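(* Let $N\ge1$ and $k\ge1$. Let $0=n_0\le n_1\le\dots\le n_k\le n_{k+1}=\infty$, where $n_0,\dots,n_k$ are integers, and let $s_1,\dots,s_k$ be complex numbers such that $s_k-s_j\ne-1$ for all $j$. Put $s_0=0$. If $a\in\Phi_r(K_1^1)$ is an $N\times N$ matrix function, then $$\det\Bigl(I+\sum_{j=1}^k(s_j-s_{j-1})\bigl(P-L(a)Q_{n_j}L(a^{-1})\bigr)\Bigr)$$ $$=\Bigl(\prod_{j=0}^{k-1}(1+s_k-s_j)^{N(n_{j+1}-n_j)}\Bigr)\det\Bigl(I-\Bigl(\sum_{j=1}^k\frac{s_ks_j}{1+s_k-s_j}P_{[n_j,n_{j+1})}\Bigr)L(a^{-1})QL(a)\Bigr),$$ where $P_{[n_j,n_{j+1})}=Q_{n_j}-Q_{n_{j+1}}$ is the projection onto the coordinates $l$ with $n_j\le l<n_{j+1}$ (with $Q_\infty=0$). All operators act on $\ell^2(\mathbf Z,\mathbf C^N)$.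
   Context: $\mathbf T$ is the complex unit circle and $L^\infty=L^\infty_{N\times N}$ is the algebra of all $N\times N$ matrix functions with entries in $L^\infty(\mathbf T)$. For $a\in L^\infty$, $a_k=\frac1{2\pi}\int_0^{2\pi}a(e^{i\theta})e^{-ik\theta}\,d\theta$ ($k\in\mathbf Z$) are the Fourier coefficients. Fix any matrix norm $\|\cdot\|$ on $\mathbf C^{N\times N}$. Put $K_1^1=\{a\in L^\infty:\sum_{n\in\mathbf Z}(|n|+1)\|a_n\|<\infty\}$ and $H^\infty_\pm=\{a\in L^\infty: a_{\mp n}=0\text{ for } n>0\}$. $a\in\Phi_r(K_1^1)$ means that $a$ has a right canonical Wiener-Hopf factorization in $K_1^1$: $a=u_-u_+$ with $u_-,u_-^{-1}\in K_1^1\cap H^\infty_-$ and $u_+,u_+^{-1}\in K_1^1\cap H^\infty_+$. $L(a)=(a_{j-k})_{j,k=-\infty}^\infty$ is the block Laurent operator on $\ell^2(\mathbf Z,\mathbf C^N)$. Projections on $\ell^2(\mathbf Z,\mathbf C^N)$: $(Px)_k=x_k$ for $k\ge0$ and $0$ for $k<0$; $Q=I-P$; for $n\in\mathbf Z$, $(Q_nx)_k=x_k$ for $k\ge n$ and $0$ for $k<n$. Determinants are Fredholm determinants of identity plus trace class operators. Powers with exponent $0$ equal $1$. *)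

theory Defs
  imports "HOL-Analysis.Analysis" "HOL-Library.Function_Algebras"
begin

text \<open>
  A matrix function on the unit circle is a function on \<^typ>\<open>complex\<close>, of which only the values
  at \<^term>\<open>cis \<theta>\<close> matter. Elements of $L^\infty$ are represented by functions, so identities
  between them are understood almost everywhere.
\<close>

type_synonym 'n matrix_fun = "complex \<Rightarrow> complex ^ 'n ^ 'n"

abbreviation angle_measure :: "real measure" where
  "angle_measure \<equiv> lebesgue_on {0..2 * pi}"

definition Linf :: "('n::finite) matrix_fun set" where
  "Linf = {a. \<forall>i j. (\<lambda>\<theta>. a (cis \<theta>) $ i $ j) \<in> borel_measurable angle_measure \<and>
                (\<exists>C. AE \<theta> in angle_measure. norm (a (cis \<theta>) $ i $ j) \<le> C)}"

definition fourier_coeff :: "('n::finite) matrix_fun \<Rightarrow> int \<Rightarrow> complex ^ 'n ^ 'n" where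
  "fourier_coeff a m =
     (\<chi> i j. complex_of_real (1 / (2 * pi)) *
        (LINT \<theta>|angle_measure. a (cis \<theta>) $ i $ j * cis (- (real_of_int m * \<theta>))))"

text \<open>
  The norm of the type \<^typ>\<open>complex ^ 'n ^ 'n\<close> is the Frobenius norm. All norms on this space are
  equivalent, so \<open>K11\<close> does not depend on this choice.
\<close>

definition K11 :: "('n::finite) matrix_fun set" where
  "K11 = {a \<in> Linf. (\<lambda>m::int. (real_of_int \<bar>m\<bar> + 1) * norm (fourier_coeff a m)) summable_on UNIV}"

definition Hinf_plus :: "('n::finite) matrix_fun set" where
  "Hinf_plus = {a \<in> Linf. \<forall>m>0. fourier_coeff a (- m) = 0}"

definition Hinf_minus :: "('n::finite) matrix_fun set" where
  "Hinf_minus = {a \<in> Linf. \<forall>m>0. fourier_coeff a m = 0}"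

text \<open>
  \<^const>\<open>matrix_inv\<close> is unspecified on singular matrices, so a statement about \<open>fun_inv u\<close> is only
  meaningful together with \<open>ae_invertible u\<close>.
\<close>

definition ae_invertible :: "('n::finite) matrix_fun \<Rightarrow> bool" where
  "ae_invertible u \<longleftrightarrow> (AE \<theta> in angle_measure. invertible (u (cis \<theta>)))"

definition fun_inv :: "('n::finite) matrix_fun \<Rightarrow> 'n matrix_fun" where
  "fun_inv u = (\<lambda>z. matrix_inv (u z))"

definition Phi_r_K11 :: "('n::finite) matrix_fun set" where
  "Phi_r_K11 = {a \<in> Linf. \<exists>um up.
      ae_invertible um \<and> um \<in> K11 \<inter> Hinf_minus \<and> fun_inv um \<in> K11 \<inter> Hinf_minus \<and>
      ae_invertible up \<and> up \<in> K11 \<inter> Hinf_plus \<and> fun_inv up \<in> K11 \<inter> Hinf_plus \<and>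
      (AE \<theta> in angle_measure. a (cis \<theta>) = um (cis \<theta>) ** up (cis \<theta>))}"

text \<open>
  The Hilbert space $\ell^2(\mathbf Z, \mathbf C^N)$, with $N$ the cardinality of \<^typ>\<open>'n\<close>, is a
  set of sequences. Operators on it are total maps on sequences of which only the restriction to
  \<open>ell2\<close> matters. They are added and subtracted pointwise and multiplied by composition.
\<close>

type_synonym 'n vseq = "int \<Rightarrow> complex ^ 'n"
type_synonym 'n oper = "'n vseq \<Rightarrow> 'n vseq"

definition ell2 :: "('n::finite) vseq set" where
  "ell2 = {x. (\<lambda>l. (norm (x l))\<^sup>2) summable_on UNIV}"

definition ell2_norm :: "('n::finite) vseq \<Rightarrow> real" where
  "ell2_norm x = sqrt (\<Sum>\<^sub>\<infinity>l. (norm (x l))\<^sup>2)"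

definition ell2_inner :: "('n::finite) vseq \<Rightarrow> 'n vseq \<Rightarrow> complex" where
  "ell2_inner x y = (\<Sum>\<^sub>\<infinity>l. \<Sum>i\<in>UNIV. x l $ i * cnj (y l $ i))"

definition op_scale :: "complex \<Rightarrow> ('n::finite) oper \<Rightarrow> 'n oper" (infixr "*\<^sub>o" 75) where
  "c *\<^sub>o T = (\<lambda>x l. c *s T x l)"

definition laurent_op :: "('n::finite) matrix_fun \<Rightarrow> 'n oper" where
  "laurent_op a = (\<lambda>x j. \<Sum>\<^sub>\<infinity>k. fourier_coeff a (j - k) *v x k)"

definition op_Qn :: "int \<Rightarrow> ('n::finite) oper" where
  "op_Qn m = (\<lambda>x l. if m \<le> l then x l else 0)"

definition op_P :: "('n::finite) oper" where
  "op_P = (\<lambda>x l. if 0 \<le> l then x l else 0)"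

definition op_Q :: "('n::finite) oper" where
  "op_Q = id - op_P"

text \<open>
  \<open>block_proj k n j\<close> is $Q_{n_j} - Q_{n_{j+1}}$ for $j \le k$, where $n_{k+1} = \infty$ and
  $Q_\infty = 0$. The value of \<open>n (Suc k)\<close> is not used.
\<close>

definition block_proj :: "nat \<Rightarrow> (nat \<Rightarrow> int) \<Rightarrow> nat \<Rightarrow> ('n::finite) oper" where
  "block_proj k n j = op_Qn (n j) - (if j < k then op_Qn (n (Suc j)) else 0)"

text \<open>
  Trace class operators, in the form of absolutely convergent (in trace norm) series of rank one
  operators $x \mapsto \langle x, v_m\rangle u_m$. The summability condition makes the series converge
  absolutely in the norm of $\ell^2$, so it is enough to describe its sum coordinatewise.
\<close>

definition trace_class :: "('n::finite) oper \<Rightarrow> bool" where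
  "trace_class T \<longleftrightarrow>
     (\<exists>u v. (\<forall>m::nat. u m \<in> ell2 \<and> v m \<in> ell2) \<and>
        summable (\<lambda>m. ell2_norm (u m) * ell2_norm (v m)) \<and>
        (\<forall>x\<in>ell2. \<forall>l. (\<lambda>m. ell2_inner x (v m) *s u m l) sums T x l))"

text \<open>
  The entry of \<open>T\<close> at row \<open>p\<close> and column \<open>q\<close> with respect to the standard orthonormal basis, which is
  indexed by \<^typ>\<open>int \<times> 'n\<close>.
\<close>

definition op_entry :: "('n::finite) oper \<Rightarrow> int \<times> 'n \<Rightarrow> int \<times> 'n \<Rightarrow> complex" where
  "op_entry T p q = T (\<lambda>l. if l = fst q then axis (snd q) 1 else 0) (fst p) $ snd p"

definition principal_minor :: "('n::finite) oper \<Rightarrow> (int \<times> 'n) set \<Rightarrow> complex" where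
  "principal_minor T S =
     (\<Sum>\<pi> | \<pi> permutes S. of_int (sign \<pi>) * (\<Prod>p\<in>S. op_entry T p (\<pi> p)))"

text \<open>
  The Fredholm determinant of \<open>A = I + T\<close> with \<open>T\<close> of trace class is
  $\sum_{m\ge0} \mathrm{tr}(\Lambda^m T)$. Evaluating the traces in the basis of $\Lambda^m$ induced
  by the standard basis gives the absolutely convergent sum of all finite principal minors of \<open>T\<close>.
  The value is not meaningful if \<open>A - id\<close> is not of trace class.
\<close>

definition fredholm_det :: "('n::finite) oper \<Rightarrow> complex" where
  "fredholm_det A = (\<Sum>\<^sub>\<infinity>S\<in>{S. finite S}. principal_minor (A - id) S)"

end

theory Submission
  imports Defs
begin

text \<open>
  The idea. Put $s = s_k$, $L = L(a)$ and $R = L^{-1}QL$, let $D$ be the diagonal operator with the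
  value $s_j$ on the block $[n_j, n_{j+1})$ and $0$ on negative coordinates, and let
  $F = I + sP - D$. Summation by parts gives $A = sP - LDL^{-1}$, so that
  $L^{-1}(I+A)L = (1+s)I - sR - D =: M$. On the other hand $F$ differs from $I$ only on the finitely
  many coordinates $0 \le l < n_k$, its determinant is the product in the theorem, and
  $F(I-B) = I + sP - D - sDR$. So the claim is that $M$ and $F(I-B)$ have the same determinant.

  The factorization $a = u_-u_+$ gives $L = U_-U_+$, where $U_-^{\pm1}$ leave the range of $Q$
  invariant and $U_+^{\pm1}$ leave the range of $P$ invariant. The operator
  $X = U_-^{-1}QU_- - Q$ satisfies $X = QX$ and $XQ = 0$, so $I + sX$ is unipotent, and so is its
  conjugate $N = U_+^{-1}(I + sX)U_+$. Now $Q(MN - I) = 0$ and $(MN - I)P = (F(I-B) - I)P$: both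
  $MN$ and $F(I-B)$ are block triangular with respect to $I = P + Q$, with the identity as the block
  of $Q$ and with the same block of $P$. Hence $\det M = \det M \det N = \det MN = \det F(I-B)$.
  The more obvious route multiplies $M$ by the inverse of $I + sP$, which does not exist for
  $s = -1$; the factor $N$ works for all $s$. This algebra is \<open>wiener_hopf_algebra\<close>, and
  \<open>bdet_wiener_hopf\<close> draws the conclusion for determinants.

  Apart from the determinant of $F$, only two facts about determinants enter, $\det(I+S)(I+T) = \det(I+S)\det(I+T)$ and
  $\det(I+ST) = \det(I+TS)$; the second one gives both the similarity invariance and the comparison
  of the block triangular operators. The weight $|n|+1$ of $K_1^1$ says precisely that the Hankel
  blocks $PL(a)Q$ and $QL(a)P$ have absolutely summable matrix entries, so every operator of which a
  determinant is taken is the identity plus a matrix with summable entries. For such matrices $T$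
  the sum of all principal minors is dominated by $\prod_p (1 + \sum_q |T_{pq}|)$, hence it is
  continuous under dominated entrywise convergence, and both facts follow from finite matrices
  (\<open>bdet_mult\<close>, \<open>bdet_mult_commute\<close>). Matrices with bounded row and column sums form a ring in
  which the summable ones are an ideal, and this ring carries all the operator algebra.

  The link to functions is that $L(uv) = L(u)L(v)$, that is, that Fourier coefficients of products
  are convolutions. For symbols with summable coefficients this follows once such a symbol is
  almost everywhere the sum of its Fourier series, which is the uniqueness theorem for Fourier
  coefficients (\<open>fourier_uniqueness\<close>).
\<close>

no_notation Infinite_Set_Sum.abs_summable_on (infix \<open>abs'_summable'_on\<close> 50)
section \<open>Determinants over finite index sets\<close>

definition set_det :: "'a set \<Rightarrow> ('a \<Rightarrow> 'a \<Rightarrow> complex) \<Rightarrow> complex" where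
  "set_det S M = (\<Sum>\<pi> | \<pi> permutes S. of_int (sign \<pi>) * (\<Prod>p\<in>S. M p (\<pi> p)))"

lemma set_det_cong:
  assumes "\<And>p q. p \<in> S \<Longrightarrow> q \<in> S \<Longrightarrow> M p q = M' p q"
  shows "set_det S M = set_det S M'"
  unfolding set_det_def
  by (intro sum.cong prod.cong refl arg_cong2[where f="(*)"])
     (use assms permutes_in_image in fastforce)

text \<open>
  Substituting $\pi \circ f$ for $\pi$ moves the row permutation into the sign.
\<close>

lemma set_det_permuted_rows:
  assumes S: "finite S" and f: "f permutes S"
  shows "(\<Sum>\<pi> | \<pi> permutes S. of_int (sign \<pi>) * (\<Prod>p\<in>S. M (f p) (\<pi> p))) =
         of_int (sign f) * set_det S M"
proof -
  have "(\<Sum>\<pi> | \<pi> permutes S. of_int (sign \<pi>) * (\<Prod>p\<in>S. M (f p) (\<pi> p))) =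
        (\<Sum>\<pi> | \<pi> permutes S. of_int (sign (\<pi> \<circ> f)) * (\<Prod>p\<in>S. M (f p) ((\<pi> \<circ> f) p)))"
    by (rule sum_permutations_compose_right[OF f])
  also have "\<dots> = (\<Sum>\<pi> | \<pi> permutes S. of_int (sign f) * (of_int (sign \<pi>) * (\<Prod>p\<in>S. M p (\<pi> p))))"
  proof (rule sum.cong[OF refl])
    fix \<pi> assume "\<pi> \<in> {\<pi>. \<pi> permutes S}"
    then have "sign (\<pi> \<circ> f) = sign \<pi> * sign f"
      using S f by (auto intro!: sign_compose permutation_permutes[THEN iffD2])
    moreover have "(\<Prod>p\<in>S. M (f p) ((\<pi> \<circ> f) p)) = (\<Prod>p\<in>S. M p (\<pi> p))"
      using prod.reindex_bij_betw[OF permutes_imp_bij[OF f], of "\<lambda>p. M p (\<pi> p)"] by simp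
    ultimately show "of_int (sign (\<pi> \<circ> f)) * (\<Prod>p\<in>S. M (f p) ((\<pi> \<circ> f) p)) =
        of_int (sign f) * (of_int (sign \<pi>) * (\<Prod>p\<in>S. M p (\<pi> p)))"
      by simp
  qed
  finally show ?thesis
    by (simp add: set_det_def sum_distrib_left)
qed

text \<open>
  Composition with the transposition of the two equal rows is a sign reversing involution of the terms.
\<close>

lemma set_det_repeated_row:
  assumes S: "finite S" and ab: "a \<in> S" "b \<in> S" "a \<noteq> b" "f a = f b"
  shows "(\<Sum>\<pi> | \<pi> permutes S. of_int (sign \<pi>) * (\<Prod>p\<in>S. M (f p) (\<pi> p)) :: complex) = 0"
proof -
  let ?t = "Transposition.transpose a b"
  have t: "?t permutes S" using ab by (simp add: permutes_swap_id)
  let ?g = "\<lambda>\<pi>. of_int (sign \<pi>) * (\<Prod>p\<in>S. M (f p) (\<pi> p)) :: complex"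
  have ft: "f (?t p) = f p" for p
    using ab(4) by (auto simp: Transposition.transpose_def)
  have "sum ?g {\<pi>. \<pi> permutes S} = (\<Sum>\<pi> | \<pi> permutes S. ?g (\<pi> \<circ> ?t))"
    by (rule sum_permutations_compose_right[OF t])
  also have "\<dots> = (\<Sum>\<pi> | \<pi> permutes S. - ?g \<pi>)"
  proof (rule sum.cong[OF refl])
    fix \<pi> assume "\<pi> \<in> {\<pi>. \<pi> permutes S}"
    then have "sign (\<pi> \<circ> ?t) = - sign \<pi>"
      using S t ab(3) by (subst sign_compose) (auto intro!: permutation_permutes[THEN iffD2] simp: sign_swap_id)
    moreover have "(\<Prod>p\<in>S. M (f p) ((\<pi> \<circ> ?t) p)) = (\<Prod>p\<in>S. M (f p) (\<pi> p))"
      using prod.reindex_bij_betw[OF permutes_imp_bij[OF t], of "\<lambda>p. M (f p) (\<pi> p)"]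
      by (simp add: ft)
    ultimately show "?g (\<pi> \<circ> ?t) = - ?g \<pi>"
      by simp
  qed
  finally show ?thesis
    by (simp add: sum_negf)
qed

theorem set_det_mult:
  assumes S: "finite S"
  shows "set_det S (\<lambda>p q. \<Sum>r\<in>S. A p r * B r q) = set_det S A * set_det S B"
proof -
  let ?inner = "\<lambda>f. \<Sum>\<pi> | \<pi> permutes S. of_int (sign \<pi>) * (\<Prod>p\<in>S. B (f p) (\<pi> p))"
  have "set_det S (\<lambda>p q. \<Sum>r\<in>S. A p r * B r q) =
        (\<Sum>\<pi> | \<pi> permutes S. of_int (sign \<pi>) *
           (\<Sum>f\<in>PiE S (\<lambda>_. S). (\<Prod>p\<in>S. A p (f p) * B (f p) (\<pi> p))))"
    unfolding set_det_def by (subst prod_sum_PiE) (simp_all add: S)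
  also have "\<dots> = (\<Sum>f\<in>PiE S (\<lambda>_. S). (\<Prod>p\<in>S. A p (f p)) * ?inner f)"
    by (simp add: sum_distrib_left prod.distrib mult_ac) (rule sum.swap)
  \<comment> \<open>A choice of columns that is not injective repeats a row of \<open>B\<close>; the injective ones are the permutations.\<close>
  also have "\<dots> = (\<Sum>f\<in>{f\<in>PiE S (\<lambda>_. S). inj_on f S}. (\<Prod>p\<in>S. A p (f p)) * ?inner f)"
  proof (rule sum.mono_neutral_right)
    show "finite (PiE S (\<lambda>_. S))"
      by (rule finite_PiE) (use S in auto)
    show "\<forall>f\<in>PiE S (\<lambda>_. S) - {f \<in> PiE S (\<lambda>_. S). inj_on f S}. (\<Prod>p\<in>S. A p (f p)) * ?inner f = 0"
    proof
      fix f assume "f \<in> PiE S (\<lambda>_. S) - {f \<in> PiE S (\<lambda>_. S). inj_on f S}"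
      then obtain a b where "a \<in> S" "b \<in> S" "a \<noteq> b" "f a = f b"
        by (auto simp: inj_on_def)
      from set_det_repeated_row[OF S this, of B] show "(\<Prod>p\<in>S. A p (f p)) * ?inner f = 0"
        by simp
    qed
  qed auto
  also have "\<dots> = (\<Sum>\<sigma> | \<sigma> permutes S. (\<Prod>p\<in>S. A p (\<sigma> p)) * ?inner \<sigma>)"
  proof (rule sum.reindex_bij_witness[where i="\<lambda>\<sigma>. restrict \<sigma> S" and j="\<lambda>f p. if p \<in> S then f p else p"])
    fix f assume f: "f \<in> {f \<in> PiE S (\<lambda>_. S). inj_on f S}"
    then have "f ` S = S"
      by (intro card_subset_eq[OF S]) (auto simp: card_image)
    then have "bij_betw f S S"
      using f by (auto simp: bij_betw_def)
    then have "bij_betw (\<lambda>p. if p \<in> S then f p else p) S S"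
      by (subst bij_betw_cong[of S _ f]) auto
    then show "(\<lambda>p. if p \<in> S then f p else p) \<in> {\<sigma>. \<sigma> permutes S}"
      by (auto intro: bij_imp_permutes)
    show "restrict (\<lambda>p. if p \<in> S then f p else p) S = f"
      using f by (auto simp: fun_eq_iff restrict_def PiE_def extensional_def)
  next
    fix \<sigma> assume "\<sigma> \<in> {\<sigma>. \<sigma> permutes S}"
    then have \<sigma>: "\<sigma> permutes S" by simp
    show "restrict \<sigma> S \<in> {f \<in> PiE S (\<lambda>_. S). inj_on f S}"
      using \<sigma> by (auto simp: permutes_in_image inj_on_def dest: permutes_inj[THEN injD])
    show "(\<lambda>p. if p \<in> S then restrict \<sigma> S p else p) = \<sigma>"
      using \<sigma> by (auto simp: fun_eq_iff permutes_not_in)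
  qed (auto intro!: sum.cong arg_cong2[where f="(*)"] prod.cong)
  also have "\<dots> = (\<Sum>\<sigma> | \<sigma> permutes S. (\<Prod>p\<in>S. A p (\<sigma> p)) * (of_int (sign \<sigma>) * set_det S B))"
    by (intro sum.cong refl) (simp add: set_det_permuted_rows S)
  also have "\<dots> = set_det S A * set_det S B"
    by (simp add: set_det_def sum_distrib_right mult_ac)
  finally show ?thesis .
qed

definition kron :: "'a \<Rightarrow> 'a \<Rightarrow> complex" where
  "kron p q = (if p = q then 1 else 0)"

text \<open>
  In the expansion of the product of the entries of $I + K$ along a permutation, the factors taken
  from $I$ force the permutation to fix their rows, so a choice of the other rows $S$ leaves the minor
  of $K$ on $S$.
\<close>

lemma sum_principal_minors:
  assumes F: "finite F"
  shows "(\<Sum>S\<in>Pow F. set_det S K) = set_det F (\<lambda>p q. kron p q + K p q)"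
proof -
  have "set_det F (\<lambda>p q. kron p q + K p q) =
        (\<Sum>\<pi> | \<pi> permutes F. \<Sum>S\<in>Pow F. of_int (sign \<pi>) *
           ((\<Prod>p\<in>S. K p (\<pi> p)) * (\<Prod>p\<in>F-S. kron p (\<pi> p))))"
    unfolding set_det_def
    by (subst add.commute, subst prod_add[OF F]) (simp add: sum_distrib_left)
  also have "\<dots> = (\<Sum>S\<in>Pow F. \<Sum>\<pi> | \<pi> permutes F. of_int (sign \<pi>) *
           ((\<Prod>p\<in>S. K p (\<pi> p)) * (\<Prod>p\<in>F-S. kron p (\<pi> p))))"
    by (rule sum.swap)
  also have "\<dots> = (\<Sum>S\<in>Pow F. set_det S K)"
  proof (rule sum.cong[OF refl])
    fix S assume S: "S \<in> Pow F"
    show "(\<Sum>\<pi> | \<pi> permutes F. of_int (sign \<pi>) *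
           ((\<Prod>p\<in>S. K p (\<pi> p)) * (\<Prod>p\<in>F-S. kron p (\<pi> p)))) = set_det S K"
      unfolding set_det_def
    proof (rule sum.mono_neutral_cong_right)
      show "finite {\<pi>. \<pi> permutes F}" using F by (rule finite_permutations)
      show "{\<pi>. \<pi> permutes S} \<subseteq> {\<pi>. \<pi> permutes F}"
        using S by (auto intro: permutes_subset)
      show "\<forall>\<pi>\<in>{\<pi>. \<pi> permutes F} - {\<pi>. \<pi> permutes S}. of_int (sign \<pi>) *
           ((\<Prod>p\<in>S. K p (\<pi> p)) * (\<Prod>p\<in>F-S. kron p (\<pi> p))) = 0"
      proof
        fix \<pi> assume \<pi>: "\<pi> \<in> {\<pi>. \<pi> permutes F} - {\<pi>. \<pi> permutes S}"
        then have "\<exists>p\<in>F-S. \<pi> p \<noteq> p"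
          using permutes_superset by (metis (no_types, lifting) DiffE mem_Collect_eq)
        then show "of_int (sign \<pi>) * ((\<Prod>p\<in>S. K p (\<pi> p)) * (\<Prod>p\<in>F-S. kron p (\<pi> p))) = 0"
          using F by (auto simp: kron_def)
      qed
    next
      fix \<pi> assume "\<pi> \<in> {\<pi>. \<pi> permutes S}"
      then have "(\<Prod>p\<in>F-S. kron p (\<pi> p)) = 1"
        by (intro prod.neutral) (auto simp: kron_def permutes_not_in)
      then show "of_int (sign \<pi>) * ((\<Prod>p\<in>S. K p (\<pi> p)) * (\<Prod>p\<in>F-S. kron p (\<pi> p))) =
          of_int (sign \<pi>) * (\<Prod>p\<in>S. K p (\<pi> p))"
        by simp
    qed
  qed
  finally show ?thesis by simp
qed

lemma set_det_image:
  assumes S: "finite S" and f: "inj_on f S"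
  shows "set_det (f ` S) M = set_det S (\<lambda>p q. M (f p) (f q))"
proof -
  have bij: "bij_betw (map_permutation S f) {\<pi>. \<pi> permutes S} {\<pi>. \<pi> permutes f ` S}"
  proof (rule bij_betw_byWitness[where f'="map_permutation (f ` S) (inv_into S f)"])
    have b: "bij_betw f S (f ` S)" "bij_betw (inv_into S f) (f ` S) S"
      using f by (auto simp: bij_betw_def inj_on_inv_into)
    show "\<forall>\<pi>\<in>{\<pi>. \<pi> permutes S}. map_permutation (f ` S) (inv_into S f) (map_permutation S f \<pi>) = \<pi>"
      using f by (auto intro!: map_permutation_compose_inv[OF b(1)])
    show "\<forall>\<pi>\<in>{\<pi>. \<pi> permutes f ` S}. map_permutation S f (map_permutation (f ` S) (inv_into S f) \<pi>) = \<pi>"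
    proof safe
      fix \<pi> assume "\<pi> permutes f ` S"
      then show "map_permutation S f (map_permutation (f ` S) (inv_into S f) \<pi>) = \<pi>"
        by (rule map_permutation_compose_inv[OF b(2)]) (rule f_inv_into_f)
    qed
    show "map_permutation S f ` {\<pi>. \<pi> permutes S} \<subseteq> {\<pi>. \<pi> permutes f ` S}"
      using map_permutation_permutes[OF b(1)] by blast
    show "map_permutation (f ` S) (inv_into S f) ` {\<pi>. \<pi> permutes f ` S} \<subseteq> {\<pi>. \<pi> permutes S}"
      using map_permutation_permutes[OF b(2)] by blast
  qed
  have "set_det (f ` S) M = (\<Sum>\<pi> | \<pi> permutes S. of_int (sign (map_permutation S f \<pi>)) *
          (\<Prod>p\<in>f ` S. M p (map_permutation S f \<pi> p)))"
    unfolding set_det_def by (rule sum.reindex_bij_betw[OF bij, symmetric])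
  also have "\<dots> = set_det S (\<lambda>p q. M (f p) (f q))"
    unfolding set_det_def
    by (intro sum.cong refl)
       (use S f in \<open>auto simp: sign_map_permutation prod.reindex map_permutation_apply permutes_in_image\<close>)
  finally show ?thesis .
qed

lemma set_det_zero_column:
  assumes S: "finite S" and q: "q \<in> S" "\<And>p. p \<in> S \<Longrightarrow> M p q = 0"
  shows "set_det S M = 0"
  unfolding set_det_def
proof (rule sum.neutral, safe)
  fix \<pi> assume \<pi>: "\<pi> permutes S"
  have "M (inv \<pi> q) (\<pi> (inv \<pi> q)) = 0" "inv \<pi> q \<in> S"
    using q \<pi> by (auto simp: permutes_inverses permutes_in_image[OF permutes_inv])
  then show "of_int (sign \<pi>) * (\<Prod>p\<in>S. M p (\<pi> p)) = 0"
    using S by (auto intro!: prod_zero)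
qed

section \<open>The ring of matrices with bounded row and column sums\<close>

definition row_bounded :: "('i \<Rightarrow> 'j \<Rightarrow> complex) \<Rightarrow> real \<Rightarrow> bool" where
  "row_bounded A C \<longleftrightarrow> (\<forall>p F. finite F \<longrightarrow> (\<Sum>q\<in>F. cmod (A p q)) \<le> C)"

lemma row_boundedD: "row_bounded A C \<Longrightarrow> finite F \<Longrightarrow> (\<Sum>q\<in>F. cmod (A p q)) \<le> C"
  by (auto simp: row_bounded_def)

lemma row_bounded_nonneg: "row_bounded A C \<Longrightarrow> 0 \<le> C"
  using row_boundedD[of A C "{}"] by simp

lemma row_bounded_entry: "row_bounded A C \<Longrightarrow> cmod (A p q) \<le> C"
  using row_boundedD[of A C "{q}"] by simp

lemma row_bounded_abs_summable: "row_bounded A C \<Longrightarrow> A p abs_summable_on X"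
  by (rule nonneg_bdd_above_summable_on) (auto intro!: bdd_aboveI2[where M=C] row_boundedD)

lemma row_bounded_infsum: "row_bounded A C \<Longrightarrow> (\<Sum>\<^sub>\<infinity>q. cmod (A p q)) \<le> C"
  by (rule infsum_le_finite_sums) (auto intro: row_bounded_abs_summable row_boundedD)

lemma row_bounded_times_bounded:
  assumes A: "row_bounded A C" and x: "\<And>q. cmod (x q) \<le> M"
  shows "(\<lambda>q. A p q * x q) abs_summable_on UNIV"
    and "(\<Sum>\<^sub>\<infinity>q. cmod (A p q * x q)) \<le> C * M"
proof -
  have sm: "(\<lambda>q. cmod (A p q) * M) summable_on UNIV"
    by (intro summable_on_cmult_left row_bounded_abs_summable[OF A])
  have le: "cmod (A p q * x q) \<le> cmod (A p q) * M" for q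
    unfolding norm_mult by (intro mult_left_mono x) auto
  show 1: "(\<lambda>q. A p q * x q) abs_summable_on UNIV"
    by (rule Infinite_Sum.abs_summable_on_comparison_test'[OF sm]) (use le in auto)
  have "(\<Sum>\<^sub>\<infinity>q. cmod (A p q * x q)) \<le> (\<Sum>\<^sub>\<infinity>q. cmod (A p q) * M)"
    by (intro infsum_mono 1 sm le)
  also have "\<dots> = (\<Sum>\<^sub>\<infinity>q. cmod (A p q)) * M"
    by (rule infsum_cmult_left')
  also have "\<dots> \<le> C * M"
    using x[of undefined] norm_ge_zero[of "x undefined"]
    by (intro mult_right_mono row_bounded_infsum[OF A]) linarith
  finally show "(\<Sum>\<^sub>\<infinity>q. cmod (A p q * x q)) \<le> C * M" .
qed

lemma row_bounded_apply_le:
  assumes A: "row_bounded A C" and x: "\<And>q. cmod (x q) \<le> M"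
  shows "cmod (\<Sum>\<^sub>\<infinity>q. A p q * x q) \<le> C * M"
  using norm_infsum_bound[OF row_bounded_times_bounded(1)[OF assms]] row_bounded_times_bounded(2)[OF assms]
  by (rule order_trans)

lemma has_sum_sum:
  fixes f :: "'a \<Rightarrow> 'b \<Rightarrow> 'c::topological_comm_monoid_add"
  assumes "finite F" "\<And>q. q \<in> F \<Longrightarrow> (f q has_sum s q) X"
  shows "((\<lambda>r. \<Sum>q\<in>F. f q r) has_sum (\<Sum>q\<in>F. s q)) X"
  using assms by (induction F rule: finite_induct) (auto intro: has_sum_add)

definition mat_mult :: "('i \<Rightarrow> 'j \<Rightarrow> complex) \<Rightarrow> ('j \<Rightarrow> 'k \<Rightarrow> complex) \<Rightarrow> 'i \<Rightarrow> 'k \<Rightarrow> complex" where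
  "mat_mult A B p q = (\<Sum>\<^sub>\<infinity>r. A p r * B r q)"

lemma row_bounded_mult:
  assumes A: "row_bounded A C" and B: "row_bounded B D"
  shows "row_bounded (mat_mult A B) (C * D)"
  unfolding row_bounded_def
proof safe
  fix p F assume F: "finite (F :: 'c set)"
  have sm: "(\<lambda>r. A p r * B r q) abs_summable_on UNIV" for q
    by (rule row_bounded_times_bounded(1)[OF A row_bounded_entry[OF B]])
  have hs: "((\<lambda>r. \<Sum>q\<in>F. cmod (A p r * B r q)) has_sum (\<Sum>q\<in>F. \<Sum>\<^sub>\<infinity>r. cmod (A p r * B r q))) UNIV"
    by (intro has_sum_sum F has_sum_infsum sm)
  have "(\<Sum>q\<in>F. cmod (mat_mult A B p q)) \<le> (\<Sum>q\<in>F. \<Sum>\<^sub>\<infinity>r. cmod (A p r * B r q))"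
    unfolding mat_mult_def by (intro sum_mono norm_infsum_bound sm)
  also have "\<dots> \<le> (\<Sum>\<^sub>\<infinity>r. cmod (A p r) * D)"
  proof (rule has_sum_mono[OF hs has_sum_infsum])
    show "(\<lambda>r. cmod (A p r) * D) summable_on UNIV"
      by (intro summable_on_cmult_left row_bounded_abs_summable[OF A])
    show "(\<Sum>q\<in>F. cmod (A p r * B r q)) \<le> cmod (A p r) * D" for r
      by (auto simp: norm_mult simp flip: sum_distrib_left intro!: mult_left_mono row_boundedD[OF B F])
  qed
  also have "\<dots> \<le> C * D"
    unfolding infsum_cmult_left'
    by (intro mult_right_mono row_bounded_infsum[OF A] row_bounded_nonneg[OF B])
  finally show "(\<Sum>q\<in>F. cmod (mat_mult A B p q)) \<le> C * D" .
qed

text \<open>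
  Associativity of the matrix action on bounded vectors, by Fubini. Columns of matrices with bounded
  entries are bounded vectors, so associativity of the product is a special case.
\<close>

lemma mat_mult_apply:
  assumes A: "row_bounded A C" and B: "row_bounded B D" and x: "\<And>q. cmod (x q) \<le> M"
  shows "(\<Sum>\<^sub>\<infinity>q. mat_mult A B p q * x q) = (\<Sum>\<^sub>\<infinity>r. A p r * (\<Sum>\<^sub>\<infinity>q. B r q * x q))"
proof -
  have "(\<lambda>(r, q). A p r * (B r q * x q)) abs_summable_on UNIV \<times> UNIV"
    unfolding Infinite_Sum.abs_summable_on_Sigma_iff
  proof (intro conjI ballI)
    fix r
    show "(\<lambda>q. cmod (case (r, q) of (r, q) \<Rightarrow> A p r * (B r q * x q))) summable_on UNIV"
      using row_bounded_times_bounded(1)[OF B x, of r]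
      by (simp add: norm_mult mult.assoc summable_on_cmult_right)
  next
    have "(\<lambda>r. cmod (A p r * of_real (\<Sum>\<^sub>\<infinity>q. cmod (B r q * x q)))) summable_on UNIV"
      by (rule row_bounded_times_bounded(1)[OF A, where M="D * M"])
         (use row_bounded_times_bounded(2)[OF B x] in \<open>simp add: infsum_nonneg\<close>)
    moreover have "cmod (A p r * of_real (\<Sum>\<^sub>\<infinity>q. cmod (B r q * x q))) =
        norm (\<Sum>\<^sub>\<infinity>q. cmod (A p r * (B r q * x q)))" for r
      unfolding norm_mult infsum_cmult_right' by (simp add: infsum_nonneg)
    ultimately show "(\<lambda>r. norm (\<Sum>\<^sub>\<infinity>q. cmod (case (r, q) of (r, q) \<Rightarrow> A p r * (B r q * x q)))) summable_on UNIV"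
      by simp
  qed
  then have sm: "(\<lambda>(r, q). A p r * (B r q * x q)) summable_on UNIV \<times> UNIV"
    by (rule abs_summable_summable)
  have "(\<Sum>\<^sub>\<infinity>q. mat_mult A B p q * x q) = (\<Sum>\<^sub>\<infinity>q. \<Sum>\<^sub>\<infinity>r. A p r * (B r q * x q))"
    unfolding mat_mult_def by (simp add: mult.assoc flip: infsum_cmult_left')
  also have "\<dots> = (\<Sum>\<^sub>\<infinity>r. \<Sum>\<^sub>\<infinity>q. A p r * (B r q * x q))"
    by (rule infsum_swap_banach[OF sm, symmetric])
  also have "\<dots> = (\<Sum>\<^sub>\<infinity>r. A p r * (\<Sum>\<^sub>\<infinity>q. B r q * x q))"
    by (simp flip: infsum_cmult_right')
  finally show ?thesis .
qed

lemma mat_mult_transpose: "mat_mult A B p q = mat_mult (\<lambda>q r. B r q) (\<lambda>r p. A p r) q p"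
  by (simp add: mat_mult_def mult.commute)

definition row_col_bounded :: "('i \<Rightarrow> 'j \<Rightarrow> complex) \<Rightarrow> bool" where
  "row_col_bounded A \<longleftrightarrow> (\<exists>C. row_bounded A C \<and> row_bounded (\<lambda>q p. A p q) C)"

lemma row_bounded_mono: "row_bounded A C \<Longrightarrow> C \<le> D \<Longrightarrow> row_bounded A D"
  unfolding row_bounded_def by (meson order_trans)

lemma row_col_boundedI: "row_bounded A C \<Longrightarrow> row_bounded (\<lambda>q p. A p q) D \<Longrightarrow> row_col_bounded A"
  unfolding row_col_bounded_def
  by (rule exI[of _ "max C D"]) (auto intro: row_bounded_mono)

lemma row_bounded_add:
  "row_bounded A C \<Longrightarrow> row_bounded B D \<Longrightarrow> row_bounded (\<lambda>p q. A p q + B p q) (C + D)"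
  unfolding row_bounded_def
  by (auto intro!: order_trans[OF sum_mono[OF norm_triangle_ineq]] add_mono simp: sum.distrib)

lemma row_col_bounded_mult:
  assumes "row_col_bounded A" "row_col_bounded B"
  shows "row_col_bounded (mat_mult A B)"
proof -
  obtain C D where "row_bounded A C" "row_bounded (\<lambda>q p. A p q) C"
    "row_bounded B D" "row_bounded (\<lambda>q p. B p q) D"
    using assms by (auto simp: row_col_bounded_def)
  then show ?thesis
    by (intro row_col_boundedI[of _ "C * D" "D * C"] row_bounded_mult)
       (auto simp: mat_mult_transpose[of A B] intro!: row_bounded_mult)
qed

lemma row_col_bounded_diag:
  assumes "\<And>p. cmod (d p) \<le> M"
  shows "row_col_bounded (\<lambda>p q. if p = q then d p else 0)"
proof -
  have M: "0 \<le> M" using assms[of undefined] norm_ge_zero order_trans by blast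
  have *: "row_bounded (\<lambda>p q. if p = q then d p else 0) M"
    unfolding row_bounded_def
  proof safe
    fix p F assume F: "finite (F :: 'a set)"
    have "(\<Sum>q\<in>F. cmod (if p = q then d p else 0)) = (\<Sum>q\<in>F. if p = q then cmod (d p) else 0)"
      by (rule sum.cong) auto
    also have "\<dots> \<le> M"
      using F M assms[of p] by (simp add: sum.delta')
    finally show "(\<Sum>q\<in>F. cmod (if p = q then d p else 0)) \<le> M" .
  qed
  moreover have "(\<lambda>q p. if p = q then d p else 0) = (\<lambda>p q. if p = q then d p else 0)"
    by (auto simp: fun_eq_iff)
  ultimately show ?thesis
    by (intro row_col_boundedI[of _ M M]) simp_all
qed

text \<open>
  Bounded row sums give the product and its associativity; bounded column sums make the set of matrices
  with summable entries stable under multiplication from the left.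
\<close>

typedef 'i bmat = "{A :: 'i \<Rightarrow> 'i \<Rightarrow> complex. row_col_bounded A}"
  morphisms entry Abs_bmat
  using row_col_bounded_diag[of "\<lambda>_. 0" 0] by fastforce

setup_lifting type_definition_bmat

lemma bmat_eqI: "(\<And>p q. entry A p q = entry B p q) \<Longrightarrow> A = B"
  by (auto simp flip: entry_inject simp: fun_eq_iff)

lemma row_col_bounded_entry: "row_col_bounded (entry A)"
  using entry[of A] by simp

text \<open>
  The value is $0$ for unbounded \<open>d\<close>, which does not define a matrix of this type.
\<close>

lift_definition diag :: "('i \<Rightarrow> complex) \<Rightarrow> 'i bmat" is
  "\<lambda>d p q. if p = q \<and> bounded (range d) then d p else 0"
proof -
  fix d :: "'i \<Rightarrow> complex"
  show "row_col_bounded (\<lambda>p q. if p = q \<and> bounded (range d) then d p else 0)"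
  proof (cases "bounded (range d)")
    case True
    then obtain M where M: "\<forall>x\<in>range d. cmod x \<le> M" unfolding bounded_iff by blast
    have "row_col_bounded (\<lambda>p q. if p = q then d p else 0)"
      by (rule row_col_bounded_diag[of d M]) (use M in blast)
    with True show ?thesis by (simp only: simp_thms)
  next
    case False
    have "row_col_bounded (\<lambda>p q::'i. if p = q then 0 else 0)"
      by (rule row_col_bounded_diag[of "\<lambda>_. 0" 0]) simp
    with False show ?thesis by (simp only: simp_thms if_False if_cancel)
  qed
qed

instantiation bmat :: (type) ring_1
begin

lift_definition zero_bmat :: "'a bmat" is "\<lambda>_ _. 0"
  by (rule row_col_boundedI[of _ 0 0]) (simp_all add: row_bounded_def)

lift_definition one_bmat :: "'a bmat" is kron
  unfolding kron_def[abs_def] by (rule row_col_bounded_diag[where M=1]) simp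

lift_definition plus_bmat :: "'a bmat \<Rightarrow> 'a bmat \<Rightarrow> 'a bmat" is "\<lambda>A B p q. A p q + B p q"
proof -
  fix A B :: "'a \<Rightarrow> 'a \<Rightarrow> complex" assume "row_col_bounded A" "row_col_bounded B"
  then obtain C D where "row_bounded A C" "row_bounded (\<lambda>q p. A p q) C"
    "row_bounded B D" "row_bounded (\<lambda>q p. B p q) D"
    by (auto simp: row_col_bounded_def)
  then show "row_col_bounded (\<lambda>p q. A p q + B p q)"
    by (intro row_col_boundedI[of _ "C + D" "C + D"] row_bounded_add)
qed

lift_definition uminus_bmat :: "'a bmat \<Rightarrow> 'a bmat" is "\<lambda>A p q. - A p q"
  by (auto simp: row_col_bounded_def row_bounded_def)

definition minus_bmat :: "'a bmat \<Rightarrow> 'a bmat \<Rightarrow> 'a bmat" where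
  "minus_bmat A B = A + (- B)"

lift_definition times_bmat :: "'a bmat \<Rightarrow> 'a bmat \<Rightarrow> 'a bmat" is mat_mult
  by (rule row_col_bounded_mult)

lemma row_col_bounded_summable:
  assumes "row_col_bounded A" "row_col_bounded B"
  shows "(\<lambda>r. A p r * B r q) summable_on UNIV"
proof -
  obtain C D where "row_bounded A C" "row_bounded B D"
    using assms by (auto simp: row_col_bounded_def)
  then have "(\<lambda>r. A p r * B r q) abs_summable_on UNIV"
    by (rule row_bounded_times_bounded(1)[OF _ row_bounded_entry])
  then show ?thesis
    by (rule abs_summable_summable)
qed

instance
proof
  fix A B C :: "'a bmat"
  show "A * B * C = A * (B * C)"
  proof transfer
    fix A B C :: "'a \<Rightarrow> 'a \<Rightarrow> complex"
    assume "row_col_bounded A" "row_col_bounded B" "row_col_bounded C"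
    then obtain a b c where "row_bounded A a" "row_bounded B b" "row_bounded C c"
      by (auto simp: row_col_bounded_def)
    then have "(\<Sum>\<^sub>\<infinity>q'. mat_mult A B p q' * C q' q) = (\<Sum>\<^sub>\<infinity>r. A p r * (\<Sum>\<^sub>\<infinity>q'. B r q' * C q' q))" for p q
      by (rule mat_mult_apply[OF _ _ row_bounded_entry])
    then show "mat_mult (mat_mult A B) C = mat_mult A (mat_mult B C)"
      by (simp add: fun_eq_iff mat_mult_def[of _ C] mat_mult_def[of A "mat_mult B C"])
  qed
  show "1 * A = A"
  proof transfer
    fix A :: "'a \<Rightarrow> 'a \<Rightarrow> complex"
    have "mat_mult kron A p q = (\<Sum>\<^sub>\<infinity>r\<in>{p}. kron p r * A r q)" for p q
      unfolding mat_mult_def by (rule infsum_cong_neutral) (auto simp: kron_def)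
    then show "mat_mult kron A = A" by (simp add: fun_eq_iff kron_def)
  qed
  show "A * 1 = A"
  proof transfer
    fix A :: "'a \<Rightarrow> 'a \<Rightarrow> complex"
    have "mat_mult A kron p q = (\<Sum>\<^sub>\<infinity>r\<in>{q}. A p r * kron r q)" for p q
      unfolding mat_mult_def by (rule infsum_cong_neutral) (auto simp: kron_def)
    then show "mat_mult A kron = A" by (simp add: fun_eq_iff kron_def)
  qed
  show "(A + B) * C = A * C + B * C"
    by transfer (auto simp: fun_eq_iff mat_mult_def ring_distribs infsum_add row_col_bounded_summable)
  show "A * (B + C) = A * B + A * C"
    by transfer (auto simp: fun_eq_iff mat_mult_def ring_distribs infsum_add row_col_bounded_summable)
  show "A + B + C = A + (B + C)" "A + B = B + A" "0 + A = A" "- A + A = 0"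
    by (transfer; simp add: fun_eq_iff)+
  show "A - B = A + (- B)"
    by (simp add: minus_bmat_def)
  show "(0 :: 'a bmat) \<noteq> 1"
    by transfer (auto simp: fun_eq_iff kron_def)
qed

end

lemma entry_simps [simp]:
  "entry 0 p q = 0" "entry 1 p q = kron p q" "entry (A + B) p q = entry A p q + entry B p q"
  "entry (- A) p q = - entry A p q"
  by (transfer; simp)+

lemma entry_minus [simp]: "entry (A - B) p q = entry A p q - entry B p q"
  by (simp only: minus_bmat_def entry_simps diff_conv_add_uminus)

lemma entry_times: "entry (A * B) p q = (\<Sum>\<^sub>\<infinity>r. entry A p r * entry B r q)"
  by transfer (simp add: mat_mult_def)

lemma entry_sum [simp]: "entry (\<Sum>i\<in>I. f i) p q = (\<Sum>i\<in>I. entry (f i) p q)"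
  by (induction I rule: infinite_finite_induct) auto

lemma entry_diag: "bounded (range d) \<Longrightarrow> entry (diag d) p q = (if p = q then d p else 0)"
  by transfer simp

lemma entry_diag_times: "bounded (range d) \<Longrightarrow> entry (diag d * A) p q = d p * entry A p q"
proof -
  assume d: "bounded (range d)"
  have "entry (diag d * A) p q = (\<Sum>\<^sub>\<infinity>r\<in>{p}. d p * entry A r q)"
    unfolding entry_times by (rule infsum_cong_neutral) (auto simp: entry_diag d)
  then show ?thesis by simp
qed

lemma entry_times_diag: "bounded (range d) \<Longrightarrow> entry (A * diag d) p q = entry A p q * d q"
proof -
  assume d: "bounded (range d)"
  have "entry (A * diag d) p q = (\<Sum>\<^sub>\<infinity>r\<in>{q}. entry A p r * d q)"
    unfolding entry_times by (rule infsum_cong_neutral) (auto simp: entry_diag d)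
  then show ?thesis by simp
qed

definition scal :: "complex \<Rightarrow> 'i bmat" where
  "scal c = diag (\<lambda>_. c)"

lemma entry_scal_times [simp]: "entry (scal c * A) p q = c * entry A p q"
  by (simp add: scal_def entry_diag_times)

lemma scal_commute: "A * scal c = scal c * A"
  by (rule bmat_eqI) (simp add: scal_def entry_diag_times entry_times_diag)

section \<open>The ideal of matrices with absolutely summable entries\<close>

definition summable_entries :: "'i bmat \<Rightarrow> bool" where
  "summable_entries A \<longleftrightarrow> (\<lambda>(p, q). cmod (entry A p q)) summable_on UNIV"

text \<open>
  $\sum_{p,q}\sum_r |S_{pr}||T_{rq}| \le C \sum_{p,r} |S_{pr}|$. The statement keeps the absolute values
  inside the sum over $r$, because this is also the dominating function for the finite sections of
  the product.
\<close>

lemma summable_abs_mult_right: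
  assumes S: "(\<lambda>(p, q). cmod (S p q)) summable_on UNIV" and T: "row_bounded T C"
  shows "(\<lambda>(p, q). \<Sum>\<^sub>\<infinity>r. cmod (S p r) * cmod (T r q)) summable_on UNIV"
    and "(\<lambda>r. cmod (S p r) * cmod (T r q)) summable_on UNIV"
proof -
  have "(\<lambda>((p, r), q). cmod (S p r) * cmod (T r q)) abs_summable_on UNIV \<times> UNIV"
    unfolding Infinite_Sum.abs_summable_on_Sigma_iff
  proof (intro conjI ballI)
    fix x
    show "(\<lambda>q. norm ((\<lambda>((p, r), q). cmod (S p r) * cmod (T r q)) (x, q))) summable_on UNIV"
      by (cases x) (simp add: norm_mult summable_on_cmult_right row_bounded_abs_summable[OF T])
  next
    have "(\<lambda>x. cmod (S (fst x) (snd x)) * C) summable_on UNIV"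
      using S by (intro summable_on_cmult_left) (simp add: case_prod_unfold)
    then show "(\<lambda>x. norm (\<Sum>\<^sub>\<infinity>q. norm ((\<lambda>((p, r), q). cmod (S p r) * cmod (T r q)) (x, q))))
        summable_on UNIV"
      by (rule Infinite_Sum.abs_summable_on_comparison_test')
         (auto simp: norm_mult infsum_cmult_right' infsum_nonneg case_prod_unfold
           intro!: mult_left_mono row_bounded_infsum[OF T])
  qed
  then have "(\<lambda>((p, r), q). cmod (S p r) * cmod (T r q)) summable_on UNIV \<times> UNIV"
    by (rule abs_summable_summable)
  moreover have "bij_betw (\<lambda>((p, q), r). ((p, r), q)) (UNIV \<times> UNIV) (UNIV \<times> UNIV)"
    by (rule bij_betwI[where g="\<lambda>((p, r), q). ((p, q), r)"]) auto
  ultimately have sm: "(\<lambda>(x, r). cmod (S (fst x) r) * cmod (T r (snd x))) summable_on UNIV \<times> UNIV"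
    by (subst (asm) summable_on_reindex_bij_betw[symmetric]) (auto simp: case_prod_unfold)
  from summable_on_Sigma_banach[OF sm]
  show "(\<lambda>(p, q). \<Sum>\<^sub>\<infinity>r. cmod (S p r) * cmod (T r q)) summable_on UNIV"
    by (simp add: case_prod_unfold)
  from summable_on_SigmaD1[OF sm, of "(p, q)"]
  show "(\<lambda>r. cmod (S p r) * cmod (T r q)) summable_on UNIV"
    by simp
qed

lemma summable_abs_mult_left:
  assumes S: "(\<lambda>(p, q). cmod (S p q)) summable_on UNIV" and T: "row_bounded (\<lambda>q p. T p q) C"
  shows "(\<lambda>(p, q). \<Sum>\<^sub>\<infinity>r. cmod (T p r) * cmod (S r q)) summable_on UNIV"
    and "(\<lambda>r. cmod (T p r) * cmod (S r q)) summable_on UNIV"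
proof -
  have S': "(\<lambda>(q, p). cmod (S p q)) summable_on UNIV"
    using S by (subst (asm) summable_on_swap[where A=UNIV and B=UNIV, simplified]) (simp add: case_prod_unfold)
  from summable_abs_mult_right(1)[OF S' T]
  show "(\<lambda>(p, q). \<Sum>\<^sub>\<infinity>r. cmod (T p r) * cmod (S r q)) summable_on UNIV"
    by (subst (asm) summable_on_swap[where A=UNIV and B=UNIV, simplified]) (simp add: case_prod_unfold mult.commute)
  from summable_abs_mult_right(2)[OF S' T]
  show "(\<lambda>r. cmod (T p r) * cmod (S r q)) summable_on UNIV"
    by (simp add: mult.commute)
qed

lemma summable_entries_abs_mult:
  assumes "summable_entries A \<or> summable_entries B"
  shows "(\<lambda>(p, q). \<Sum>\<^sub>\<infinity>r. cmod (entry A p r) * cmod (entry B r q)) summable_on UNIV"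
    and "(\<lambda>r. cmod (entry A p r) * cmod (entry B r q)) summable_on UNIV"
  using assms row_col_bounded_entry[of A] row_col_bounded_entry[of B]
  unfolding summable_entries_def row_col_bounded_def
  by (blast intro: summable_abs_mult_left summable_abs_mult_right)+

lemma summable_entries_mult:
  assumes "summable_entries A \<or> summable_entries B"
  shows "summable_entries (A * B)"
  unfolding summable_entries_def
proof (rule summable_on_comparison_test[OF summable_entries_abs_mult(1)[OF assms]])
  show "(case x of (p, q) \<Rightarrow> cmod (entry (A * B) p q)) \<le>
      (case x of (p, q) \<Rightarrow> \<Sum>\<^sub>\<infinity>r. cmod (entry A p r) * cmod (entry B r q))" for x
    using norm_infsum_bound[of "\<lambda>r. entry A (fst x) r * entry B r (snd x)" UNIV]
      summable_entries_abs_mult(2)[OF assms]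
    by (simp add: case_prod_unfold entry_times norm_mult)
qed auto

lemma summable_entries_add:
  assumes "summable_entries A" "summable_entries B"
  shows "summable_entries (A + B)"
  using summable_on_add[OF assms[unfolded summable_entries_def]] unfolding summable_entries_def
  by (rule summable_on_comparison_test) (auto simp: norm_triangle_ineq)

lemma summable_entries_uminus: "summable_entries (- A) \<longleftrightarrow> summable_entries A"
  by (simp add: summable_entries_def)

lemma summable_entries_diff:
  "summable_entries A \<Longrightarrow> summable_entries B \<Longrightarrow> summable_entries (A - B)"
  using summable_entries_add[of A "- B"] by (simp add: summable_entries_uminus)

section \<open>Fredholm determinants of matrices with summable entries\<close>

lemma set_det_diagonal:
  assumes S: "finite S"
  shows "set_det S (\<lambda>p q. if p = q then d p else 0) = (\<Prod>p\<in>S. d p)"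
proof -
  have "set_det S (\<lambda>p q. if p = q then d p else 0) =
        (\<Sum>\<pi>\<in>{id}. of_int (sign \<pi>) * (\<Prod>p\<in>S. if p = \<pi> p then d p else 0))"
    unfolding set_det_def
  proof (rule sum.mono_neutral_right)
    show "\<forall>\<pi>\<in>{\<pi>. \<pi> permutes S} - {id}. of_int (sign \<pi>) * (\<Prod>p\<in>S. if p = \<pi> p then d p else 0) = 0"
    proof
      fix \<pi> assume \<pi>: "\<pi> \<in> {\<pi>. \<pi> permutes S} - {id}"
      then obtain p where "\<pi> p \<noteq> p" by (auto simp: fun_eq_iff)
      then have "\<exists>p\<in>S. (if p = \<pi> p then d p else 0) = 0"
        using \<pi> by (intro bexI[of _ p]) (auto dest: permutes_not_in)
      then show "of_int (sign \<pi>) * (\<Prod>p\<in>S. if p = \<pi> p then d p else 0) = 0"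
        using S by (simp add: prod_zero)
    qed
  qed (use S in \<open>auto simp: finite_permutations permutes_id\<close>)
  then show ?thesis by simp
qed

lemma set_det_identity: "finite S \<Longrightarrow> set_det S kron = 1"
  using set_det_diagonal[of S "\<lambda>_. 1"] by (simp add: kron_def[abs_def])

text \<open>
  Only the principal minors of \<open>K\<close> inside \<open>H\<close> survive in the expansion of the determinant of $I + K$.
\<close>

lemma set_det_zero_columns:
  assumes G: "finite G" "H \<subseteq> G" and K: "\<And>p q. p \<in> G \<Longrightarrow> q \<in> G - H \<Longrightarrow> K p q = 0"
  shows "set_det G (\<lambda>p q. kron p q + K p q) = set_det H (\<lambda>p q. kron p q + K p q)"
proof -
  have "(\<Sum>S\<in>Pow G. set_det S K) = (\<Sum>S\<in>Pow H. set_det S K)"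
  proof (rule sum.mono_neutral_right)
    show "\<forall>S\<in>Pow G - Pow H. set_det S K = 0"
    proof
      fix S assume S: "S \<in> Pow G - Pow H"
      then obtain q where "q \<in> S" "q \<notin> H" by auto
      then show "set_det S K = 0"
        using S K G by (intro set_det_zero_column[of S q]) (auto intro: finite_subset)
    qed
  qed (use G in auto)
  then show ?thesis
    using sum_principal_minors[of G K] sum_principal_minors[of H K] G finite_subset by fastforce
qed

lemma kron_sum_left [simp]: "finite F \<Longrightarrow> p \<in> F \<Longrightarrow> (\<Sum>r\<in>F. kron p r * B r) = B p"
  by (simp add: kron_def if_distrib[of "\<lambda>c. c * _"] cong: if_cong)

lemma kron_sum_right [simp]: "finite F \<Longrightarrow> q \<in> F \<Longrightarrow> (\<Sum>r\<in>F. A r * kron r q) = A q"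
  by (simp add: kron_def if_distrib[of "\<lambda>c. _ * c"] cong: if_cong)

text \<open>
  With block matrices written by rows, $[[I, -A], [B, I]]$ has the two triangular factorizations
  $[[I, -A], [0, I]]\,[[I+AB, 0], [B, I]]$ and $[[I, 0], [B, I]]\,[[I, -A], [0, I+BA]]$.
  The block matrices are indexed by the sum of two copies of the index type.
\<close>

lemma set_det_one_plus_mult_commute:
  assumes F: "finite F"
  shows "set_det F (\<lambda>p q. kron p q + (\<Sum>r\<in>F. A p r * B r q)) =
         set_det F (\<lambda>p q. kron p q + (\<Sum>r\<in>F. B p r * A r q))"
proof -
  let ?AB = "\<lambda>p q. \<Sum>r\<in>F. A p r * B r q" and ?BA = "\<lambda>p q. \<Sum>r\<in>F. B p r * A r q"
  let ?G = "Inl ` F \<union> Inr ` F"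
  define blk :: "_ \<Rightarrow> _ \<Rightarrow> _ \<Rightarrow> _ \<Rightarrow> 'a + 'a \<Rightarrow> 'a + 'a \<Rightarrow> complex" where
    "blk a b c d x y = (case x of Inl p \<Rightarrow> (case y of Inl q \<Rightarrow> a p q | Inr q \<Rightarrow> b p q)
                              | Inr p \<Rightarrow> (case y of Inl q \<Rightarrow> c p q | Inr q \<Rightarrow> d p q))" for a b c d x y
  let ?I = "\<lambda>K x y. kron x y + K x y"
  let ?O = "\<lambda>_ _. 0 :: complex"
  have kr: "kron (Inl p) (Inl q) = kron p q" "kron (Inr p) (Inr q) = kron p q"
    "kron (Inl p) (Inr r) = 0" "kron (Inr r) (Inl p) = 0" for p q :: 'a and r :: 'a
    by (auto simp: kron_def)
  have G: "finite ?G" using F by simp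
  have left: "set_det ?G (?I (blk a ?O c ?O)) = set_det F (?I a)" for a c
    by (subst set_det_zero_columns[of _ "Inl ` F"])
       (use F in \<open>auto simp: set_det_image blk_def kr\<close>)
  have right: "set_det ?G (?I (blk ?O b ?O d)) = set_det F (?I d)" for b d
    by (subst set_det_zero_columns[of _ "Inr ` F"])
       (use F in \<open>auto simp: set_det_image blk_def kr\<close>)
  have sumG: "(\<Sum>z\<in>?G. f z) = (\<Sum>r\<in>F. f (Inl r)) + (\<Sum>r\<in>F. f (Inr r))" for f :: "'a + 'a \<Rightarrow> complex"
    by (subst sum.union_disjoint) (use F in \<open>auto simp: sum.reindex\<close>)
  have "set_det F (?I ?AB) = set_det ?G (?I (blk ?O (\<lambda>p q. - A p q) ?O ?O)) * set_det ?G (?I (blk ?AB ?O B ?O))"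
    by (simp only: left right) (simp add: set_det_identity F)
  also have "\<dots> = set_det ?G (\<lambda>x y. \<Sum>z\<in>?G. ?I (blk ?O (\<lambda>p q. - A p q) ?O ?O) x z * ?I (blk ?AB ?O B ?O) z y)"
    by (rule set_det_mult[OF G, symmetric])
  also have "\<dots> = set_det ?G (\<lambda>x y. \<Sum>z\<in>?G. ?I (blk ?O ?O B ?O) x z * ?I (blk ?O (\<lambda>p q. - A p q) ?O ?BA) z y)"
    by (rule set_det_cong, unfold sumG)
       (use F in \<open>auto simp: blk_def kr ring_distribs sum.distrib sum_negf\<close>)
  also have "\<dots> = set_det ?G (?I (blk ?O ?O B ?O)) * set_det ?G (?I (blk ?O (\<lambda>p q. - A p q) ?O ?BA))"
    by (rule set_det_mult[OF G])
  also have "\<dots> = set_det F (?I ?BA)"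
    by (simp only: left right) (simp add: set_det_identity F)
  finally show ?thesis .
qed

text \<open>
  Dominated convergence for sums along an arbitrary filter: by the M-test the sums converge uniformly, so the limits may be exchanged.
\<close>

lemma tendsto_infsum_dominated:
  fixes f :: "'x \<Rightarrow> 'a \<Rightarrow> 'b::banach"
  assumes lim: "\<And>i. i \<in> A \<Longrightarrow> ((\<lambda>x. f x i) \<longlongrightarrow> g i) L"
    and le: "\<And>x i. i \<in> A \<Longrightarrow> norm (f x i) \<le> h i"
    and h: "h summable_on A" and L: "L \<noteq> bot"
  shows "((\<lambda>x. infsum (f x) A) \<longlongrightarrow> infsum g A) L"
proof (rule swap_uniform_limit'[where S=UNIV and f="\<lambda>X x. \<Sum>i\<in>X. f x i" and g="sum g" and F="finite_subsets_at_top A"])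
  show "uniform_limit UNIV (\<lambda>X x. \<Sum>i\<in>X. f x i) (\<lambda>x. infsum (f x) A) (finite_subsets_at_top A)"
    using Weierstrass_m_test_general[of A UNIV "\<lambda>i x. f x i" h] le h by simp
  show "\<forall>\<^sub>F X in finite_subsets_at_top A. ((\<lambda>x. \<Sum>i\<in>X. f x i) \<longlongrightarrow> (\<Sum>i\<in>X. g i)) L"
    by (rule eventually_finite_subsets_at_top_weakI, rule tendsto_sum) (use lim in blast)
  have "norm (g i) \<le> h i" if "i \<in> A" for i
    by (rule Lim_norm_ubound[OF L lim[OF that]]) (use le that in auto)
  then have "g abs_summable_on A"
    by (rule Infinite_Sum.abs_summable_on_comparison_test'[OF h])
  then show "(sum g \<longlongrightarrow> infsum g A) (finite_subsets_at_top A)"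
    by (rule infsum_tendsto[OF abs_summable_summable])
qed auto

text \<open>
  This is the Fredholm determinant of $I + K$, in the form that von Koch gave it.
\<close>

definition fdet :: "('i \<Rightarrow> 'i \<Rightarrow> complex) \<Rightarrow> complex" where
  "fdet K = (\<Sum>\<^sub>\<infinity>S\<in>{S. finite S}. set_det S K)"

text \<open>
  The sum over all subsets $S$ of a finite set $F$ is at most
  $\prod_{p \in F} (1 + \sum_{q \in F} G_{pq}) \le \exp \sum_{p,q} G_{pq}$, because permutations of $S$ are
  particular maps from $S$ to $F$.
\<close>

lemma summable_permanents:
  fixes G :: "'i \<Rightarrow> 'i \<Rightarrow> real"
  assumes G: "(\<lambda>(p, q). G p q) summable_on UNIV" and nonneg: "\<And>p q. 0 \<le> G p q"
  shows "(\<lambda>S. \<Sum>\<pi> | \<pi> permutes S. \<Prod>p\<in>S. G p (\<pi> p)) summable_on {S. finite S}"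
proof (rule nonneg_bdd_above_summable_on)
  let ?perm = "\<lambda>S. \<Sum>\<pi> | \<pi> permutes S. \<Prod>p\<in>S. G p (\<pi> p)"
  let ?T = "\<Sum>\<^sub>\<infinity>(p, q). G p q"
  show "0 \<le> ?perm S" for S
    by (intro sum_nonneg prod_nonneg nonneg)
  show "bdd_above (sum ?perm ` {\<S>. \<S> \<subseteq> {S. finite S} \<and> finite \<S>})"
  proof (rule bdd_aboveI2[where M="exp ?T"])
    fix \<S> :: "'i set set" assume \<S>: "\<S> \<in> {\<S>. \<S> \<subseteq> {S. finite S} \<and> finite \<S>}"
    define F where "F = \<Union>\<S>"
    have F: "finite F" using \<S> by (auto simp: F_def)
    have "sum ?perm \<S> \<le> (\<Sum>S\<in>Pow F. ?perm S)"
      by (rule sum_mono2) (use F in \<open>auto simp: F_def intro!: sum_nonneg prod_nonneg nonneg\<close>)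
    also have "\<dots> \<le> (\<Sum>S\<in>Pow F. \<Prod>p\<in>S. \<Sum>q\<in>F. G p q)"
    proof (rule sum_mono)
      fix S assume S: "S \<in> Pow F"
      then have fS: "finite S" using F finite_subset by blast
      have inj: "inj_on (\<lambda>\<pi>. restrict \<pi> S) {\<pi>. \<pi> permutes S}"
      proof (rule inj_onI)
        fix \<pi> \<sigma> assume *: "\<pi> \<in> {\<pi>. \<pi> permutes S}" "\<sigma> \<in> {\<pi>. \<pi> permutes S}" "restrict \<pi> S = restrict \<sigma> S"
        show "\<pi> = \<sigma>"
        proof
          fix p show "\<pi> p = \<sigma> p"
            using * by (cases "p \<in> S") (auto simp: permutes_not_in dest: fun_cong[of _ _ p])
        qed
      qed
      have "?perm S = (\<Sum>f\<in>(\<lambda>\<pi>. restrict \<pi> S) ` {\<pi>. \<pi> permutes S}. \<Prod>p\<in>S. G p (f p))"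
        by (subst sum.reindex[OF inj]) auto
      also have "\<dots> \<le> (\<Sum>f\<in>PiE S (\<lambda>_. F). \<Prod>p\<in>S. G p (f p))"
        by (rule sum_mono2)
           (use S fS F in \<open>auto simp: permutes_in_image intro!: finite_PiE prod_nonneg nonneg\<close>)
      also have "\<dots> = (\<Prod>p\<in>S. \<Sum>q\<in>F. G p q)"
        by (rule prod_sum_PiE[symmetric]) (use fS F in auto)
      finally show "?perm S \<le> (\<Prod>p\<in>S. \<Sum>q\<in>F. G p q)" .
    qed
    also have "\<dots> = (\<Prod>p\<in>F. (\<Sum>q\<in>F. G p q) + 1)"
      by (subst prod_add[OF F]) simp
    also have "\<dots> \<le> (\<Prod>p\<in>F. exp (\<Sum>q\<in>F. G p q))"
      by (intro prod_mono conjI add_nonneg_nonneg sum_nonneg nonneg) (auto simp: add.commute)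
    also have "\<dots> = exp (\<Sum>(p, q)\<in>F \<times> F. G p q)"
      unfolding sum.cartesian_product[symmetric] by (simp add: exp_sum[OF F])
    also have "\<dots> \<le> exp ?T"
      using finite_sum_le_infsum[OF G, of "F \<times> F"] F nonneg by (auto simp: case_prod_unfold)
    finally show "sum ?perm \<S> \<le> exp ?T" .
  qed
qed

lemma set_det_le_permanent:
  assumes "\<And>p q. cmod (K p q) \<le> G p q"
  shows "cmod (set_det S K) \<le> (\<Sum>\<pi> | \<pi> permutes S. \<Prod>p\<in>S. G p (\<pi> p))"
proof -
  have "cmod (set_det S K) \<le> (\<Sum>\<pi> | \<pi> permutes S. cmod (of_int (sign \<pi>) * (\<Prod>p\<in>S. K p (\<pi> p))))"
    unfolding set_det_def by (rule norm_sum)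
  also have "\<dots> \<le> (\<Sum>\<pi> | \<pi> permutes S. \<Prod>p\<in>S. G p (\<pi> p))"
    by (intro sum_mono) (auto simp: norm_mult sign_def prod_norm[symmetric] intro!: prod_mono assms)
  finally show ?thesis .
qed

text \<open>
  Each minor depends on finitely many entries and is bounded by the corresponding permanent of the
  dominating matrix.
\<close>

lemma tendsto_fdet:
  assumes G: "(\<lambda>(p, q). G p q) summable_on UNIV"
    and le: "\<And>x p q. cmod (K x p q) \<le> G p q"
    and lim: "\<And>p q. ((\<lambda>x. K x p q) \<longlongrightarrow> M p q) L" and L: "L \<noteq> bot"
  shows "((\<lambda>x. fdet (K x)) \<longlongrightarrow> fdet M) L"
  unfolding fdet_def
proof (rule tendsto_infsum_dominated[OF _ _ summable_permanents[OF G] L])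
  show "0 \<le> G p q" for p q
    using le[of undefined p q] norm_ge_zero order_trans by blast
  show "cmod (set_det S (K x)) \<le> (\<Sum>\<pi> | \<pi> permutes S. \<Prod>p\<in>S. G p (\<pi> p))" for S x
    by (rule set_det_le_permanent) (rule le)
  show "((\<lambda>x. set_det S (K x)) \<longlongrightarrow> set_det S M) L" for S
    unfolding set_det_def
    by (rule tendsto_sum, rule tendsto_mult[OF tendsto_const], rule tendsto_prod, rule lim)
qed

definition compression :: "'i set \<Rightarrow> ('i \<Rightarrow> 'i \<Rightarrow> complex) \<Rightarrow> 'i \<Rightarrow> 'i \<Rightarrow> complex" where
  "compression F K p q = (if p \<in> F \<and> q \<in> F then K p q else 0)"

lemma fdet_compression:
  assumes F: "finite F"
  shows "fdet (compression F K) = set_det F (\<lambda>p q. kron p q + K p q)"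
proof -
  have "fdet (compression F K) = (\<Sum>\<^sub>\<infinity>S\<in>Pow F. set_det S (compression F K))"
    unfolding fdet_def
  proof (rule infsum_cong_neutral)
    fix S assume "S \<in> {S. finite S} - Pow F"
    then obtain q where "q \<in> S" "q \<notin> F" "finite S" by auto
    then show "set_det S (compression F K) = 0"
      by (intro set_det_zero_column[of S q]) (auto simp: compression_def)
  qed (use F finite_subset in auto)
  also have "\<dots> = (\<Sum>S\<in>Pow F. set_det S (compression F K))"
    using F by simp
  also have "\<dots> = set_det F (\<lambda>p q. kron p q + compression F K p q)"
    by (rule sum_principal_minors[OF F])
  also have "\<dots> = set_det F (\<lambda>p q. kron p q + K p q)"
    by (rule set_det_cong) (simp add: compression_def)
  finally show ?thesis .
qed

lemma tendsto_compression:
  assumes "((\<lambda>F. K F p q) \<longlongrightarrow> M p q) (finite_subsets_at_top UNIV)"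
  shows "((\<lambda>F. compression F (K F) p q) \<longlongrightarrow> M p q) (finite_subsets_at_top UNIV)"
proof (rule Lim_transform_eventually[OF assms])
  show "\<forall>\<^sub>F F in finite_subsets_at_top UNIV. K F p q = compression F (K F) p q"
    unfolding eventually_finite_subsets_at_top
    by (rule exI[of _ "{p, q}"]) (auto simp: compression_def)
qed

lemma tendsto_partial_product:
  assumes "summable_entries A \<or> summable_entries B"
  shows "((\<lambda>F. \<Sum>r\<in>F. entry A p r * entry B r q) \<longlongrightarrow> entry (A * B) p q) (finite_subsets_at_top UNIV)"
  unfolding entry_times
  by (intro infsum_tendsto row_col_bounded_summable row_col_bounded_entry)

text \<open>
  The bound is the same for all finite sections, as dominated convergence requires.
\<close>

lemma partial_product_le:
  assumes "summable_entries A \<or> summable_entries B" and F: "finite F"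
  shows "cmod (\<Sum>r\<in>F. entry A p r * entry B r q) \<le> (\<Sum>\<^sub>\<infinity>r. cmod (entry A p r) * cmod (entry B r q))"
proof -
  have "cmod (\<Sum>r\<in>F. entry A p r * entry B r q) \<le> (\<Sum>r\<in>F. cmod (entry A p r) * cmod (entry B r q))"
    by (rule sum_norm_le) (simp add: norm_mult)
  also have "\<dots> \<le> (\<Sum>\<^sub>\<infinity>r. cmod (entry A p r) * cmod (entry B r q))"
    by (rule finite_sum_le_infsum) (use F summable_entries_abs_mult(2)[OF assms(1)] in auto)
  finally show ?thesis .
qed

lemma eventually_finite: "\<forall>\<^sub>F F in finite_subsets_at_top A. finite F"
  by (auto simp: eventually_finite_subsets_at_top)

abbreviation bdet :: "'i bmat \<Rightarrow> complex" where
  "bdet A \<equiv> fdet (entry A)"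

lemma tendsto_set_det_one_plus_product:
  assumes AB: "summable_entries A \<or> summable_entries B"
  shows "((\<lambda>F. set_det F (\<lambda>p q. kron p q + (\<Sum>r\<in>F. entry A p r * entry B r q))) \<longlongrightarrow> bdet (A * B))
           (finite_subsets_at_top UNIV)"
proof -
  \<comment> \<open>\<open>tendsto_fdet\<close> wants a bound for every index of the filter, infinite sets included; hence the case distinction.\<close>
  let ?K = "\<lambda>F. if finite F then compression F (\<lambda>p q. \<Sum>r\<in>F. entry A p r * entry B r q) else (\<lambda>_ _. 0)"
  have "((\<lambda>F. fdet (?K F)) \<longlongrightarrow> bdet (A * B)) (finite_subsets_at_top UNIV)"
  proof (rule tendsto_fdet[OF summable_entries_abs_mult(1)[OF AB]])
    show "cmod (?K F p q) \<le> (\<Sum>\<^sub>\<infinity>r. cmod (entry A p r) * cmod (entry B r q))" for F p q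
      using partial_product_le[OF AB] by (auto simp: compression_def infsum_nonneg)
    show "((\<lambda>F. ?K F p q) \<longlongrightarrow> entry (A * B) p q) (finite_subsets_at_top UNIV)" for p q
      by (rule Lim_transform_eventually[OF tendsto_compression[OF tendsto_partial_product[OF AB]]])
         (rule eventually_mono[OF eventually_finite], simp)
  qed simp
  then show ?thesis
    by (rule Lim_transform_eventually)
       (rule eventually_mono[OF eventually_finite], simp add: fdet_compression)
qed

text \<open>
  One of the two factors may be any matrix of the ring, so this contains invariance under similarity:
  $\det(I + T) = \det(I + L(L^{-1}T)) = \det(I + L^{-1}TL)$.
\<close>

theorem bdet_mult_commute:
  assumes "summable_entries A \<or> summable_entries B"
  shows "bdet (A * B) = bdet (B * A)"
proof (rule tendsto_unique)
  show "((\<lambda>F. set_det F (\<lambda>p q. kron p q + (\<Sum>r\<in>F. entry A p r * entry B r q))) \<longlongrightarrow> bdet (A * B))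
           (finite_subsets_at_top UNIV)"
    by (rule tendsto_set_det_one_plus_product[OF assms])
  show "((\<lambda>F. set_det F (\<lambda>p q. kron p q + (\<Sum>r\<in>F. entry A p r * entry B r q))) \<longlongrightarrow> bdet (B * A))
           (finite_subsets_at_top UNIV)"
    by (rule Lim_transform_eventually[OF tendsto_set_det_one_plus_product])
       (use assms in \<open>auto intro!: eventually_mono[OF eventually_finite] set_det_one_plus_mult_commute\<close>)
qed simp

lemma tendsto_set_det_one_plus:
  assumes A: "summable_entries A"
  shows "((\<lambda>F. set_det F (\<lambda>p q. kron p q + entry A p q)) \<longlongrightarrow> bdet A) (finite_subsets_at_top UNIV)"
proof -
  have "((\<lambda>F. fdet (compression F (entry A))) \<longlongrightarrow> bdet A) (finite_subsets_at_top UNIV)"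
    by (rule tendsto_fdet[OF A[unfolded summable_entries_def]])
       (auto simp: compression_def[abs_def] intro: tendsto_compression[of "\<lambda>_. entry A", unfolded compression_def])
  then show ?thesis
    by (rule Lim_transform_eventually)
       (rule eventually_mono[OF eventually_finite], simp add: fdet_compression)
qed

text \<open>
  The product of the finite sections of $I + A$ and $I + B$ is a dominated approximation of $(I + A)(I + B)$.
\<close>

theorem bdet_mult:
  assumes A: "summable_entries A" and B: "summable_entries B"
  shows "bdet (A + B + A * B) = bdet A * bdet B"
proof (rule tendsto_unique)
  show "((\<lambda>F. set_det F (\<lambda>p q. kron p q + entry A p q) * set_det F (\<lambda>p q. kron p q + entry B p q))
           \<longlongrightarrow> bdet A * bdet B) (finite_subsets_at_top UNIV)"
    by (intro tendsto_mult tendsto_set_det_one_plus A B)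
  have AB: "summable_entries A \<or> summable_entries B" using A by simp
  let ?K = "\<lambda>F. if finite F then compression F (\<lambda>p q. entry A p q + entry B p q +
      (\<Sum>r\<in>F. entry A p r * entry B r q)) else (\<lambda>_ _. 0)"
  let ?G = "\<lambda>p q. cmod (entry A p q) + cmod (entry B p q) + (\<Sum>\<^sub>\<infinity>r. cmod (entry A p r) * cmod (entry B r q))"
  have "((\<lambda>F. fdet (?K F)) \<longlongrightarrow> bdet (A + B + A * B)) (finite_subsets_at_top UNIV)"
  proof (rule tendsto_fdet)
    show "(\<lambda>(p, q). ?G p q) summable_on UNIV"
      using summable_on_add[OF summable_on_add[OF A[unfolded summable_entries_def] B[unfolded summable_entries_def]]
          summable_entries_abs_mult(1)[OF AB]]
      by (simp add: case_prod_unfold)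
    show "cmod (?K F p q) \<le> ?G p q" for F p q
    proof (cases "finite F")
      case True
      have "cmod (entry A p q + entry B p q + (\<Sum>r\<in>F. entry A p r * entry B r q)) \<le> ?G p q"
        by (intro order_trans[OF norm_triangle_ineq] add_mono norm_triangle_ineq partial_product_le AB True)
      then show ?thesis
        using True by (auto simp: compression_def infsum_nonneg)
    qed (simp add: infsum_nonneg)
    have "((\<lambda>F. entry A p q + entry B p q + (\<Sum>r\<in>F. entry A p r * entry B r q)) \<longlongrightarrow>
        entry (A + B + A * B) p q) (finite_subsets_at_top UNIV)" for p q
      using tendsto_add[OF tendsto_const tendsto_partial_product[OF AB]] by simp
    from tendsto_compression[OF this]
    show "((\<lambda>F. ?K F p q) \<longlongrightarrow> entry (A + B + A * B) p q) (finite_subsets_at_top UNIV)" for p q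
      by (rule Lim_transform_eventually) (rule eventually_mono[OF eventually_finite], simp)
  qed simp
  then show "((\<lambda>F. set_det F (\<lambda>p q. kron p q + entry A p q) * set_det F (\<lambda>p q. kron p q + entry B p q))
           \<longlongrightarrow> bdet (A + B + A * B)) (finite_subsets_at_top UNIV)"
  proof (rule Lim_transform_eventually, intro eventually_mono[OF eventually_finite])
    fix F :: "'a set" assume F: "finite F"
    have "fdet (?K F) = set_det F (\<lambda>p q. \<Sum>r\<in>F. (kron p r + entry A p r) * (kron r q + entry B r q))"
      by (simp add: F fdet_compression, rule set_det_cong)
         (simp add: F ring_distribs sum.distrib)
    also have "\<dots> = set_det F (\<lambda>p q. kron p q + entry A p q) * set_det F (\<lambda>p q. kron p q + entry B p q)"
      by (rule set_det_mult[OF F])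
    finally show "fdet (?K F) = set_det F (\<lambda>p q. kron p q + entry A p q) * set_det F (\<lambda>p q. kron p q + entry B p q)" .
  qed
qed simp

lemma bdet_0 [simp]: "bdet 0 = 1"
proof -
  have "compression {} (entry (0 :: 'a bmat)) = entry 0"
    by (simp add: fun_eq_iff compression_def)
  then show ?thesis
    using fdet_compression[of "{}" "entry (0 :: 'a bmat)"] by (simp add: set_det_def)
qed

lemma bdet_diag:
  assumes d: "bounded (range d)" and F: "finite F" "\<And>p. p \<notin> F \<Longrightarrow> d p = 0"
  shows "bdet (diag d) = (\<Prod>p\<in>F. 1 + d p)"
proof -
  have "compression F (entry (diag d)) = entry (diag d)"
    using F by (auto simp: fun_eq_iff compression_def entry_diag d)
  then have "bdet (diag d) = set_det F (\<lambda>p q. kron p q + entry (diag d) p q)"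
    using fdet_compression[OF F(1), of "entry (diag d)"] by simp
  also have "(\<lambda>p q. kron p q + entry (diag d) p q) = (\<lambda>p q. if p = q then 1 + d p else 0)"
    by (simp add: fun_eq_iff entry_diag d kron_def)
  finally show ?thesis
    by (simp add: set_det_diagonal F)
qed

section \<open>Fourier coefficients of bounded functions\<close>

lemma finite_measure_angle: "finite_measure angle_measure"
  by (rule finite_measure_lebesgue_on) (metis cbox_interval lmeasurable_cbox)

text \<open>
  Functions of the angle, so \<open>f\<close> stands for the function $e^{i\theta} \mapsto f(\theta)$ on the circle.
\<close>

definition ess_bounded :: "(real \<Rightarrow> complex) \<Rightarrow> bool" where
  "ess_bounded f \<longleftrightarrow> f \<in> borel_measurable angle_measure \<and> (\<exists>C. AE \<theta> in angle_measure. cmod (f \<theta>) \<le> C)"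

lemma ess_bounded_integrable:
  assumes "ess_bounded f"
  shows "integrable angle_measure f"
proof -
  obtain C where "AE \<theta> in angle_measure. cmod (f \<theta>) \<le> C"
    using assms by (auto simp: ess_bounded_def)
  then show ?thesis
    using assms by (intro finite_measure.integrable_const_bound[OF finite_measure_angle])
      (auto simp: ess_bounded_def)
qed

lemma ess_bounded_mult [intro]:
  assumes "ess_bounded f" "ess_bounded g"
  shows "ess_bounded (\<lambda>\<theta>. f \<theta> * g \<theta>)"
proof -
  obtain C D where C: "AE \<theta> in angle_measure. cmod (f \<theta>) \<le> C" and D: "AE \<theta> in angle_measure. cmod (g \<theta>) \<le> D"
    using assms by (auto simp: ess_bounded_def)
  have "AE \<theta> in angle_measure. cmod (f \<theta> * g \<theta>) \<le> \<bar>C\<bar> * \<bar>D\<bar>"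
    using C D
  proof eventually_elim
    case (elim \<theta>)
    then show ?case by (auto simp: norm_mult intro!: mult_mono)
  qed
  then show ?thesis
    using assms by (auto simp: ess_bounded_def)
qed

lemma ess_bounded_add [intro]:
  assumes "ess_bounded f" "ess_bounded g"
  shows "ess_bounded (\<lambda>\<theta>. f \<theta> + g \<theta>)"
proof -
  obtain C D where C: "AE \<theta> in angle_measure. cmod (f \<theta>) \<le> C" and D: "AE \<theta> in angle_measure. cmod (g \<theta>) \<le> D"
    using assms by (auto simp: ess_bounded_def)
  have "AE \<theta> in angle_measure. cmod (f \<theta> + g \<theta>) \<le> C + D"
    using C D
  proof eventually_elim
    case (elim \<theta>)
    then show ?case using norm_triangle_ineq[of "f \<theta>" "g \<theta>"] by linarith
  qed
  then show ?thesis
    using assms by (auto simp: ess_bounded_def)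
qed

lemma ess_bounded_continuous:
  assumes "continuous_on {0..2 * pi} f"
  shows "ess_bounded f"
proof -
  have "bounded (f ` {0..2 * pi})"
    by (intro compact_imp_bounded compact_continuous_image assms) auto
  then obtain C where "\<forall>x\<in>f ` {0..2 * pi}. cmod x \<le> C"
    unfolding bounded_iff by blast
  then have "AE \<theta> in angle_measure. cmod (f \<theta>) \<le> C"
    by (intro AE_I2) (auto simp: space_restrict_space)
  moreover have "f \<in> borel_measurable angle_measure"
    by (rule continuous_imp_measurable_on_sets_lebesgue[OF assms]) auto
  ultimately show ?thesis by (auto simp: ess_bounded_def)
qed

lemma ess_bounded_const [intro, simp]: "ess_bounded (\<lambda>_. c)"
  by (intro ess_bounded_continuous continuous_intros)

lemma ess_bounded_cis [intro, simp]: "ess_bounded (\<lambda>\<theta>. cis (c * \<theta>))"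
  by (intro ess_bounded_continuous continuous_intros)

lemma ess_bounded_uminus [intro]: "ess_bounded f \<Longrightarrow> ess_bounded (\<lambda>\<theta>. - f \<theta>)"
  using ess_bounded_mult[OF ess_bounded_const[of "-1"], of f] by simp

lemma ess_bounded_diff [intro]: "ess_bounded f \<Longrightarrow> ess_bounded g \<Longrightarrow> ess_bounded (\<lambda>\<theta>. f \<theta> - g \<theta>)"
  using ess_bounded_add[of f "\<lambda>\<theta>. - g \<theta>"] by auto

lemma ess_bounded_sum [intro]:
  "(\<And>i. i \<in> I \<Longrightarrow> ess_bounded (f i)) \<Longrightarrow> ess_bounded (\<lambda>\<theta>. \<Sum>i\<in>I. f i \<theta>)"
  by (induction I rule: infinite_finite_induct) auto

definition fcoeff :: "(real \<Rightarrow> complex) \<Rightarrow> int \<Rightarrow> complex" where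
  "fcoeff f m = complex_of_real (1 / (2 * pi)) * (LINT \<theta>|angle_measure. f \<theta> * cis (- (real_of_int m * \<theta>)))"

lemma fourier_coeff_entry: "fourier_coeff a m $ i $ j = fcoeff (\<lambda>\<theta>. a (cis \<theta>) $ i $ j) m"
  by (simp add: fourier_coeff_def fcoeff_def)

lemma ess_bounded_cis_uminus [intro, simp]: "ess_bounded (\<lambda>\<theta>. cis (- (c * \<theta>)))"
  using ess_bounded_cis[of "- c"] by simp

lemma integrable_fcoeff: "ess_bounded f \<Longrightarrow> integrable angle_measure (\<lambda>\<theta>. f \<theta> * cis (- (c * \<theta>)))"
  by (intro ess_bounded_integrable) auto

lemma fcoeff_add: "ess_bounded f \<Longrightarrow> ess_bounded g \<Longrightarrow> fcoeff (\<lambda>\<theta>. f \<theta> + g \<theta>) m = fcoeff f m + fcoeff g m"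
  by (simp add: fcoeff_def ring_distribs integrable_fcoeff)

lemma fcoeff_diff: "ess_bounded f \<Longrightarrow> ess_bounded g \<Longrightarrow> fcoeff (\<lambda>\<theta>. f \<theta> - g \<theta>) m = fcoeff f m - fcoeff g m"
  by (simp add: fcoeff_def ring_distribs integrable_fcoeff)

lemma fcoeff_cmult: "fcoeff (\<lambda>\<theta>. c * f \<theta>) m = c * fcoeff f m"
  by (simp add: fcoeff_def mult.assoc)

lemma fcoeff_sum:
  "(\<And>i. i \<in> I \<Longrightarrow> ess_bounded (f i)) \<Longrightarrow> fcoeff (\<lambda>\<theta>. \<Sum>i\<in>I. f i \<theta>) m = (\<Sum>i\<in>I. fcoeff (f i) m)"
  by (induction I rule: infinite_finite_induct) (auto simp: fcoeff_add ess_bounded_sum, auto simp: fcoeff_def)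

lemma fcoeff_cis_mult: "fcoeff (\<lambda>\<theta>. f \<theta> * cis (real_of_int k * \<theta>)) m = fcoeff f (m - k)"
proof -
  have "cis (real_of_int k * \<theta>) * cis (- (real_of_int m * \<theta>)) = cis (- (real_of_int (m - k) * \<theta>))" for \<theta>
    by (simp add: cis_mult ring_distribs algebra_simps)
  then show ?thesis by (simp add: fcoeff_def mult.assoc)
qed

lemma fcoeff_cong_AE:
  assumes "AE \<theta> in angle_measure. f \<theta> = g \<theta>" and "ess_bounded f" "ess_bounded g"
  shows "fcoeff f m = fcoeff g m"
  unfolding fcoeff_def
proof (rule arg_cong2[where f="(*)", OF refl], rule integral_cong_AE)
  show "AE \<theta> in angle_measure. f \<theta> * cis (- (real_of_int m * \<theta>)) = g \<theta> * cis (- (real_of_int m * \<theta>))"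
    using assms(1) by eventually_elim simp
qed (use assms in \<open>auto intro!: borel_measurable_integrable integrable_fcoeff\<close>)

section \<open>Uniqueness of Fourier coefficients\<close>

text \<open>
  Having only zero Fourier coefficients is a property of $f$ that is preserved by multiplication with
  $e^{\pm i\theta}$, hence with real linear functions on the circle and with constants. Since it holds
  for all $f$ at once, it passes to sums and products of multipliers.
\<close>

lemma fcoeff_real_polynomial:
  assumes g: "real_polynomial_function g"
  shows "ess_bounded f \<Longrightarrow> (\<And>m. fcoeff f m = 0) \<Longrightarrow>
     ess_bounded (\<lambda>\<theta>. f \<theta> * of_real (g (cis \<theta>))) \<and> (\<forall>m. fcoeff (\<lambda>\<theta>. f \<theta> * of_real (g (cis \<theta>))) m = 0)"
  using g
proof (induction g arbitrary: f rule: real_polynomial_function.induct)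
  case (linear l)
  have l: "of_real (l (cis \<theta>)) = of_real (l 1) * ((cis \<theta> + cis (- \<theta>)) / 2) + of_real (l \<i>) * ((cis \<theta> - cis (- \<theta>)) / (2 * \<i>))" for \<theta>
  proof -
    have "cis \<theta> = cos \<theta> *\<^sub>R 1 + sin \<theta> *\<^sub>R \<i>"
      by (simp add: complex_eq_iff)
    then have "l (cis \<theta>) = cos \<theta> * l 1 + sin \<theta> * l \<i>"
      using linear(1) by (simp add: linear_simps(1,5))
    then show ?thesis
      by (simp add: complex_eq_iff cis.simps)
  qed
  define \<alpha> where "\<alpha> = of_real (l 1) / 2 + of_real (l \<i>) / (2 * \<i>)"
  define \<beta> where "\<beta> = of_real (l 1) / 2 - of_real (l \<i>) / (2 * \<i>)"
  have eq: "(\<lambda>\<theta>. f \<theta> * of_real (l (cis \<theta>))) =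
      (\<lambda>\<theta>. \<alpha> * (f \<theta> * cis (real_of_int 1 * \<theta>)) + \<beta> * (f \<theta> * cis (real_of_int (-1) * \<theta>)))"
    unfolding l \<alpha>_def \<beta>_def by (auto simp: fun_eq_iff field_simps)
  have b: "ess_bounded (\<lambda>\<theta>. \<alpha> * (f \<theta> * cis (real_of_int 1 * \<theta>)))"
    "ess_bounded (\<lambda>\<theta>. \<beta> * (f \<theta> * cis (real_of_int (-1) * \<theta>)))"
    by (intro linear(2) ess_bounded_mult ess_bounded_const ess_bounded_cis)+
  show ?case
    unfolding eq using b linear(3)
    by (simp only: fcoeff_add fcoeff_cmult fcoeff_cis_mult) (auto simp: linear(3))
next
  case (const c)
  then show ?case
    using fcoeff_cmult[of "of_real c" f] by (auto simp: mult.commute)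
next
  case (add g h)
  have "(\<lambda>\<theta>. f \<theta> * of_real (g (cis \<theta>) + h (cis \<theta>))) =
      (\<lambda>\<theta>. f \<theta> * of_real (g (cis \<theta>)) + f \<theta> * of_real (h (cis \<theta>)))"
    by (simp add: fun_eq_iff ring_distribs)
  with add.IH(1)[OF add.prems] add.IH(2)[OF add.prems] show ?case
    by (auto simp: fcoeff_add)
next
  case (mult g h)
  from mult.IH(1)[OF mult.prems] have "ess_bounded (\<lambda>\<theta>. f \<theta> * of_real (g (cis \<theta>)))"
    "\<And>m. fcoeff (\<lambda>\<theta>. f \<theta> * of_real (g (cis \<theta>))) m = 0"
    by auto
  from mult.IH(2)[OF this] show ?case
    by (simp add: mult.assoc)
qed

lemma integral_eq_0_of_fcoeff_0: "fcoeff f 0 = 0 \<Longrightarrow> (LINT \<theta>|angle_measure. f \<theta>) = 0"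
  by (simp add: fcoeff_def)

lemma measure_angle: "measure angle_measure {0..2 * pi} = 2 * pi"
proof -
  have "measure angle_measure {0..2 * pi} = measure lebesgue {0..2 * pi}"
    by (rule measure_restrict_space) auto
  then show ?thesis by simp
qed

lemma norm_integral_le:
  assumes f: "ess_bounded f" and C: "AE \<theta> in angle_measure. cmod (f \<theta>) \<le> C"
  shows "cmod (LINT \<theta>|angle_measure. f \<theta>) \<le> 2 * pi * C"
proof -
  interpret finite_measure angle_measure by (rule finite_measure_angle)
  have "cmod (LINT \<theta>|angle_measure. f \<theta>) \<le> (LINT \<theta>|angle_measure. cmod (f \<theta>))"
    by (rule integral_norm_bound)
  also have "\<dots> \<le> (LINT \<theta>|angle_measure. C)"
    by (rule integral_mono_AE) (use ess_bounded_integrable[OF f] C in auto)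
  also have "\<dots> = 2 * pi * C"
    by (simp add: space_restrict_space measure_angle)
  finally show ?thesis .
qed

text \<open>
  By Stone-Weierstrass, \<open>g\<close> is a uniform limit of polynomials on the circle, whose integrals against \<open>f\<close> vanish.
\<close>

lemma integral_continuous_circle_eq_0:
  fixes g :: "complex \<Rightarrow> real"
  assumes f: "ess_bounded f" "\<And>m. fcoeff f m = 0" and g: "continuous_on (sphere 0 1) g"
  shows "(LINT \<theta>|angle_measure. f \<theta> * of_real (g (cis \<theta>))) = 0"
proof -
  obtain C where C: "AE \<theta> in angle_measure. cmod (f \<theta>) \<le> C"
    using f(1) by (auto simp: ess_bounded_def)
  have gb: "ess_bounded (\<lambda>\<theta>. of_real (g (cis \<theta>)))"
    by (intro ess_bounded_continuous continuous_on_of_real continuous_on_compose2[OF g]) (auto intro!: continuous_intros)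
  have le: "cmod (LINT \<theta>|angle_measure. f \<theta> * of_real (g (cis \<theta>))) \<le> 2 * pi * (\<bar>C\<bar> * e)" if e: "e > 0" for e
  proof -
    obtain p where p: "real_polynomial_function p" "\<And>x. x \<in> sphere 0 1 \<Longrightarrow> \<bar>g x - p x\<bar> < e"
      using Stone_Weierstrass_real_polynomial_function[OF compact_sphere g e] by blast
    have fp: "ess_bounded (\<lambda>\<theta>. f \<theta> * of_real (p (cis \<theta>)))" "(LINT \<theta>|angle_measure. f \<theta> * of_real (p (cis \<theta>))) = 0"
      using fcoeff_real_polynomial[OF p(1) f] by (auto intro: integral_eq_0_of_fcoeff_0)
    have fg: "ess_bounded (\<lambda>\<theta>. f \<theta> * of_real (g (cis \<theta>)))"
      using f(1) gb by auto
    have "(LINT \<theta>|angle_measure. f \<theta> * of_real (g (cis \<theta>))) =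
        (LINT \<theta>|angle_measure. f \<theta> * of_real (g (cis \<theta>)) - f \<theta> * of_real (p (cis \<theta>)))"
      by (subst Bochner_Integration.integral_diff) (use fp fg ess_bounded_integrable in auto)
    also have "cmod \<dots> \<le> 2 * pi * (\<bar>C\<bar> * e)"
    proof (rule norm_integral_le)
      show "ess_bounded (\<lambda>\<theta>. f \<theta> * of_real (g (cis \<theta>)) - f \<theta> * of_real (p (cis \<theta>)))"
        using fg fp by auto
      show "AE \<theta> in angle_measure. cmod (f \<theta> * of_real (g (cis \<theta>)) - f \<theta> * of_real (p (cis \<theta>))) \<le> \<bar>C\<bar> * e"
        using C
      proof eventually_elim
        case (elim \<theta>)
        have "cmod (f \<theta> * of_real (g (cis \<theta>)) - f \<theta> * of_real (p (cis \<theta>))) = cmod (f \<theta>) * \<bar>g (cis \<theta>) - p (cis \<theta>)\<bar>"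
          by (simp flip: right_diff_distrib of_real_diff add: norm_mult)
        also have "\<dots> \<le> \<bar>C\<bar> * e"
          using elim p(2)[of "cis \<theta>"] by (intro mult_mono) auto
        finally show ?case .
      qed
    qed
    finally show ?thesis .
  qed
  have "cmod (LINT \<theta>|angle_measure. f \<theta> * of_real (g (cis \<theta>))) \<le> 0"
  proof (rule field_le_epsilon)
    fix e :: real assume e: "e > 0"
    \<comment> \<open>Adding 1 keeps the divisor positive when \<open>C\<close> is 0.\<close>
    define c where "c = 2 * pi * \<bar>C\<bar> + 1"
    have c: "c > 0" by (simp add: c_def add_nonneg_pos)
    then have "e / c > 0" using e by simp
    from le[OF this] have "cmod (LINT \<theta>|angle_measure. f \<theta> * of_real (g (cis \<theta>))) \<le> (c - 1) * (e / c)"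
      by (simp add: c_def)
    also have "\<dots> \<le> c * (e / c)"
      using c e by (intro mult_right_mono) auto
    also have "\<dots> = e" using c by simp
    finally show "cmod (LINT \<theta>|angle_measure. f \<theta> * of_real (g (cis \<theta>))) \<le> 0 + e" by simp
  qed
  then show ?thesis by simp
qed

text \<open>
  A continuous function on the interval with equal end values is a loop, and a loop is continuous as
  a function on the circle. The latter is the case of a constant homotopy of loops.
\<close>

lemma continuous_on_circle_Arg2pi:
  fixes g :: "real \<Rightarrow> complex"
  assumes g: "continuous_on {0..2 * pi} g" "g 0 = g (2 * pi)"
  shows "continuous_on (sphere 0 1) (\<lambda>z. g (Arg2pi z))"
proof -
  define p where "p = (\<lambda>t. g (2 * pi * t))"
  have "path p"
    unfolding path_def p_def
    by (rule continuous_on_compose2[OF g(1)]) (auto intro!: continuous_intros mult_left_le)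
  moreover have "pathfinish p = pathstart p"
    using g(2) by (simp add: pathfinish_def pathstart_def p_def)
  ultimately have "homotopic_loops UNIV p p"
    by (simp add: homotopic_loops_refl)
  from homotopic_loops_imp_homotopic_circlemaps[OF this]
  have "continuous_on (sphere 0 1) (p \<circ> (\<lambda>z. Arg2pi z / (2 * pi)))"
    using homotopic_with_imp_continuous by blast
  then show ?thesis
    by (simp add: p_def o_def)
qed

lemma integral_continuous_periodic_eq_0:
  assumes f: "ess_bounded f" "\<And>m. fcoeff f m = 0"
    and g: "continuous_on {0..2 * pi} g" "g 0 = g (2 * pi)"
  shows "(LINT \<theta>|angle_measure. f \<theta> * g \<theta>) = 0"
proof -
  note cont = continuous_on_circle_Arg2pi[OF g]
  have arg: "g (Arg2pi (cis \<theta>)) = g \<theta>" if "\<theta> \<in> {0..2 * pi}" for \<theta>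
  proof (cases "\<theta> = 2 * pi")
    case True
    moreover have "Arg2pi 1 = 0" by (rule Arg2pi_unique[of 1]) auto
    ultimately show ?thesis using g(2) by simp
  next
    case False
    then have "Arg2pi (cis \<theta>) = \<theta>"
      using that by (intro Arg2pi_unique[of 1]) (auto simp: cis_conv_exp)
    then show ?thesis by simp
  qed
  have Re: "continuous_on (sphere 0 1) (\<lambda>z. Re (g (Arg2pi z)))" and Im: "continuous_on (sphere 0 1) (\<lambda>z. Im (g (Arg2pi z)))"
    using cont by (auto intro: continuous_on_Re continuous_on_Im)
  have b: "ess_bounded (\<lambda>\<theta>. f \<theta> * of_real (Re (g (Arg2pi (cis \<theta>)))))" "ess_bounded (\<lambda>\<theta>. f \<theta> * of_real (Im (g (Arg2pi (cis \<theta>)))))"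
    by (intro ess_bounded_mult f(1) ess_bounded_continuous continuous_on_of_real continuous_on_compose2[OF Re]
          continuous_on_compose2[OF Im]; auto intro!: continuous_intros)+
  have "(LINT \<theta>|angle_measure. f \<theta> * g \<theta>) =
      (LINT \<theta>|angle_measure. f \<theta> * of_real (Re (g (Arg2pi (cis \<theta>)))) + \<i> * (f \<theta> * of_real (Im (g (Arg2pi (cis \<theta>))))))"
  proof (rule Bochner_Integration.integral_cong[OF refl])
    fix \<theta> assume "\<theta> \<in> space angle_measure"
    then have "g \<theta> = of_real (Re (g (Arg2pi (cis \<theta>)))) + \<i> * of_real (Im (g (Arg2pi (cis \<theta>))))"
      using arg[of \<theta>] complex_eq[of "g \<theta>"] by (simp add: space_restrict_space)
    then show "f \<theta> * g \<theta> = f \<theta> * of_real (Re (g (Arg2pi (cis \<theta>)))) + \<i> * (f \<theta> * of_real (Im (g (Arg2pi (cis \<theta>)))))"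
      by (metis (no_types, lifting) distrib_left mult.left_commute)
  qed
  also have "\<dots> = 0"
    using integral_continuous_circle_eq_0[OF f Re] integral_continuous_circle_eq_0[OF f Im]
      ess_bounded_integrable[OF b(1)] ess_bounded_integrable[OF b(2)]
    by simp
  finally show ?thesis .
qed

text \<open>
  The radial retraction of the plane onto the disc of radius \<open>C\<close>.
\<close>

definition clamp_norm :: "real \<Rightarrow> complex \<Rightarrow> complex" where
  "clamp_norm C z = of_real (min 1 (C / max C (cmod z))) * z"

lemma
  assumes C: "C > 0"
  shows norm_clamp_norm: "cmod (clamp_norm C z) \<le> C"
    and clamp_norm_eq: "cmod z \<le> C \<Longrightarrow> clamp_norm C z = z"
    and continuous_clamp_norm: "continuous_on UNIV (clamp_norm C)"
proof -
  have pos: "max C (cmod z) > 0" for z using C by auto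
  have "cmod (clamp_norm C z) = min 1 (C / max C (cmod z)) * cmod z"
    unfolding clamp_norm_def norm_mult norm_of_real using C pos[of z] by simp
  also have "\<dots> \<le> C / max C (cmod z) * max C (cmod z)"
    using C pos[of z] by (intro mult_mono) auto
  also have "\<dots> = C" using pos[of z] by simp
  finally show "cmod (clamp_norm C z) \<le> C" .
  show "cmod z \<le> C \<Longrightarrow> clamp_norm C z = z"
    using C by (simp add: clamp_norm_def max_def)
  show "continuous_on UNIV (clamp_norm C)"
    unfolding clamp_norm_def using pos by (intro continuous_intros) (metis less_irrefl)
qed

text \<open>
  The function $\overline f$ is an almost everywhere limit of continuous functions. After clamping their
  norm and multiplying them by cutoffs $\varphi_n$ that vanish at $0$ and $2\pi$, they are bounded and
  periodic, so their integrals against $f$ vanish. Dominated convergence gives $\int |f|^2 = 0$.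
\<close>

theorem fourier_uniqueness:
  assumes f: "ess_bounded f" "\<And>m. fcoeff f m = 0"
  shows "AE \<theta> in angle_measure. f \<theta> = 0"
proof -
  interpret finite_measure angle_measure by (rule finite_measure_angle)
  obtain C0 where C0: "AE \<theta> in angle_measure. cmod (f \<theta>) \<le> C0"
    using f(1) by (auto simp: ess_bounded_def)
  define C where "C = \<bar>C0\<bar> + 1"
  have C: "C > 0" "AE \<theta> in angle_measure. cmod (f \<theta>) \<le> C"
    using C0 by (auto simp: C_def)
  have fm: "f \<in> borel_measurable angle_measure"
    using f(1) by (simp add: ess_bounded_def)
  have cnj_fm: "(\<lambda>\<theta>. cnj (f \<theta>)) \<in> borel_measurable angle_measure"
    by (rule measurable_compose[OF fm borel_measurable_continuous_onI[OF continuous_on_cnj[OF continuous_on_id]]])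
  then have "(\<lambda>\<theta>. cnj (f \<theta>)) measurable_on {0..2 * pi}"
    by (simp add: measurable_on_iff_borel_measurable)
  then obtain N g where N: "negligible N" and g: "\<And>n. continuous_on UNIV (g n)"
    and lim: "\<And>\<theta>. \<theta> \<notin> N \<Longrightarrow> (\<lambda>n::nat. g n \<theta>) \<longlonglongrightarrow> (if \<theta> \<in> {0..2 * pi} then cnj (f \<theta>) else 0)"
    unfolding measurable_on_def by blast
  define \<phi> where "\<phi> = (\<lambda>(n::nat) \<theta>::real. min 1 (real n * min \<theta> (2 * pi - \<theta>)))"
  define G where "G = (\<lambda>n \<theta>. of_real (\<phi> n \<theta>) * clamp_norm C (g n \<theta>))"
  have Gcont: "continuous_on {0..2 * pi} (G n)" for n
    unfolding G_def \<phi>_def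
    by (intro continuous_intros continuous_on_compose2[OF continuous_clamp_norm[OF C(1)]]
          continuous_on_subset[OF g]) auto
  have Gzero: "(LINT \<theta>|angle_measure. f \<theta> * G n \<theta>) = 0" for n
    by (rule integral_continuous_periodic_eq_0[OF f Gcont]) (simp add: G_def \<phi>_def)
  have Gle: "cmod (G n \<theta>) \<le> C" if "\<theta> \<in> {0..2 * pi}" for n \<theta>
  proof -
    have "\<bar>\<phi> n \<theta>\<bar> \<le> 1" using that by (auto simp: \<phi>_def min_def)
    then have "\<bar>\<phi> n \<theta>\<bar> * cmod (clamp_norm C (g n \<theta>)) \<le> 1 * C"
      by (intro mult_mono norm_clamp_norm C(1)) auto
    then show ?thesis by (simp add: G_def norm_mult)
  qed
  have ae: "AE \<theta> in angle_measure. \<theta> \<notin> N \<union> {0, 2 * pi}"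
  proof -
    have "negligible (N \<union> {0, 2 * pi})" using N negligible_Un[OF N negligible_finite[of "{0, 2 * pi}"]] by simp
    then have "AE \<theta> in lebesgue. \<theta> \<notin> N \<union> {0, 2 * pi}"
      by (intro AE_not_in) (simp add: negligible_iff_null_sets)
    then show ?thesis by (subst AE_restrict_space_iff) auto
  qed
  have "(\<lambda>n. LINT \<theta>|angle_measure. f \<theta> * G n \<theta>) \<longlonglongrightarrow> (LINT \<theta>|angle_measure. f \<theta> * cnj (f \<theta>))"
  proof (rule integral_dominated_convergence[where w="\<lambda>_. C * C"])
    show "(\<lambda>\<theta>. f \<theta> * cnj (f \<theta>)) \<in> borel_measurable angle_measure"
      by (intro borel_measurable_times fm cnj_fm)
    show "(\<lambda>\<theta>. f \<theta> * G n \<theta>) \<in> borel_measurable angle_measure" for n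
      using ess_bounded_integrable[OF ess_bounded_mult[OF f(1) ess_bounded_continuous[OF Gcont]]] by auto
    show "integrable angle_measure (\<lambda>_. C * C)" by simp
    show "AE \<theta> in angle_measure. (\<lambda>n. f \<theta> * G n \<theta>) \<longlonglongrightarrow> f \<theta> * cnj (f \<theta>)"
      using ae C(2) AE_space[of angle_measure]
    proof eventually_elim
      case (elim \<theta>)
      then have \<theta>: "0 < \<theta>" "\<theta> < 2 * pi" by (auto simp: space_restrict_space)
      have "(\<lambda>n. g n \<theta>) \<longlonglongrightarrow> cnj (f \<theta>)"
        using lim[of \<theta>] elim \<theta> by auto
      then have "(\<lambda>n. clamp_norm C (g n \<theta>)) \<longlonglongrightarrow> clamp_norm C (cnj (f \<theta>))"
        by (rule continuous_on_tendsto_compose[OF continuous_clamp_norm[OF C(1)]]) auto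
      then have "(\<lambda>n. clamp_norm C (g n \<theta>)) \<longlonglongrightarrow> cnj (f \<theta>)"
        using elim by (simp add: clamp_norm_eq C)
      moreover have "(\<lambda>n. of_real (\<phi> n \<theta>) :: complex) \<longlonglongrightarrow> 1"
      proof (rule tendsto_eventually)
        obtain m :: nat where m: "1 / min \<theta> (2 * pi - \<theta>) \<le> real m"
          using real_arch_simple by blast
        show "\<forall>\<^sub>F n in sequentially. complex_of_real (\<phi> n \<theta>) = 1"
          using eventually_ge_at_top[of m]
        proof eventually_elim
          case (elim n)
          then have "1 / min \<theta> (2 * pi - \<theta>) \<le> real n" using m by linarith
          then have "1 \<le> real n * min \<theta> (2 * pi - \<theta>)"
            using \<theta> by (subst (asm) pos_divide_le_eq) auto
          then show ?case by (simp add: \<phi>_def)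
        qed
      qed
      ultimately have "(\<lambda>n. of_real (\<phi> n \<theta>) * clamp_norm C (g n \<theta>)) \<longlonglongrightarrow> 1 * cnj (f \<theta>)"
        by (intro tendsto_mult)
      then show ?case unfolding G_def by (intro tendsto_mult tendsto_const) simp
    qed
    show "AE \<theta> in angle_measure. cmod (f \<theta> * G n \<theta>) \<le> C * C" for n
      using C(2) AE_space[of angle_measure]
    proof eventually_elim
      case (elim \<theta>)
      then show ?case using Gle[of \<theta> n] C(1)
        by (auto simp: norm_mult space_restrict_space intro!: mult_mono)
    qed
  qed
  then have "(LINT \<theta>|angle_measure. f \<theta> * cnj (f \<theta>)) = 0"
    by (simp add: Gzero LIMSEQ_const_iff)
  moreover have int: "integrable angle_measure (\<lambda>\<theta>. (cmod (f \<theta>))\<^sup>2)"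
    using integrable_norm[OF ess_bounded_integrable[OF ess_bounded_mult[OF f(1) f(1)]]]
    by (simp add: norm_mult power2_eq_square)
  moreover have "(LINT \<theta>|angle_measure. f \<theta> * cnj (f \<theta>)) =
      of_real (LINT \<theta>|angle_measure. (cmod (f \<theta>))\<^sup>2)"
    unfolding complex_norm_square[symmetric] by (rule integral_of_real[OF int])
  ultimately have "AE \<theta> in angle_measure. (cmod (f \<theta>))\<^sup>2 = 0"
    by (subst integral_nonneg_eq_0_iff_AE[symmetric]) (simp_all only: of_real_eq_0_iff, simp)
  then show ?thesis by simp
qed

section \<open>Fourier coefficients of products\<close>

lemma integral_cis_eq_0:
  assumes "j \<noteq> (0::int)"
  shows "(LINT \<theta>|angle_measure. cis (real_of_int j * \<theta>)) = 0"
proof -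
  let ?F = "\<lambda>\<theta>. cis (real_of_int j * \<theta>) / (\<i> * of_int j)"
  have "((\<lambda>\<theta>. cis (real_of_int j * \<theta>)) has_integral (?F (2 * pi) - ?F 0)) {0..2 * pi}"
  proof (rule fundamental_theorem_of_calculus)
    fix \<theta> :: real
    show "(?F has_vector_derivative cis (real_of_int j * \<theta>)) (at \<theta> within {0..2 * pi})"
      unfolding cis_conv_exp
      by (rule has_vector_derivative_real_field[THEN has_vector_derivative_at_within] | auto intro!: derivative_eq_intros simp: assms field_simps)+
  qed simp
  moreover have "?F (2 * pi) = ?F 0"
    using cis_multiple_2pi[of "of_int j"] by (simp add: mult_ac)
  ultimately have "integral {0..2 * pi} (\<lambda>\<theta>. cis (real_of_int j * \<theta>)) = 0"
    by (simp add: integral_unique)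
  then show ?thesis
    by (subst lebesgue_integral_eq_integral) (auto intro!: ess_bounded_integrable)
qed

lemma fcoeff_1: "fcoeff (\<lambda>_. 1) m = (if m = 0 then 1 else 0)"
proof (cases "m = 0")
  case True
  interpret finite_measure angle_measure by (rule finite_measure_angle)
  show ?thesis using True by (simp add: fcoeff_def space_restrict_space measure_angle scaleR_conv_of_real)
next
  case False
  then show ?thesis
    using integral_cis_eq_0[of "- m"] by (simp add: fcoeff_def)
qed

text \<open>
  The partial sums converge uniformly, so they may be integrated term by term against a bounded
  function.
\<close>

lemma
  fixes c :: "int \<Rightarrow> complex"
  assumes c: "(\<lambda>k. cmod (c k)) summable_on UNIV"
  shows ess_bounded_trig_series: "ess_bounded (\<lambda>\<theta>. \<Sum>\<^sub>\<infinity>k. c k * cis (real_of_int k * \<theta>))" (is "ess_bounded ?g")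
    and has_sum_fcoeff_mult_trig_series: "ess_bounded f \<Longrightarrow>
      ((\<lambda>k. fcoeff f (m - k) * c k) has_sum fcoeff (\<lambda>\<theta>. f \<theta> * (\<Sum>\<^sub>\<infinity>k. c k * cis (real_of_int k * \<theta>))) m) UNIV"
proof -
  let ?s = "\<lambda>F \<theta>. \<Sum>k\<in>F. c k * cis (real_of_int k * \<theta>)"
  have unif: "uniform_limit UNIV ?s ?g (finite_subsets_at_top UNIV)"
    using Weierstrass_m_test_general[of UNIV UNIV "\<lambda>k \<theta>. c k * cis (real_of_int k * \<theta>)" "\<lambda>k. cmod (c k)"] c
    by (simp add: norm_mult)
  have "continuous_on UNIV ?g"
    by (rule uniform_limit_theorem[OF _ unif]) (auto intro!: always_eventually continuous_intros)
  then show g: "ess_bounded ?g"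
    by (intro ess_bounded_continuous) (auto intro: continuous_on_subset)
  assume f: "ess_bounded f"
  obtain C where C: "AE \<theta> in angle_measure. cmod (f \<theta>) \<le> C"
    using f by (auto simp: ess_bounded_def)
  show "((\<lambda>k. fcoeff f (m - k) * c k) has_sum fcoeff (\<lambda>\<theta>. f \<theta> * ?g \<theta>) m) UNIV"
    unfolding has_sum_def
  proof (rule tendstoI)
    fix e :: real assume e: "e > 0"
    define d where "d = e / (\<bar>C\<bar> + 1)"
    have d: "d > 0" using e by (simp add: d_def)
    from uniform_limitD[OF unif d]
    show "\<forall>\<^sub>F F in finite_subsets_at_top UNIV. dist (\<Sum>k\<in>F. fcoeff f (m - k) * c k) (fcoeff (\<lambda>\<theta>. f \<theta> * ?g \<theta>) m) < e"
    proof eventually_elim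
      case (elim F)
      have sb: "ess_bounded (?s F)"
        by (intro ess_bounded_sum ess_bounded_mult ess_bounded_const ess_bounded_cis)
      have "(\<lambda>\<theta>. f \<theta> * ?s F \<theta>) = (\<lambda>\<theta>. \<Sum>k\<in>F. c k * (f \<theta> * cis (real_of_int k * \<theta>)))"
        by (simp add: sum_distrib_left mult_ac)
      then have "fcoeff (\<lambda>\<theta>. f \<theta> * ?s F \<theta>) m = (\<Sum>k\<in>F. fcoeff f (m - k) * c k)"
        using f
        by (simp only: fcoeff_sum ess_bounded_mult ess_bounded_const ess_bounded_cis fcoeff_cmult fcoeff_cis_mult)
           (simp only: mult.commute)
      then have "(\<Sum>k\<in>F. fcoeff f (m - k) * c k) - fcoeff (\<lambda>\<theta>. f \<theta> * ?g \<theta>) m =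
          fcoeff (\<lambda>\<theta>. f \<theta> * ?s F \<theta> - f \<theta> * ?g \<theta>) m"
        using f sb g by (subst fcoeff_diff) auto
      also have "cmod \<dots> \<le> 1 / (2 * pi) * (2 * pi * (\<bar>C\<bar> * d))"
        unfolding fcoeff_def norm_mult
      proof (intro mult_mono norm_integral_le)
        show "ess_bounded (\<lambda>\<theta>. (f \<theta> * ?s F \<theta> - f \<theta> * ?g \<theta>) * cis (- (real_of_int m * \<theta>)))"
          by (intro f sb g ess_bounded_mult ess_bounded_diff ess_bounded_cis_uminus)
        show "AE \<theta> in angle_measure. cmod ((f \<theta> * ?s F \<theta> - f \<theta> * ?g \<theta>) * cis (- (real_of_int m * \<theta>))) \<le> \<bar>C\<bar> * d"
          using C
        proof eventually_elim
          case (elim \<theta>)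
          have "cmod ((f \<theta> * ?s F \<theta> - f \<theta> * ?g \<theta>) * cis (- (real_of_int m * \<theta>))) = cmod (f \<theta>) * dist (?s F \<theta>) (?g \<theta>)"
            by (simp add: norm_mult dist_norm flip: right_diff_distrib)
          also have "\<dots> \<le> \<bar>C\<bar> * d"
            using elim \<open>\<forall>x\<in>UNIV. dist (?s F x) (?g x) < d\<close> by (intro mult_mono) (auto intro: less_imp_le)
          finally show ?case .
        qed
      qed (auto simp: norm_divide)
      also have "\<dots> = \<bar>C\<bar> * d" by simp
      also have "\<dots> < (\<bar>C\<bar> + 1) * d"
        using d by (intro mult_strict_right_mono) auto
      also have "\<dots> = e" by (simp add: d_def)
      finally show ?case by (simp add: dist_norm)
    qed
  qed
qed

text \<open>
  Both sides have the same Fourier coefficients.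
\<close>

lemma fourier_series_AE:
  assumes h: "ess_bounded h" "(\<lambda>k. cmod (fcoeff h k)) summable_on UNIV"
  shows "AE \<theta> in angle_measure. h \<theta> = (\<Sum>\<^sub>\<infinity>k. fcoeff h k * cis (real_of_int k * \<theta>))"
proof -
  let ?g = "\<lambda>\<theta>. \<Sum>\<^sub>\<infinity>k. fcoeff h k * cis (real_of_int k * \<theta>)"
  have g: "ess_bounded ?g" by (rule ess_bounded_trig_series[OF h(2)])
  have "fcoeff ?g m = fcoeff h m" for m
  proof -
    have "((\<lambda>k. fcoeff (\<lambda>_. 1) (m - k) * fcoeff h k) has_sum fcoeff ?g m) UNIV"
      using has_sum_fcoeff_mult_trig_series[OF h(2) ess_bounded_const[of 1]] by simp
    moreover have "((\<lambda>k. fcoeff (\<lambda>_. 1) (m - k) * fcoeff h k) has_sum fcoeff h m) UNIV"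
      by (rule has_sum_finite_neutralI[of "{m}"]) (auto simp: fcoeff_1)
    ultimately show ?thesis by (rule has_sum_unique)
  qed
  then have "fcoeff (\<lambda>\<theta>. h \<theta> - ?g \<theta>) m = 0" for m
    using h(1) g by (simp add: fcoeff_diff)
  then have "AE \<theta> in angle_measure. h \<theta> - ?g \<theta> = 0"
    by (intro fourier_uniqueness ess_bounded_diff h(1) g)
  then show ?thesis by simp
qed

theorem has_sum_fcoeff_mult:
  assumes f: "ess_bounded f" and h: "ess_bounded h" "(\<lambda>k. cmod (fcoeff h k)) summable_on UNIV"
  shows "((\<lambda>k. fcoeff f (m - k) * fcoeff h k) has_sum fcoeff (\<lambda>\<theta>. f \<theta> * h \<theta>) m) UNIV"
proof -
  let ?g = "\<lambda>\<theta>. \<Sum>\<^sub>\<infinity>k. fcoeff h k * cis (real_of_int k * \<theta>)"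
  have "fcoeff (\<lambda>\<theta>. f \<theta> * h \<theta>) m = fcoeff (\<lambda>\<theta>. f \<theta> * ?g \<theta>) m"
  proof (rule fcoeff_cong_AE)
    show "AE \<theta> in angle_measure. f \<theta> * h \<theta> = f \<theta> * ?g \<theta>"
      using fourier_series_AE[OF h] by eventually_elim simp
  qed (use f h ess_bounded_trig_series[OF h(2)] in auto)
  with has_sum_fcoeff_mult_trig_series[OF h(2) f] show ?thesis by simp
qed

section \<open>Symbols and their Laurent matrices\<close>

lemma Linf_iff_ess_bounded: "a \<in> Linf \<longleftrightarrow> (\<forall>i j. ess_bounded (\<lambda>\<theta>. a (cis \<theta>) $ i $ j))"
  by (auto simp: Linf_def ess_bounded_def)

lemma K11_summable_norm:
  assumes "a \<in> K11"
  shows "(\<lambda>m. norm (fourier_coeff a m)) summable_on UNIV"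
proof (rule summable_on_comparison_test)
  show "(\<lambda>m::int. (real_of_int \<bar>m\<bar> + 1) * norm (fourier_coeff a m)) summable_on UNIV"
    using assms by (simp add: K11_def)
  show "norm (fourier_coeff a m) \<le> (real_of_int \<bar>m\<bar> + 1) * norm (fourier_coeff a m)" for m
    by (simp add: ring_distribs)
qed auto

lemma norm_entry_le: "cmod (A $ i $ j) \<le> norm A" for A :: "complex ^ 'n::finite ^ 'm::finite"
  by (rule order_trans[OF Finite_Cartesian_Product.norm_nth_le Finite_Cartesian_Product.norm_nth_le])

lemma has_sum_fourier_coeff_mult:
  fixes u v :: "('n::finite) matrix_fun"
  assumes u: "u \<in> Linf" and v: "v \<in> Linf" "(\<lambda>m. norm (fourier_coeff v m)) summable_on UNIV"
  shows "((\<lambda>k. \<Sum>l\<in>UNIV. fourier_coeff u (m - k) $ i $ l * fourier_coeff v k $ l $ j) has_sum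
          fourier_coeff (\<lambda>z. u z ** v z) m $ i $ j) UNIV"
proof -
  have ub: "ess_bounded (\<lambda>\<theta>. u (cis \<theta>) $ i $ l)" and vb: "ess_bounded (\<lambda>\<theta>. v (cis \<theta>) $ l $ j)" for l
    using u v(1) by (auto simp: Linf_iff_ess_bounded)
  have sm: "(\<lambda>k. cmod (fcoeff (\<lambda>\<theta>. v (cis \<theta>) $ l $ j) k)) summable_on UNIV" for l
    by (rule summable_on_comparison_test[OF v(2)]) (auto simp flip: fourier_coeff_entry intro: norm_entry_le)
  have "((\<lambda>k. \<Sum>l\<in>UNIV. fourier_coeff u (m - k) $ i $ l * fourier_coeff v k $ l $ j) has_sum
        (\<Sum>l\<in>UNIV. fcoeff (\<lambda>\<theta>. u (cis \<theta>) $ i $ l * v (cis \<theta>) $ l $ j) m)) UNIV"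
    unfolding fourier_coeff_entry
    by (intro has_sum_sum finite has_sum_fcoeff_mult ub vb sm)
  also have "(\<Sum>l\<in>UNIV. fcoeff (\<lambda>\<theta>. u (cis \<theta>) $ i $ l * v (cis \<theta>) $ l $ j) m) =
      fourier_coeff (\<lambda>z. u z ** v z) m $ i $ j"
    unfolding fourier_coeff_entry
    by (subst fcoeff_sum[symmetric]) (auto intro: ub vb simp: matrix_matrix_mult_def)
  finally show ?thesis .
qed

lemma Linf_mult:
  assumes "u \<in> Linf" "v \<in> Linf"
  shows "(\<lambda>z. u z ** v z) \<in> Linf"
  using assms unfolding Linf_iff_ess_bounded
  by (auto simp: matrix_matrix_mult_def intro!: ess_bounded_sum ess_bounded_mult)

lemma AE_angle_iff_negligible:
  "(AE \<theta> in angle_measure. P \<theta>) \<longleftrightarrow> negligible {\<theta> \<in> {0..2 * pi}. \<not> P \<theta>}"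
proof -
  have "(AE \<theta> in angle_measure. P \<theta>) \<longleftrightarrow> (AE \<theta> in lebesgue. \<theta> \<in> {0..2 * pi} \<longrightarrow> P \<theta>)"
    by (rule AE_restrict_space_iff) auto
  also have "\<dots> \<longleftrightarrow> (\<exists>N. negligible N \<and> {\<theta> \<in> {0..2 * pi}. \<not> P \<theta>} \<subseteq> N)"
    unfolding eventually_ae_filter_negligible by (intro ex_cong1 conj_cong refl) auto
  also have "\<dots> \<longleftrightarrow> negligible {\<theta> \<in> {0..2 * pi}. \<not> P \<theta>}"
    using negligible_subset by blast
  finally show ?thesis .
qed

lemma ess_bounded_cong_AE:
  assumes f: "ess_bounded f" and eq: "AE \<theta> in angle_measure. f \<theta> = g \<theta>"
  shows "ess_bounded g"
proof -
  have "f measurable_on {0..2 * pi}"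
    using f by (simp add: measurable_on_iff_borel_measurable ess_bounded_def)
  then have "g measurable_on {0..2 * pi}"
    by (rule measurable_on_spike[OF _ eq[unfolded AE_angle_iff_negligible]]) auto
  then have "g \<in> borel_measurable angle_measure"
    by (simp add: measurable_on_iff_borel_measurable)
  moreover obtain C where "AE \<theta> in angle_measure. cmod (f \<theta>) \<le> C"
    using f by (auto simp: ess_bounded_def)
  then have "AE \<theta> in angle_measure. cmod (g \<theta>) \<le> C"
    using eq by eventually_elim simp
  ultimately show ?thesis by (auto simp: ess_bounded_def)
qed

lemma fourier_coeff_cong_AE:
  assumes u: "u \<in> Linf" and eq: "AE \<theta> in angle_measure. u (cis \<theta>) = v (cis \<theta>)"
  shows "fourier_coeff u m = fourier_coeff v m"
proof -
  have eq': "AE \<theta> in angle_measure. u (cis \<theta>) $ i $ j = v (cis \<theta>) $ i $ j" for i j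
    using eq by eventually_elim simp
  have ub: "ess_bounded (\<lambda>\<theta>. u (cis \<theta>) $ i $ j)" for i j
    using u by (simp add: Linf_iff_ess_bounded)
  show ?thesis
    unfolding vec_eq_iff fourier_coeff_entry
    using fcoeff_cong_AE[OF eq' ub ess_bounded_cong_AE[OF ub eq']] by blast
qed

lemma fourier_coeff_mat_1: "fourier_coeff (\<lambda>_. mat 1) m $ i $ j = (if m = 0 \<and> i = j then 1 else 0)"
  using fcoeff_1[of m] by (cases "i = j") (auto simp: fourier_coeff_entry mat_def, simp add: fcoeff_def)

type_synonym 'n idx = "int \<times> 'n"

definition laurent_mat :: "('n::finite) matrix_fun \<Rightarrow> 'n idx bmat" where
  "laurent_mat a = Abs_bmat (\<lambda>p q. fourier_coeff a (fst p - fst q) $ snd p $ snd q)"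

text \<open>
  A row or column of a Laurent matrix meets every Fourier coefficient once for each of the
  \<open>CARD('n)\<close> component indices.
\<close>

lemma sum_shifted_le:
  fixes w :: "int \<Rightarrow> real"
  assumes w: "w summable_on UNIV" "\<And>m. 0 \<le> w m" and h: "inj h" and X: "finite (X :: (int \<times> 'n::finite) set)"
  shows "(\<Sum>q\<in>X. w (h (fst q))) \<le> real CARD('n) * infsum w UNIV"
proof -
  have "(\<Sum>q\<in>X. w (h (fst q))) \<le> (\<Sum>q\<in>fst ` X \<times> (UNIV :: 'n set). w (h (fst q)))"
    by (rule sum_mono2) (use X w in \<open>auto simp: rev_image_eqI\<close>)
  also have "\<dots> = real CARD('n) * (\<Sum>k\<in>fst ` X. w (h k))"
    by (simp add: sum.cartesian_product[symmetric, of "\<lambda>k _. w (h k)", unfolded case_prod_unfold] sum_distrib_left)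
  also have "(\<Sum>k\<in>fst ` X. w (h k)) = sum w (h ` fst ` X)"
    by (subst sum.reindex) (use h in \<open>auto intro: inj_on_subset\<close>)
  also have "sum w (h ` fst ` X) \<le> infsum w UNIV"
    by (rule finite_sum_le_infsum) (use w X in auto)
  finally show ?thesis by (simp add: mult_left_mono)
qed

lemma entry_laurent_mat:
  assumes "(\<lambda>m. norm (fourier_coeff a m)) summable_on UNIV"
  shows "entry (laurent_mat a) p q = fourier_coeff a (fst p - fst q) $ snd p $ snd q"
proof -
  let ?A = "\<lambda>p q. fourier_coeff a (fst p - fst q) $ snd p $ snd q"
  have "row_col_bounded ?A"
  proof (rule row_col_boundedI)
    let ?C = "real CARD('a) * (\<Sum>\<^sub>\<infinity>m. norm (fourier_coeff a m))"
    show "row_bounded ?A ?C"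
      unfolding row_bounded_def
    proof safe
      fix j \<alpha> and X :: "'a idx set" assume X: "finite X"
      have "(\<Sum>q\<in>X. cmod (?A (j, \<alpha>) q)) \<le> (\<Sum>q\<in>X. norm (fourier_coeff a (j - fst q)))"
        by (rule sum_mono) (simp add: norm_entry_le)
      also have "\<dots> \<le> ?C"
        by (rule sum_shifted_le[OF assms _ _ X]) (auto simp: inj_def)
      finally show "(\<Sum>q\<in>X. cmod (?A (j, \<alpha>) q)) \<le> ?C" .
    qed
    show "row_bounded (\<lambda>q p. ?A p q) ?C"
      unfolding row_bounded_def
    proof safe
      fix j \<alpha> and X :: "'a idx set" assume X: "finite X"
      have "(\<Sum>p\<in>X. cmod (?A p (j, \<alpha>))) \<le> (\<Sum>p\<in>X. norm (fourier_coeff a (fst p - j)))"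
        by (rule sum_mono) (simp add: norm_entry_le)
      also have "\<dots> \<le> ?C"
        by (rule sum_shifted_le[OF assms _ _ X]) (auto simp: inj_def)
      finally show "(\<Sum>p\<in>X. cmod (?A p (j, \<alpha>))) \<le> ?C" .
    qed
  qed
  then show ?thesis
    by (simp add: laurent_mat_def Abs_bmat_inverse)
qed

text \<open>
  $L(u)L(v) = L(uv)$: the entries of the product are the convolution of the Fourier coefficients.
\<close>

lemma entry_laurent_mat_mult:
  fixes u v :: "('n::finite) matrix_fun"
  assumes u: "u \<in> Linf" "(\<lambda>m. norm (fourier_coeff u m)) summable_on UNIV"
    and v: "v \<in> Linf" "(\<lambda>m. norm (fourier_coeff v m)) summable_on UNIV"
  shows "entry (laurent_mat u * laurent_mat v) p q =
    fourier_coeff (\<lambda>z. u z ** v z) (fst p - fst q) $ snd p $ snd q"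
proof -
  let ?U = "laurent_mat u" and ?V = "laurent_mat v"
  let ?f = "\<lambda>r. entry ?U p r * entry ?V r q"
  have "(?f has_sum entry (?U * ?V) p q) (UNIV \<times> UNIV)"
    unfolding entry_times by (auto intro!: has_sum_infsum row_col_bounded_summable row_col_bounded_entry)
  then have "((\<lambda>r. \<Sum>l\<in>UNIV. ?f (r, l)) has_sum entry (?U * ?V) p q) UNIV"
    by (rule has_sum_SigmaD) (rule has_sum_finite, simp)
  moreover have "((\<lambda>r. \<Sum>l\<in>UNIV. ?f (r, l)) has_sum
      fourier_coeff (\<lambda>z. u z ** v z) (fst p - fst q) $ snd p $ snd q) UNIV"
    using has_sum_fourier_coeff_mult[OF u(1) v, of "fst p - fst q" "snd p" "snd q"]
    by (subst (asm) has_sum_reindex_bij_betw[symmetric, of "\<lambda>r. r - fst q" UNIV])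
       (auto simp: entry_laurent_mat u v intro!: bij_betwI[where g="\<lambda>t. t + fst q"])
  ultimately show ?thesis by (rule has_sum_unique)
qed

lemma invertible_matrix_inv:
  assumes "invertible A"
  shows "A ** matrix_inv A = mat 1" "matrix_inv A ** A = mat 1"
  using someI_ex[OF assms[unfolded invertible_def]] by (simp_all add: matrix_inv_def)

lemma laurent_mat_inverse:
  fixes u :: "('n::finite) matrix_fun"
  assumes u: "u \<in> K11" "fun_inv u \<in> K11" "ae_invertible u"
  shows "laurent_mat u * laurent_mat (fun_inv u) = 1" "laurent_mat (fun_inv u) * laurent_mat u = 1"
proof -
  have L: "u \<in> Linf" "fun_inv u \<in> Linf" using u by (auto simp: K11_def)
  note S = K11_summable_norm[OF u(1)] K11_summable_norm[OF u(2)]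
  have inv: "AE \<theta> in angle_measure. u (cis \<theta>) ** fun_inv u (cis \<theta>) = mat 1 \<and> fun_inv u (cis \<theta>) ** u (cis \<theta>) = mat 1"
    using u(3) unfolding ae_invertible_def
    by eventually_elim (simp add: fun_inv_def invertible_matrix_inv)
  have "fourier_coeff (\<lambda>z. u z ** fun_inv u z) m = fourier_coeff (\<lambda>_. mat 1) m" for m
    by (rule fourier_coeff_cong_AE[OF Linf_mult[OF L]]) (use inv in eventually_elim, simp)
  then show "laurent_mat u * laurent_mat (fun_inv u) = 1"
    by (intro bmat_eqI)
       (auto simp: entry_laurent_mat_mult L S fourier_coeff_mat_1 kron_def prod_eq_iff)
  have "fourier_coeff (\<lambda>z. fun_inv u z ** u z) m = fourier_coeff (\<lambda>_. mat 1) m" for m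
    by (rule fourier_coeff_cong_AE[OF Linf_mult[OF L(2,1)]]) (use inv in eventually_elim, simp)
  then show "laurent_mat (fun_inv u) * laurent_mat u = 1"
    by (intro bmat_eqI)
       (auto simp: entry_laurent_mat_mult L S fourier_coeff_mat_1 kron_def prod_eq_iff)
qed

section \<open>Hankel blocks and triangularity\<close>

definition proj_P :: "'n idx bmat" where
  "proj_P = diag (\<lambda>p. if 0 \<le> fst p then 1 else 0)"

definition proj_Q :: "'n idx bmat" where
  "proj_Q = 1 - proj_P"

lemma bounded_range_if: "bounded (range (\<lambda>p. if Q p then 1 else 0 :: complex))"
  by (rule finite_imp_bounded, rule finite_subset[of _ "{0, 1}"]) auto

lemma proj_Q_diag: "proj_Q = diag (\<lambda>p. if fst p < 0 then 1 else 0)"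
  unfolding proj_Q_def proj_P_def
  by (rule bmat_eqI) (auto simp: entry_diag[OF bounded_range_if] kron_def)

lemma entry_P_Q: "entry (proj_P * A * proj_Q) p q = (if 0 \<le> fst p \<and> fst q < 0 then entry A p q else 0)"
  unfolding proj_Q_diag unfolding proj_P_def
  by (simp add: entry_times_diag[OF bounded_range_if] entry_diag_times[OF bounded_range_if])

lemma entry_Q_P: "entry (proj_Q * A * proj_P) p q = (if fst p < 0 \<and> 0 \<le> fst q then entry A p q else 0)"
  unfolding proj_Q_diag unfolding proj_P_def
  by (simp add: entry_times_diag[OF bounded_range_if] entry_diag_times[OF bounded_range_if])

text \<open>
  The diagonal $j - k = m$ meets the quadrant $j \ge 0 > k$ in $m$ points if $m > 0$ and not at all
  otherwise. This is where the weight of $K_1^1$ comes from.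
\<close>

lemma summable_hankel:
  fixes w :: "int \<Rightarrow> real"
  assumes w: "(\<lambda>m. (real_of_int \<bar>m\<bar> + 1) * w m) summable_on UNIV" "\<And>m. 0 \<le> w m"
  shows "(\<lambda>(j, k). w (j - k)) summable_on {0..} \<times> {..<0}"
    and "(\<lambda>(j, k). w (j - k)) summable_on {..<0} \<times> {0..}"
proof -
  have 1: "(\<lambda>(j, k). w (j - k)) summable_on {0..} \<times> {..<0}"
    if w: "(\<lambda>m. (real_of_int \<bar>m\<bar> + 1) * w m) summable_on UNIV" "\<And>m. 0 \<le> w m" for w :: "int \<Rightarrow> real"
  proof -
    have "(\<lambda>(m, j). w m) summable_on Sigma UNIV (\<lambda>m. {0..<m})"
    proof (rule summable_on_SigmaI)
      show "((\<lambda>j. case (m, j) of (m, j) \<Rightarrow> w m) has_sum real (nat m) * w m) {0..<m}" for m :: int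
        using has_sum_finite[of "{0..<m}" "\<lambda>_. w m"] by simp
      show "(\<lambda>m. real (nat m) * w m) summable_on UNIV"
        by (rule summable_on_comparison_test[OF w(1)]) (use w(2) in \<open>auto intro!: mult_right_mono\<close>)
    qed (use w in auto)
    moreover have "bij_betw (\<lambda>(j, k). (j - k, j)) ({0..} \<times> {..<0}) (Sigma UNIV (\<lambda>m::int. {0..<m}))"
      by (rule bij_betwI[where g="\<lambda>(m, j). (j, j - m)"]) auto
    ultimately show ?thesis
      by (subst (asm) summable_on_reindex_bij_betw[symmetric]) (auto simp: case_prod_unfold)
  qed
  show "(\<lambda>(j, k). w (j - k)) summable_on {0..} \<times> {..<0}"
    by (rule 1) (use w in auto)
  have "(\<lambda>m. (real_of_int \<bar>m\<bar> + 1) * w (- m)) summable_on UNIV"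
    using w(1) by (subst (asm) summable_on_reindex_bij_betw[symmetric, of uminus UNIV])
      (auto intro!: bij_betwI[where g=uminus])
  from 1[OF this] w(2) have "(\<lambda>(j, k). w (k - j)) summable_on {0..} \<times> {..<0}"
    by simp
  then show "(\<lambda>(j, k). w (j - k)) summable_on {..<0} \<times> {0..}"
    by (subst summable_on_swap) (simp add: case_prod_unfold)
qed

text \<open>
  Reduces summability over pairs of indices in $\mathbf Z \times \{1,\dots,N\}$ to summability over pairs of integers.
\<close>

lemma summable_index_pairs:
  fixes g :: "int \<Rightarrow> int \<Rightarrow> real" and K :: "('n::finite) idx \<Rightarrow> 'n idx \<Rightarrow> complex"
  assumes g: "(\<lambda>(j, k). g j k) summable_on A \<times> B" "\<And>j k. 0 \<le> g j k"
    and K: "\<And>p q. cmod (K p q) \<le> (if fst p \<in> A \<and> fst q \<in> B then g (fst p) (fst q) else 0)"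
  shows "(\<lambda>(p, q). cmod (K p q)) summable_on UNIV"
proof -
  let ?h = "\<lambda>((j, k), (\<alpha>::'n, \<beta>::'n)). g j k"
  have "?h summable_on (A \<times> B) \<times> UNIV"
  proof (rule summable_on_SigmaI)
    show "((\<lambda>y. ?h (x, y)) has_sum (\<Sum>y\<in>UNIV. ?h (x, y))) UNIV" for x
      by (rule has_sum_finite) simp
    have "(\<lambda>x. real CARD('n \<times> 'n) * (case x of (j, k) \<Rightarrow> g j k)) summable_on A \<times> B"
      by (intro summable_on_cmult_right g)
    then show "(\<lambda>x. \<Sum>y\<in>UNIV. ?h (x, y)) summable_on A \<times> B"
      by (simp add: case_prod_unfold)
  qed (use g in auto)
  moreover have "bij_betw (\<lambda>((j, \<alpha>), (k, \<beta>)). ((j, k), (\<alpha>, \<beta>)))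
      ((A \<times> (UNIV :: 'n set)) \<times> (B \<times> (UNIV :: 'n set))) ((A \<times> B) \<times> UNIV)"
    by (rule bij_betwI[where g="\<lambda>((j, k), (\<alpha>, \<beta>)). ((j, \<alpha>), (k, \<beta>))"]) auto
  ultimately have "(\<lambda>(p, q). g (fst p) (fst q)) summable_on (A \<times> (UNIV :: 'n set)) \<times> (B \<times> (UNIV :: 'n set))"
    by (subst (asm) summable_on_reindex_bij_betw[symmetric]) (auto simp: case_prod_unfold)
  then have "(\<lambda>(p, q). if fst p \<in> A \<and> fst q \<in> B then g (fst p) (fst q) else 0) summable_on (UNIV :: ('n idx \<times> 'n idx) set)"
    by (subst summable_on_cong_neutral[of _ UNIV]) (auto split: if_splits)
  then show ?thesis
    by (rule summable_on_comparison_test) (use K in auto)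
qed

lemma summable_entries_hankel:
  assumes a: "a \<in> K11"
  shows "summable_entries (proj_P * laurent_mat a * proj_Q)" (is ?PQ)
    and "summable_entries (proj_Q * laurent_mat a * proj_P)" (is ?QP)
proof -
  have w: "(\<lambda>m. (real_of_int \<bar>m\<bar> + 1) * norm (fourier_coeff a m)) summable_on UNIV"
    using a by (simp add: K11_def)
  note e = entry_laurent_mat[OF K11_summable_norm[OF a]]
  show ?PQ
    unfolding summable_entries_def entry_P_Q
    by (rule summable_index_pairs[OF summable_hankel(1)[OF w]]) (auto simp: e norm_entry_le)
  show ?QP
    unfolding summable_entries_def entry_Q_P
    by (rule summable_index_pairs[OF summable_hankel(2)[OF w]]) (auto simp: e norm_entry_le)
qed

lemma laurent_mat_minus_upper: "a \<in> K11 \<Longrightarrow> a \<in> Hinf_minus \<Longrightarrow> proj_P * laurent_mat a * proj_Q = 0"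
  by (rule bmat_eqI) (auto simp: entry_P_Q entry_laurent_mat K11_summable_norm Hinf_minus_def)

lemma laurent_mat_plus_lower:
  fixes a :: "('n::finite) matrix_fun"
  assumes "a \<in> K11" "a \<in> Hinf_plus"
  shows "proj_Q * laurent_mat a * proj_P = 0"
proof (rule bmat_eqI)
  fix p q :: "'n idx"
  have "fourier_coeff a (fst p - fst q) = 0" if "fst p < 0" "0 \<le> fst q"
    using assms(2) that by (auto simp: Hinf_plus_def dest: spec[of _ "fst q - fst p"])
  then show "entry (proj_Q * laurent_mat a * proj_P) p q = entry 0 p q"
    by (auto simp: entry_Q_P entry_laurent_mat K11_summable_norm assms)
qed

section \<open>The determinant identity for matrices\<close>

text \<open>
  The algebra of the proof in an arbitrary ring, with the central element \<open>c\<close> in the role of the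
  scalar $s$. The matrices \<open>KM\<close>, \<open>KN\<close> and \<open>KT\<close> are $M - I$, $N - I$ and $MN - I$. The last two
  conclusions say that $MN$ is block triangular with the identity on the range of $Q$, and that its
  block on the range of $P$ is that of $I + cP - D - cDR$.
  
  The computation rests on the splitting $R = V + X'$ with $V = U_+^{-1}QU_+$ and
  $X' = U_+^{-1}XU_+$, where $VP = 0$, $QV = Q$ and $RX' = X'$.
\<close>

lemma wiener_hopf_algebra:
  fixes P Q Um Umi Up Upi c D :: "'r::ring_1"
  assumes PQ: "P = 1 - Q" "Q * Q = Q"
    and inv: "Um * Umi = 1" "Umi * Um = 1" "Up * Upi = 1" "Upi * Up = 1"
    and tri: "P * Um * Q = 0" "P * Umi * Q = 0" "Q * Up * P = 0" "Q * Upi * P = 0"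
    and c: "\<And>x. x * c = c * x" and D: "Q * D = 0"
  defines "X \<equiv> Umi * Q * Um - Q" and "R \<equiv> Upi * Umi * Q * (Um * Up)"
  defines "KM \<equiv> c - c * R - D" and "KN \<equiv> Upi * (c * X) * Up"
  defines "KT \<equiv> KM + KN + KM * KN"
  shows "Q * X = X" "X * Q = 0" "Q * KT = 0" "KT * P = (c * P - D - c * D * R) * P"
proof -
  have e: "a * (b * z) = d * z" if "a * b = d" for a b d z :: 'r
    using that by (simp flip: mult.assoc)
  have q: "Q * Um * Q = Um * Q" "Q * Umi * Q = Umi * Q" "Q * Up * Q = Q * Up" "Q * Upi * Q = Q * Upi"
  proof -
    have "P * a * Q = a * Q - Q * a * Q" "Q * a * P = Q * a - Q * a * Q" for a
      unfolding PQ(1) by (simp_all only: left_diff_distrib right_diff_distrib mult_1_left mult_1_right)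
    with tri show "Q * Um * Q = Um * Q" "Q * Umi * Q = Umi * Q" "Q * Up * Q = Q * Up" "Q * Upi * Q = Q * Upi"
      by (simp_all only: right_minus_eq)
  qed
  have "Q * (Umi * Q * Um) = Umi * Q * Um"
    using q(2) by (simp flip: mult.assoc)
  then show QX: "Q * X = X"
    by (simp add: X_def right_diff_distrib PQ)
  have "Umi * Q * Um * Q = Umi * (Q * Um * Q)" by (simp add: mult.assoc)
  also have "\<dots> = Q" by (simp add: q e[OF inv(2)])
  finally show XQ: "X * Q = 0"
    by (simp add: X_def left_diff_distrib PQ)
  have XX: "X * X = 0"
  proof -
    have "X * X = X * (Q * X)" by (simp only: QX)
    also have "\<dots> = X * Q * X" by (simp only: mult.assoc)
    also have "\<dots> = 0" by (simp only: XQ mult_zero_left)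
    finally show ?thesis .
  qed
  define V where "V = Upi * Q * Up"
  define X' where "X' = Upi * X * Up"
  have R: "R = V + X'"
    by (simp add: R_def V_def X'_def X_def ring_distribs mult.assoc)
  have VX: "V * X' = X'"
    by (simp add: V_def X'_def mult.assoc e[OF inv(3)] e[OF QX])
  have XX': "X' * X' = 0"
    by (simp add: X'_def mult.assoc e[OF inv(3)] e[OF XX])
  have RX: "R * X' = X'" by (simp add: R ring_distribs VX XX')
  have QV: "Q * V = Q"
  proof -
    have "Q * V = Q * Upi * Q * Up" by (simp only: V_def mult.assoc)
    also have "\<dots> = Q" by (simp add: q(4)) (simp add: mult.assoc inv(4))
    finally show ?thesis .
  qed
  have VP: "V * P = 0"
    using arg_cong[OF tri(3), of "\<lambda>x. Upi * x"] by (simp add: V_def mult.assoc)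
  have KN: "KN = c * X'"
    unfolding KN_def X'_def by (simp only: mult.assoc e[OF c[of Upi]])
  have "KM * KN = c * (c * X') - c * (c * (R * X')) - c * (D * X')"
  proof -
    have "KM * KN = c * (c * X') - c * (R * (c * X')) - D * (c * X')"
      by (simp only: KM_def KN left_diff_distrib mult.assoc)
    also have "\<dots> = c * (c * X') - c * (c * (R * X')) - c * (D * X')"
      by (simp only: e[OF c[of R]] e[OF c[of D]] mult.assoc)
    finally show ?thesis .
  qed
  then have KT: "KT = c - c * V - D - c * (D * X')"
    unfolding KT_def RX by (simp add: KM_def KN R right_diff_distrib distrib_left)
  have "Q * (c * y) = c * (Q * y)" for y
    by (simp only: e[OF c[of Q]] mult.assoc)
  then show "Q * KT = 0"
    by (simp only: KT right_diff_distrib c QV D e[OF D] mult_zero_left mult_zero_right diff_self diff_0_right)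
  have PP: "P * P = P" by (simp add: PQ ring_distribs)
  have RP: "R * P = X' * P" by (simp add: R ring_distribs VP)
  show "KT * P = (c * P - D - c * D * R) * P"
    by (simp add: KT left_diff_distrib mult.assoc VP PP RP)
qed

text \<open>
  Here \<open>d\<close> and \<open>c\<close> are the values of the diagonal matrices $D$ and of the one in front of
  $L^{-1}QL$ in $B$. The assumption \<open>dc\<close> says that $FC = sD$.
\<close>

theorem bdet_wiener_hopf:
  fixes Um Umi Up Upi :: "('n::finite) idx bmat" and d c :: "int \<Rightarrow> complex"
  assumes inv: "Um * Umi = 1" "Umi * Um = 1" "Up * Upi = 1" "Upi * Up = 1"
    and tri: "proj_P * Um * proj_Q = 0" "proj_P * Umi * proj_Q = 0"
             "proj_Q * Up * proj_P = 0" "proj_Q * Upi * proj_P = 0"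
    and sum: "summable_entries (proj_Q * Um * proj_P)" "summable_entries (proj_P * Up * proj_Q)"
    and bd: "bounded (range d)" "bounded (range c)"
    and neg: "\<And>l. l < 0 \<Longrightarrow> d l = 0" "\<And>l. l < 0 \<Longrightarrow> c l = 0"
    and large: "\<And>l. l \<ge> m \<Longrightarrow> d l = s"
    and dc: "\<And>l. (1 + s - d l) * c l = s * d l"
  defines "L \<equiv> Um * Up" and "Li \<equiv> Upi * Umi"
    and "D \<equiv> diag (\<lambda>p. d (fst p))" and "C \<equiv> diag (\<lambda>p. c (fst p))"
  shows "summable_entries (scal s * proj_P - L * D * Li)"
    and "summable_entries (C * (Li * proj_Q * L))"
    and "bdet (scal s * proj_P - L * D * Li) =
      (\<Prod>l\<in>{0..<m}. (1 + s - d l) ^ CARD('n)) * bdet (- (C * (Li * proj_Q * L)))"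
proof -
  let ?P = "proj_P :: 'n idx bmat" and ?Q = "proj_Q :: 'n idx bmat" and ?c = "scal s :: 'n idx bmat"
  have e: "a * (b * z) = d * z" if "a * b = d" for a b d z :: "'n idx bmat"
    using that by (simp flip: mult.assoc)
  note smult = summable_entries_mult[OF disjI1] summable_entries_mult[OF disjI2]
  have bd': "bounded (range (\<lambda>p::'n idx. d (fst p)))" "bounded (range (\<lambda>p::'n idx. c (fst p)))"
    by (rule bounded_subset[OF bd(1)], force) (rule bounded_subset[OF bd(2)], force)
  \<comment> \<open>\<open>E\<close> is $F - I$.\<close>
  define f where "f = (\<lambda>p::'n idx. (if 0 \<le> fst p then s else 0) - d (fst p))"
  have f0: "f p = 0" if "p \<notin> {0..<m} \<times> UNIV" for p
    using that neg large by (cases p) (auto simp: f_def not_less not_le)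
  have bf: "bounded (range f)"
  proof (rule finite_imp_bounded, rule finite_subset)
    show "range f \<subseteq> insert 0 (f ` ({0..<m} \<times> UNIV))"
    proof
      fix y assume "y \<in> range f"
      then obtain p where "y = f p" by auto
      then show "y \<in> insert 0 (f ` ({0..<m} \<times> UNIV))"
        using f0[of p] by (cases "p \<in> {0..<m} \<times> UNIV") auto
    qed
  qed auto
  define E where "E = diag f"
  have E: "E = ?c * ?P - D"
    unfolding E_def D_def proj_P_def
    by (rule bmat_eqI, simp only: entry_minus entry_scal_times entry_diag[OF bf] entry_diag[OF bd'(1)]
          entry_diag[OF bounded_range_if]) (simp add: f_def)
  have Esum: "summable_entries E"
    unfolding summable_entries_def
  proof (rule finite_nonzero_values_imp_summable_on, rule finite_subset)
    show "{x \<in> UNIV. (case x of (p, q) \<Rightarrow> cmod (entry E p q)) \<noteq> 0} \<subseteq> (\<lambda>p. (p, p)) ` ({0..<m} \<times> UNIV)"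
    proof
      fix x assume x: "x \<in> {x \<in> UNIV. (case x of (p, q) \<Rightarrow> cmod (entry E p q)) \<noteq> 0}"
      obtain p q where pq: "x = (p, q)" by (cases x)
      with x have "p = q" "f p \<noteq> 0" by (auto simp: E_def entry_diag[OF bf] split: if_splits)
      then show "x \<in> (\<lambda>p. (p, p)) ` ({0..<m} \<times> UNIV)"
        using f0[of p] pq by blast
    qed
  qed simp
  have PQ: "?P = 1 - ?Q" "?Q = 1 - ?P" by (simp_all add: proj_Q_def)
  have PP: "?P * ?P = ?P"
    unfolding proj_P_def
    by (rule bmat_eqI) (auto simp: entry_diag_times[OF bounded_range_if] entry_diag[OF bounded_range_if])
  have QQ: "?Q * ?Q = ?Q" by (simp add: proj_Q_def ring_distribs PP)
  have PD: "?P * D = D" and PC: "C * ?P = C"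
    unfolding proj_P_def D_def C_def
    by (rule bmat_eqI, use neg in \<open>auto simp: entry_diag_times[OF bounded_range_if] entry_times_diag[OF bounded_range_if] entry_diag[OF bd'(1)] entry_diag[OF bd'(2)]\<close>)+
  have QD: "?Q * D = 0" by (simp add: proj_Q_def left_diff_distrib PD)
  \<comment> \<open>A commutator with \<open>?P\<close> consists of two Hankel blocks, so \<open>L\<close> commutes with \<open>?P\<close> up to a summable matrix.\<close>
  have com: "A * ?P - ?P * A = ?Q * A * ?P - ?P * A * ?Q" for A
    unfolding proj_Q_def by (simp add: ring_distribs mult.assoc)
  have LL: "L * Li = 1" "Li * L = 1"
    using e[OF inv(3)] e[OF inv(2)] inv unfolding L_def Li_def by (simp_all add: mult.assoc)
  have comU: "summable_entries (Um * ?P - ?P * Um)" "summable_entries (Up * ?P - ?P * Up)"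
    using sum by (simp_all add: com tri summable_entries_uminus)
  have "L * ?P - ?P * L = Um * (Up * ?P - ?P * Up) + (Um * ?P - ?P * Um) * Up"
    by (simp add: L_def ring_distribs mult.assoc)
  then have comL: "summable_entries (L * ?P - ?P * L)"
    by (simp only:) (rule summable_entries_add[OF smult(2)[OF comU(2)] smult(1)[OF comU(1)]])
  have "(L * ?P - ?P * L) * Li = L * ?P * Li - ?P"
    by (simp add: left_diff_distrib mult.assoc LL)
  then have "summable_entries (L * ?P * Li - ?P)"
    using smult(1)[OF comL, of Li] by simp
  then have s1: "summable_entries (?c * (L * ?P * Li - ?P))"
    by (rule smult(2))
  have A_eq: "?c * ?P - L * D * Li = L * E * Li - ?c * (L * ?P * Li - ?P)"
    by (simp add: E left_diff_distrib right_diff_distrib mult.assoc e[OF scal_commute[of L]])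
  show Asum: "summable_entries (?c * ?P - L * D * Li)"
    unfolding A_eq by (rule summable_entries_diff[OF smult(1)[OF smult(2)[OF Esum]] s1])
  have PQ0: "?P * ?Q = 0" by (simp add: proj_Q_def right_diff_distrib PP)
  have "Li * (L * ?P - ?P * L) * Li * ?Q = ?P * Li * ?Q"
    by (simp add: left_diff_distrib right_diff_distrib mult.assoc e[OF LL(2)] e[OF LL(1)] PQ0)
  moreover have "summable_entries (Li * (L * ?P - ?P * L) * Li * ?Q)"
    by (rule smult(1)[OF smult(1)[OF smult(2)[OF comL]]])
  ultimately have PLiQ: "summable_entries (?P * Li * ?Q)" by simp
  \<comment> \<open>Since \<open>C\<close> lives on the range of \<open>?P\<close>, only a Hankel block of \<open>Li\<close> remains.\<close>
  have B_eq: "C * (Li * ?Q * L) = C * (?P * Li * ?Q) * L"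
    using arg_cong[OF PC, of "\<lambda>x. x * Li * ?Q * L"] by (simp add: mult.assoc)
  show Bsum: "summable_entries (C * (Li * ?Q * L))"
    unfolding B_eq by (rule smult(1)[OF smult(2)[OF PLiQ]])
  define X where "X = Umi * ?Q * Um - ?Q"
  define R where "R = Upi * Umi * ?Q * (Um * Up)"
  define KM where "KM = ?c - ?c * R - D"
  define KN where "KN = Upi * (?c * X) * Up"
  define KT where "KT = KM + KN + KM * KN"
  note alg = wiener_hopf_algebra[OF PQ(1) QQ inv tri scal_commute[of _ s] QD,
      folded X_def, folded R_def, folded KM_def KN_def, folded KT_def]
  have R_eq: "R = Li * ?Q * L" by (simp add: R_def Li_def L_def mult.assoc)
  have KM_eq: "Li * (?c * ?P - L * D * Li) * L = KM"
    by (simp add: KM_def R_eq PQ(1) left_diff_distrib right_diff_distrib mult.assoc e[OF LL(2)] LL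
        e[OF scal_commute[of Li]])
  have KMsum: "summable_entries KM"
    unfolding KM_eq[symmetric] by (rule smult(1)[OF smult(2)[OF Asum]])
  have "X = Umi * (Um * ?P - ?P * Um)"
    unfolding X_def PQ(1) by (simp add: right_diff_distrib mult.assoc e[OF inv(2)] inv(2)) (simp add: left_diff_distrib right_diff_distrib mult.assoc e[OF inv(2)] inv(2))
  then have Xsum: "summable_entries X" by (simp only: smult(2)[OF comU(1)])
  then have cXsum: "summable_entries (?c * X)" by (rule smult(2))
  have KNsum: "summable_entries KN" unfolding KN_def by (rule smult(1)[OF smult(2)[OF cXsum]])
  have KTsum: "summable_entries KT"
    unfolding KT_def by (rule summable_entries_add[OF summable_entries_add[OF KMsum KNsum] smult(1)[OF KMsum]])
  \<comment> \<open>Conjugation reduces this to $I + sX$, where $X = QX$ and $XQ = 0$.\<close>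
  have det_KN: "bdet KN = 1"
  proof -
    have "bdet KN = bdet (Upi * (?c * X * Up))" by (simp add: KN_def mult.assoc)
    also have "\<dots> = bdet (?c * X * Up * Upi)"
      by (rule bdet_mult_commute) (rule disjI2[OF smult(1)[OF cXsum]])
    also have "?c * X * Up * Upi = ?c * X" by (simp add: mult.assoc inv)
    also have "?c * X = ?Q * (?c * X)" by (simp add: e[OF scal_commute[of ?Q]] mult.assoc alg(1))
    also have "bdet (?Q * (?c * X)) = bdet (?c * X * ?Q)"
      by (rule bdet_mult_commute) (rule disjI2[OF cXsum])
    also have "?c * X * ?Q = 0" by (simp add: mult.assoc alg(2))
    finally show ?thesis by (simp only: bdet_0)
  qed
  define B where "B = C * (Li * ?Q * L)"
  have FB: "E + - B + E * - B = ?c * ?P - D - ?c * D * R"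
  proof -
    have "B + E * B = ?c * D * R"
    proof -
      have "C + E * C = ?c * D"
        unfolding E_def C_def D_def
        by (rule bmat_eqI, simp only: entry_simps entry_scal_times entry_diag_times[OF bf]
              entry_diag[OF bd'(1)] entry_diag[OF bd'(2)])
           (use dc neg in \<open>auto simp: f_def algebra_simps not_le\<close>)
      from arg_cong[OF this, of "\<lambda>A. A * R"] show ?thesis
        by (simp only: B_def R_eq distrib_right mult.assoc)
    qed
    then show ?thesis by (simp add: E algebra_simps)
  qed
  have FBsum: "summable_entries (E + - B + E * - B)"
    by (rule summable_entries_add[OF summable_entries_add[OF Esum] smult(1)[OF Esum]])
       (simp add: B_def summable_entries_uminus Bsum)
  have "bdet (?c * ?P - L * D * Li) = bdet (L * (Li * (?c * ?P - L * D * Li)))"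
    by (simp add: e[OF LL(1)])
  also have "\<dots> = bdet (Li * (?c * ?P - L * D * Li) * L)"
    by (rule bdet_mult_commute) (rule disjI2[OF smult(2)[OF Asum]])
  also have "\<dots> = bdet KM * bdet KN"
    by (simp add: KM_eq det_KN)
  also have "\<dots> = bdet KT"
    unfolding KT_def by (rule bdet_mult[symmetric]) (rule KMsum KNsum)+
  also have "KT = ?P * KT"
    using alg(3) by (simp add: PQ(1) left_diff_distrib)
  also have "bdet (?P * KT) = bdet (KT * ?P)"
    by (rule bdet_mult_commute) (rule disjI2[OF KTsum])
  also have "KT * ?P = (E + - B + E * - B) * ?P"
    unfolding FB by (rule alg(4))
  also have "bdet \<dots> = bdet (?P * (E + - B + E * - B))"
    by (rule bdet_mult_commute) (rule disjI1[OF FBsum])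
  also have "?P * (E + - B + E * - B) = E + - B + E * - B"
    unfolding FB by (simp add: right_diff_distrib e[OF scal_commute[of ?P]] PP PD mult.assoc e[OF PD])
  also have "bdet (E + - B + E * - B) = bdet E * bdet (- B)"
    using Bsum by (intro bdet_mult Esum) (simp add: B_def summable_entries_uminus)
  also have "bdet E = (\<Prod>p\<in>{0..<m} \<times> (UNIV :: 'n set). 1 + f p)"
    unfolding E_def by (rule bdet_diag[OF bf]) (auto intro: f0)
  also have "\<dots> = (\<Prod>(l, i)\<in>{0..<m} \<times> (UNIV :: 'n set). 1 + s - d l)"
    by (rule prod.cong) (auto simp: f_def add_diff_eq)
  also have "\<dots> = (\<Prod>l\<in>{0..<m}. \<Prod>i\<in>(UNIV :: 'n set). 1 + s - d l)"
    by (rule prod.cartesian_product[symmetric])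
  also have "\<dots> = (\<Prod>l\<in>{0..<m}. (1 + s - d l) ^ CARD('n))"
    by simp
  finally show "bdet (?c * ?P - L * D * Li) =
      (\<Prod>l\<in>{0..<m}. (1 + s - d l) ^ CARD('n)) * bdet (- (C * (Li * ?Q * L)))"
    by (simp only: B_def)
qed

section \<open>Operators represented by matrices\<close>

text \<open>
  The test vectors are all bounded sequences and not only those in \<open>ell2\<close>: matrices with bounded row
  sums map bounded sequences to bounded sequences, so composition needs no separate proof that the
  operators preserve \<open>ell2\<close>.
\<close>

definition represents :: "('n::finite) oper \<Rightarrow> 'n idx bmat \<Rightarrow> bool" where
  "represents T M \<longleftrightarrow> (\<forall>x. bounded (range x) \<longrightarrow>
     (\<forall>l i. T x l $ i = (\<Sum>\<^sub>\<infinity>q. entry M (l, i) q * x (fst q) $ snd q)))"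

lemma representsD:
  "represents T M \<Longrightarrow> bounded (range x) \<Longrightarrow> T x l $ i = (\<Sum>\<^sub>\<infinity>q. entry M (l, i) q * x (fst q) $ snd q)"
  by (simp add: represents_def)

lemma bounded_vseqE:
  fixes x :: "('n::finite) vseq"
  assumes "bounded (range x)"
  obtains B where "\<And>q. cmod (x (fst q) $ snd q) \<le> B"
proof -
  obtain B where "\<And>l. norm (x l) \<le> B" using assms by (auto simp: bounded_iff)
  then show ?thesis
    by (intro that[of B]) (meson Finite_Cartesian_Product.norm_nth_le order_trans)
qed

lemma entry_row_boundedE:
  obtains C where "row_bounded (entry M) C"
  using row_col_bounded_entry[of M] by (auto simp: row_col_bounded_def)

lemma represents_summable:
  fixes x :: "('n::finite) vseq"
  assumes "bounded (range x)"
  shows "(\<lambda>q. entry M p q * x (fst q) $ snd q) summable_on UNIV"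
proof -
  obtain B C where "\<And>q. cmod (x (fst q) $ snd q) \<le> B" "row_bounded (entry M) C"
    using bounded_vseqE[OF assms] entry_row_boundedE by metis
  then show ?thesis
    by (intro abs_summable_summable[OF row_bounded_times_bounded(1)])
qed

lemma represents_bounded:
  fixes T :: "('n::finite) oper"
  assumes T: "represents T M" and x: "bounded (range x)"
  shows "bounded (range (T x))"
proof -
  obtain B C where B: "\<And>q. cmod (x (fst q) $ snd q) \<le> B" and C: "row_bounded (entry M) C"
    using bounded_vseqE[OF x] entry_row_boundedE by metis
  have "norm (T x l) \<le> real CARD('n) * (C * B)" for l
  proof -
    have "norm (T x l) \<le> (\<Sum>i\<in>UNIV. cmod (T x l $ i))"
      unfolding norm_vec_def by (rule L2_set_le_sum) simp
    also have "\<dots> \<le> (\<Sum>i\<in>(UNIV :: 'n set). C * B)"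
      by (intro sum_mono) (simp add: representsD[OF T x] row_bounded_apply_le[OF C B])
    finally show ?thesis by simp
  qed
  then show ?thesis by (auto simp: bounded_iff)
qed

lemma represents_comp:
  assumes S: "represents S A" and T: "represents T B"
  shows "represents (S \<circ> T) (A * B)"
  unfolding represents_def
proof (intro allI impI)
  fix x :: "'a vseq" and l i assume x: "bounded (range x)"
  obtain M a b where M: "\<And>q. cmod (x (fst q) $ snd q) \<le> M" and a: "row_bounded (entry A) a" and b: "row_bounded (entry B) b"
    using bounded_vseqE[OF x] entry_row_boundedE by metis
  have "(S \<circ> T) x l $ i = (\<Sum>\<^sub>\<infinity>r. entry A (l, i) r * T x (fst r) $ snd r)"
    using representsD[OF S represents_bounded[OF T x]] by simp
  also have "\<dots> = (\<Sum>\<^sub>\<infinity>r. entry A (l, i) r * (\<Sum>\<^sub>\<infinity>q. entry B r q * x (fst q) $ snd q))"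
    by (simp add: representsD[OF T x])
  also have "\<dots> = (\<Sum>\<^sub>\<infinity>q. entry (A * B) (l, i) q * x (fst q) $ snd q)"
    using mat_mult_apply[OF a b M] by (simp add: times_bmat.rep_eq)
  finally show "(S \<circ> T) x l $ i = (\<Sum>\<^sub>\<infinity>q. entry (A * B) (l, i) q * x (fst q) $ snd q)" .
qed

lemma represents_add:
  assumes "represents S A" "represents T B"
  shows "represents (S + T) (A + B)"
  using assms unfolding represents_def
  by (simp add: plus_fun_def ring_distribs infsum_add represents_summable)

lemma represents_diff:
  assumes "represents S A" "represents T B"
  shows "represents (S - T) (A - B)"
proof -
  have "infsum (\<lambda>q. entry (A - B) p q * x (fst q) $ snd q) UNIV =
      infsum (\<lambda>q. entry A p q * x (fst q) $ snd q) UNIV - infsum (\<lambda>q. entry B p q * x (fst q) $ snd q) UNIV"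
    if x: "bounded (range x)" for x p
    using infsum_add[OF represents_summable[OF x, of A p] represents_summable[OF x, of "- B" p]]
    by (simp add: infsum_uminus algebra_simps)
  then show ?thesis
    using assms unfolding represents_def by (simp add: fun_diff_def)
qed

lemma represents_zero: "represents 0 0"
  by (simp add: represents_def)

lemma represents_scale: "represents T M \<Longrightarrow> represents (c *\<^sub>o T) (scal c * M)"
  by (simp add: represents_def op_scale_def mult.assoc infsum_cmult_right')

lemma represents_sum:
  "(\<And>i. i \<in> I \<Longrightarrow> represents (f i) (g i)) \<Longrightarrow> represents (\<Sum>i\<in>I. f i) (\<Sum>i\<in>I. g i)"
  by (induction I rule: infinite_finite_induct) (auto intro: represents_zero represents_add)

definition mat_Qn :: "int \<Rightarrow> 'n idx bmat" where
  "mat_Qn m = diag (\<lambda>p. if m \<le> fst p then 1 else 0)"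

lemma entry_mat_Qn: "entry (mat_Qn m) p q = (if p = q \<and> m \<le> fst p then 1 else 0)"
  by (simp add: mat_Qn_def entry_diag[OF bounded_range_if])

lemma infsum_single: "(\<Sum>\<^sub>\<infinity>q. if p = q then f q else 0) = (f p :: 'b :: {comm_monoid_add, t2_space})"
proof -
  have "(\<Sum>\<^sub>\<infinity>q. if p = q then f q else 0) = (\<Sum>\<^sub>\<infinity>q\<in>{p}. f q)"
    by (rule infsum_cong_neutral) auto
  then show ?thesis by simp
qed

lemma represents_id: "represents id 1"
proof -
  have "(\<Sum>\<^sub>\<infinity>q. kron (l, i) q * x (fst q) $ snd q) = x l $ i" for x :: "'a vseq" and l i
    using infsum_single[of "(l, i)" "\<lambda>q. x (fst q) $ snd q"]
    by (simp add: kron_def if_distrib[of "\<lambda>c. c * _"] cong: if_cong)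
  then show ?thesis by (simp add: represents_def)
qed

lemma represents_Qn: "represents (op_Qn m) (mat_Qn m)"
proof -
  have "(\<Sum>\<^sub>\<infinity>q. entry (mat_Qn m) (l, i) q * x (fst q) $ snd q) = op_Qn m x l $ i" for x :: "'a vseq" and l i
  proof -
    have "(\<Sum>\<^sub>\<infinity>q. entry (mat_Qn m) (l, i) q * x (fst q) $ snd q) =
        (\<Sum>\<^sub>\<infinity>q. if (l, i) = q then op_Qn m x l $ i else 0)"
      by (rule infsum_cong) (auto simp: entry_mat_Qn op_Qn_def)
    then show ?thesis by (simp add: infsum_single)
  qed
  then show ?thesis by (simp add: represents_def)
qed

lemma represents_P: "represents (op_P :: ('n::finite) oper) proj_P"
proof -
  have 1: "(op_P :: 'n oper) = op_Qn 0" and 2: "(proj_P :: 'n idx bmat) = mat_Qn 0"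
    by (simp_all add: op_P_def op_Qn_def proj_P_def mat_Qn_def)
  show ?thesis unfolding 1 2 by (rule represents_Qn)
qed

lemma represents_Q: "represents op_Q proj_Q"
  unfolding op_Q_def proj_Q_def by (intro represents_diff represents_id represents_P)

lemma has_sum_vec:
  fixes f :: "'a \<Rightarrow> complex ^ 'n::finite"
  assumes "\<And>i. ((\<lambda>k. f k $ i) has_sum s $ i) A"
  shows "(f has_sum s) A"
  using assms unfolding has_sum_def by (intro vec_tendstoI) (simp add: sum_component)

lemma represents_laurent:
  fixes a :: "('n::finite) matrix_fun"
  assumes M: "\<And>p q. entry M p q = fourier_coeff a (fst p - fst q) $ snd p $ snd q"
  shows "represents (laurent_op a) M"
  unfolding represents_def
proof (intro allI impI)
  fix x :: "'n vseq" and l i assume x: "bounded (range x)"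
  let ?s = "\<lambda>i. \<Sum>\<^sub>\<infinity>q. entry M (l, i) q * x (fst q) $ snd q"
  have "((\<lambda>k. (fourier_coeff a (l - k) *v x k) $ i) has_sum ?s i) UNIV" for i
  proof -
    have "((\<lambda>q. entry M (l, i) q * x (fst q) $ snd q) has_sum ?s i) (UNIV \<times> UNIV)"
      using represents_summable[OF x] by simp
    then show ?thesis
      by (rule has_sum_SigmaD) (auto simp: M matrix_vector_mult_def intro: has_sum_finite)
  qed
  then have "((\<lambda>k. fourier_coeff a (l - k) *v x k) has_sum (\<chi> i. ?s i)) UNIV"
    by (intro has_sum_vec) simp
  then have "laurent_op a x l = (\<chi> i. ?s i)"
    unfolding laurent_op_def by (rule infsumI)
  then show "laurent_op a x l $ i = ?s i" by simp
qed

definition basis_vseq :: "('n::finite) idx \<Rightarrow> 'n vseq" where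
  "basis_vseq q = (\<lambda>l. if l = fst q then axis (snd q) 1 else 0)"

lemma bounded_basis: "bounded (range (basis_vseq q))"
  by (rule finite_imp_bounded, rule finite_subset[of _ "{axis (snd q) 1, 0}"]) (auto simp: basis_vseq_def)

lemma basis_component: "basis_vseq q (fst p) $ snd p = (if q = p then 1 else 0)"
  by (auto simp: basis_vseq_def axis_def prod_eq_iff)

lemma op_entry_represents:
  assumes "represents T M"
  shows "op_entry T = entry M"
proof (intro ext)
  fix p q
  have "op_entry T p q = T (basis_vseq q) (fst p) $ snd p"
    by (simp add: op_entry_def basis_vseq_def)
  also have "\<dots> = (\<Sum>\<^sub>\<infinity>r. if q = r then entry M p r else 0)"
    by (simp add: representsD[OF assms bounded_basis] basis_component if_distrib[of "\<lambda>c. _ * c"] cong: if_cong)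
  finally show "op_entry T p q = entry M p q" by (simp add: infsum_single)
qed

lemma fredholm_det_represents:
  assumes "represents T M"
  shows "fredholm_det (id + T) = bdet M"
proof -
  have "id + T - id = T" by simp
  then show ?thesis
    using op_entry_represents[OF assms]
    by (simp add: fredholm_det_def fdet_def principal_minor_def set_det_def)
qed

lemma ell2_bounded:
  assumes "x \<in> ell2"
  shows "bounded (range x)"
proof -
  have sm: "(\<lambda>l. (norm (x l))\<^sup>2) summable_on UNIV" using assms by (simp add: ell2_def)
  have "norm (x l) \<le> sqrt (\<Sum>\<^sub>\<infinity>l. (norm (x l))\<^sup>2)" for l
    using finite_sum_le_infsum[OF sm, of "{l}"] by (simp add: real_le_rsqrt)
  then show ?thesis by (auto simp: bounded_iff)
qed

lemma
  shows cbasis_ell2: "(\<lambda>l. c *s basis_vseq q l) \<in> ell2"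
    and ell2_norm_cbasis: "ell2_norm (\<lambda>l. c *s basis_vseq q l) = cmod c"
    and ell2_inner_basis: "ell2_inner x (basis_vseq q) = x (fst q) $ snd q"
proof -
  have n: "(norm (c *s basis_vseq q l))\<^sup>2 = (if fst q = l then (cmod c)\<^sup>2 else 0)" for l
    by (auto simp: basis_vseq_def norm_vec_def L2_set_def axis_def if_distrib[of cmod] if_distrib[of "\<lambda>x. x\<^sup>2"]
          if_distrib[of "\<lambda>x. c * x"] cong: if_cong)
  show "(\<lambda>l. c *s basis_vseq q l) \<in> ell2"
    unfolding ell2_def mem_Collect_eq n
    by (rule finite_nonzero_values_imp_summable_on, rule finite_subset[of _ "{fst q}"]) auto
  show "ell2_norm (\<lambda>l. c *s basis_vseq q l) = cmod c"
    unfolding ell2_norm_def n infsum_single by simp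
  have "(\<Sum>i\<in>UNIV. x l $ i * cnj (basis_vseq q l $ i)) = (if fst q = l then x l $ snd q else 0)" for l
    by (simp add: basis_vseq_def axis_def if_distrib[of cnj] if_distrib[of "\<lambda>c. _ * c"] cong: if_cong)
  then show "ell2_inner x (basis_vseq q) = x (fst q) $ snd q"
    unfolding ell2_inner_def by (simp add: infsum_single)
qed

text \<open>
  Every matrix entry contributes the rank one operator $x \mapsto M_{pq}\langle x, e_q\rangle e_p$, whose
  trace norm is $|M_{pq}|$. The pairs $(p, q)$ are enumerated by the natural numbers.
\<close>

theorem trace_class_represents:
  fixes T :: "('n::finite) oper"
  assumes T: "represents T M" and M: "summable_entries M"
  shows "trace_class T"
  unfolding trace_class_def
proof (intro exI conjI ballI allI)
  define e where "e = from_nat_into (UNIV :: ('n idx \<times> 'n idx) set)"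
  have e: "bij_betw e UNIV UNIV"
    unfolding e_def by (rule bij_betw_from_nat_into) (auto simp: finite_prod)
  let ?u = "\<lambda>m l. entry M (fst (e m)) (snd (e m)) *s basis_vseq (fst (e m)) l"
  let ?v = "\<lambda>m. basis_vseq (snd (e m))"
  have v1: "?v m = (\<lambda>l. 1 *s basis_vseq (snd (e m)) l)" for m by simp
  show "?u m \<in> ell2" "?v m \<in> ell2" for m
    by (rule cbasis_ell2, subst v1, rule cbasis_ell2)
  have "(\<lambda>m. cmod (entry M (fst (e m)) (snd (e m)))) summable_on UNIV"
    using M by (subst (asm) summable_entries_def, subst (asm) summable_on_reindex_bij_betw[OF e, symmetric])
      (simp add: case_prod_unfold)
  moreover have "ell2_norm (?v m) = 1" for m
    by (subst v1, subst ell2_norm_cbasis) simp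
  ultimately show "summable (\<lambda>m. ell2_norm (?u m) * ell2_norm (?v m))"
    by (simp add: ell2_norm_cbasis summable_on_imp_summable)
  fix x :: "'n vseq" and l assume "x \<in> ell2"
  then have x: "bounded (range x)" by (rule ell2_bounded)
  show "(\<lambda>m. ell2_inner x (?v m) *s ?u m l) sums T x l"
    unfolding sums_def
  proof (rule vec_tendstoI)
    fix i
    let ?g = "\<lambda>(p, q). x (fst q) $ snd q * (entry M p q * basis_vseq p l $ i)"
    have "((\<lambda>q. entry M (l, i) q * x (fst q) $ snd q) has_sum T x l $ i) UNIV"
      using represents_summable[OF x] by (simp add: representsD[OF T x])
    then have "(?g has_sum T x l $ i) (Pair (l, i) ` UNIV)"
      using basis_component[of "(l, i)" "(l, i)"]
      by (subst has_sum_reindex) (auto simp: o_def inj_on_def mult_ac)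
    moreover have "basis_vseq p l $ i = 0" if "p \<noteq> (l, i)" for p :: "'n idx"
      using basis_component[of p "(l, i)"] that by simp
    ultimately have "(?g has_sum T x l $ i) UNIV"
      by (subst has_sum_cong_neutral[where T="Pair (l, i) ` UNIV" and g="?g"]) (auto simp: image_iff)
    then have "((\<lambda>m. ?g (e m)) has_sum T x l $ i) UNIV"
      by (subst has_sum_reindex_bij_betw[OF e])
    then have "(\<lambda>m. ?g (e m)) sums (T x l $ i)"
      by (rule has_sum_imp_sums)
    then show "(\<lambda>N. (\<Sum>m<N. ell2_inner x (?v m) *s ?u m l) $ i) \<longlonglongrightarrow> T x l $ i"
      unfolding sums_def by (simp add: ell2_inner_basis case_prod_unfold sum_component mult.assoc)
  qed
qed

section \<open>Factorized symbols\<close>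

lemma laurent_mat_factorization:
  fixes a :: "('n::finite) matrix_fun"
  assumes a: "a \<in> Linf"
    and um: "um \<in> K11" "fun_inv um \<in> K11" "ae_invertible um"
    and up: "up \<in> K11" "fun_inv up \<in> K11" "ae_invertible up"
    and eq: "AE \<theta> in angle_measure. a (cis \<theta>) = um (cis \<theta>) ** up (cis \<theta>)"
  shows "represents (laurent_op a) (laurent_mat um * laurent_mat up)"
    and "represents (laurent_op (fun_inv a)) (laurent_mat (fun_inv up) * laurent_mat (fun_inv um))"
proof -
  have L: "um \<in> Linf" "up \<in> Linf" "fun_inv um \<in> Linf" "fun_inv up \<in> Linf"
    using um up by (auto simp: K11_def)
  note S = K11_summable_norm[OF um(1)] K11_summable_norm[OF um(2)] K11_summable_norm[OF up(1)] K11_summable_norm[OF up(2)]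
  have "fourier_coeff a m = fourier_coeff (\<lambda>z. um z ** up z) m" for m
    by (rule fourier_coeff_cong_AE[OF a eq])
  then show "represents (laurent_op a) (laurent_mat um * laurent_mat up)"
    by (intro represents_laurent) (simp add: entry_laurent_mat_mult L S)
  have "fourier_coeff (fun_inv a) m = fourier_coeff (\<lambda>z. fun_inv up z ** fun_inv um z) m" for m
  proof (rule fourier_coeff_cong_AE[OF Linf_mult[OF L(4,3)], symmetric])
    show "AE \<theta> in angle_measure. fun_inv up (cis \<theta>) ** fun_inv um (cis \<theta>) = fun_inv a (cis \<theta>)"
      using um(3)[unfolded ae_invertible_def] up(3)[unfolded ae_invertible_def] eq
    proof eventually_elim
      case (elim \<theta>)
      let ?u = "um (cis \<theta>)" and ?v = "up (cis \<theta>)" and ?b = "matrix_inv (a (cis \<theta>))"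
      note i = invertible_matrix_inv[OF elim(1)] invertible_matrix_inv[OF elim(2)]
      have inv: "invertible (a (cis \<theta>))"
        using elim by (simp add: invertible_mult)
      have "matrix_inv ?v ** matrix_inv ?u ** (?u ** ?v) = matrix_inv ?v ** (matrix_inv ?u ** ?u) ** ?v"
        by (simp add: matrix_mul_assoc)
      also have "\<dots> = mat 1" by (simp add: i)
      finally have "matrix_inv ?v ** matrix_inv ?u ** a (cis \<theta>) = mat 1" by (simp add: elim(3))
      then have "matrix_inv ?v ** matrix_inv ?u ** (a (cis \<theta>) ** ?b) = ?b"
        by (simp add: matrix_mul_assoc)
      then show ?case
        by (simp add: fun_inv_def invertible_matrix_inv[OF inv])
    qed
  qed
  then show "represents (laurent_op (fun_inv a)) (laurent_mat (fun_inv up) * laurent_mat (fun_inv um))"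
    by (intro represents_laurent) (simp add: entry_laurent_mat_mult L S)
qed

section \<open>Block diagonal matrices\<close>

text \<open>
  The function that is $\sigma_j$ on $[n_j, n_{j+1})$ for $j \le k$, with $n_{k+1} = \infty$, and $0$
  to the left of $n_0$. Blocks may be empty; the maximum picks the last $j$ with $n_j \le l$, whose
  block is the one that contains $l$.
\<close>

definition block_value :: "nat \<Rightarrow> (nat \<Rightarrow> int) \<Rightarrow> (nat \<Rightarrow> complex) \<Rightarrow> int \<Rightarrow> complex" where
  "block_value k n \<sigma> l = (if l < n 0 then 0 else \<sigma> (Max {j. j \<le> k \<and> n j \<le> l}))"

lemma breakpoints_mono:
  fixes n :: "nat \<Rightarrow> int"
  assumes mono: "\<forall>j<k. n j \<le> n (Suc j)"
  shows "i \<le> j \<Longrightarrow> j \<le> k \<Longrightarrow> n i \<le> n j"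
proof (induction j rule: dec_induct)
  case (step j)
  then have "n i \<le> n j" "n j \<le> n (Suc j)" using mono by auto
  then show ?case by (rule order_trans)
qed simp

lemma sum_increments:
  fixes s :: "nat \<Rightarrow> complex"
  shows "(\<Sum>j=1..k. s j - s (j - 1)) = s k - s 0"
  by (induction k) auto

lemma block_valueE:
  assumes mono: "\<forall>j<k. n j \<le> n (Suc j)" and l: "n 0 \<le> (l::int)"
  obtains j0 where "j0 \<le> k" "\<And>j. j \<le> k \<Longrightarrow> n j \<le> l \<longleftrightarrow> j \<le> j0" "\<And>\<sigma>. block_value k n \<sigma> l = \<sigma> j0"
proof
  let ?J = "{j. j \<le> k \<and> n j \<le> l}"
  have J: "finite ?J" "?J \<noteq> {}" using l by auto
  show "Max ?J \<le> k" using Max_in[OF J] by auto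
  note le = breakpoints_mono[OF mono]
  show "n j \<le> l \<longleftrightarrow> j \<le> Max ?J" if "j \<le> k" for j
    using that Max_ge[OF J(1), of j] Max_in[OF J] le[of j "Max ?J"] by auto
  show "block_value k n \<sigma> l = \<sigma> (Max ?J)" for \<sigma>
    using l by (simp add: block_value_def)
qed

lemma bounded_block_value: "bounded (range (block_value k n \<sigma>))"
proof (rule finite_imp_bounded, rule finite_subset)
  show "range (block_value k n \<sigma>) \<subseteq> insert 0 (\<sigma> ` {..k})"
  proof
    fix y assume "y \<in> range (block_value k n \<sigma>)"
    then obtain l where y: "y = block_value k n \<sigma> l" by auto
    show "y \<in> insert 0 (\<sigma> ` {..k})"
    proof (cases "l < n 0")
      case False
      then have "Max {j. j \<le> k \<and> n j \<le> l} \<in> {j. j \<le> k \<and> n j \<le> l}"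
        by (intro Max_in) auto
      then show ?thesis using False by (auto simp: y block_value_def)
    qed (simp add: y block_value_def)
  qed
qed simp

abbreviation block_diag :: "nat \<Rightarrow> (nat \<Rightarrow> int) \<Rightarrow> (nat \<Rightarrow> complex) \<Rightarrow> 'n idx bmat" where
  "block_diag k n \<sigma> \<equiv> diag (\<lambda>p. block_value k n \<sigma> (fst p))"

lemma entry_block_diag: "entry (block_diag k n \<sigma>) p q = (if p = q then block_value k n \<sigma> (fst p) else 0)"
  by (rule entry_diag, rule bounded_subset[OF bounded_block_value[of k n \<sigma>]]) auto

text \<open>
  At a coordinate of block $j_0$ exactly the summands $1 \le j \le j_0$ contribute, and they telescope.
\<close>

lemma sum_telescope_Qn:
  assumes mono: "\<forall>j<k. n j \<le> n (Suc j)" and s0: "s 0 = 0"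
  shows "(\<Sum>j=1..k. scal (s j - s (j - 1)) * mat_Qn (n j)) = block_diag k n s"
proof (rule bmat_eqI)
  fix p q :: "'a idx"
  show "entry (\<Sum>j=1..k. scal (s j - s (j - 1)) * mat_Qn (n j)) p q = entry (block_diag k n s) p q"
  proof (cases "p = q")
    case True
    let ?l = "fst q"
    have "entry (\<Sum>j=1..k. scal (s j - s (j - 1)) * mat_Qn (n j)) p q =
        (\<Sum>j=1..k. if n j \<le> ?l then s j - s (j - 1) else 0)"
      unfolding entry_sum by (rule sum.cong) (auto simp: entry_mat_Qn True)
    also have "\<dots> = block_value k n s ?l"
    proof (cases "?l < n 0")
      case True
      have "\<not> n j \<le> ?l" if "j \<in> {1..k}" for j
        using that True breakpoints_mono[OF mono, of 0 j] by simp
      then show ?thesis using True by (simp add: block_value_def)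
    next
      case False
      then obtain j0 where j0: "j0 \<le> k" "\<And>j. j \<le> k \<Longrightarrow> n j \<le> ?l \<longleftrightarrow> j \<le> j0" "block_value k n s ?l = s j0"
        using block_valueE[OF mono, of ?l] by (metis not_less)
      have "(\<Sum>j=1..k. if n j \<le> ?l then s j - s (j - 1) else 0) = (\<Sum>j=1..j0. s j - s (j - 1))"
        by (rule sum.mono_neutral_cong_right) (use j0 in auto)
      also have "\<dots> = s j0"
        by (simp only: sum_increments s0) simp
      finally show ?thesis by (simp add: j0)
    qed
    finally show ?thesis by (simp add: entry_block_diag True)
  qed (simp add: entry_mat_Qn entry_block_diag)
qed

lemma sum_block_proj:
  assumes mono: "\<forall>j<k. n j \<le> n (Suc j)" and \<sigma>0: "\<sigma> 0 = 0"
  shows "(\<Sum>j=1..k. scal (\<sigma> j) * (mat_Qn (n j) - (if j < k then mat_Qn (n (Suc j)) else 0))) = block_diag k n \<sigma>"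
proof (rule bmat_eqI)
  fix p q :: "'a idx"
  show "entry (\<Sum>j=1..k. scal (\<sigma> j) * (mat_Qn (n j) - (if j < k then mat_Qn (n (Suc j)) else 0))) p q =
      entry (block_diag k n \<sigma>) p q"
  proof (cases "p = q")
    case True
    let ?l = "fst q"
    have "entry (\<Sum>j=1..k. scal (\<sigma> j) * (mat_Qn (n j) - (if j < k then mat_Qn (n (Suc j)) else 0))) p q =
        (\<Sum>j=1..k. \<sigma> j * ((if n j \<le> ?l then 1 else 0) - (if j < k \<and> n (Suc j) \<le> ?l then 1 else 0)))"
      unfolding entry_sum by (rule sum.cong) (auto simp: entry_mat_Qn True)
    also have "\<dots> = block_value k n \<sigma> ?l"
    proof (cases "?l < n 0")
      case True
      have le: "n 0 \<le> n j" if "j \<le> k" for j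
        using that by (intro breakpoints_mono[OF mono]) auto
      have "\<sigma> j * ((if n j \<le> ?l then 1 else 0) - (if j < k \<and> n (Suc j) \<le> ?l then 1 else 0)) = 0" if "j \<in> {1..k}" for j
        using that le[of j] le[of "Suc j"] True by auto
      then have "(\<Sum>j=1..k. \<sigma> j * ((if n j \<le> ?l then 1 else 0) - (if j < k \<and> n (Suc j) \<le> ?l then 1 else 0))) = 0"
        by (intro sum.neutral ballI)
      then show ?thesis using True by (simp only: block_value_def if_True)
    next
      case False
      then obtain j0 where j0: "j0 \<le> k" "\<And>j. j \<le> k \<Longrightarrow> n j \<le> ?l \<longleftrightarrow> j \<le> j0" "block_value k n \<sigma> ?l = \<sigma> j0"
        using block_valueE[OF mono, of ?l] by (metis not_less)
      have "(\<Sum>j=1..k. \<sigma> j * ((if n j \<le> ?l then 1 else 0) - (if j < k \<and> n (Suc j) \<le> ?l then 1 else 0))) =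
          (\<Sum>j=1..k. if j = j0 then \<sigma> j else 0)"
      proof (rule sum.cong[OF refl])
        fix j assume "j \<in> {1..k}"
        then have e: "n j \<le> ?l \<longleftrightarrow> j \<le> j0" "j < k \<and> n (Suc j) \<le> ?l \<longleftrightarrow> Suc j \<le> j0"
          using j0(1) j0(2)[of j] j0(2)[of "Suc j"] by auto
        show "\<sigma> j * ((if n j \<le> ?l then 1 else 0) - (if j < k \<and> n (Suc j) \<le> ?l then 1 else 0)) =
            (if j = j0 then \<sigma> j else 0)"
          unfolding e by auto
      qed
      also have "\<dots> = \<sigma> j0"
        using j0(1) \<sigma>0 by (cases "j0 = 0") auto
      finally show ?thesis by (simp add: j0)
    qed
    finally show ?thesis by (simp add: entry_block_diag True)
  qed (auto simp: entry_mat_Qn entry_block_diag intro!: sum.neutral)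
qed

text \<open>
  The product over an interval splits at the breakpoints, and each block contributes a constant.
\<close>

lemma prod_block_value:
  assumes mono: "\<forall>j<k. n j \<le> n (Suc j)" and "m \<le> k"
  shows "(\<Prod>l\<in>{n 0..<n m}. g (block_value k n s l)) = (\<Prod>j<m. g (s j) ^ nat (n (Suc j) - n j) :: complex)"
  using \<open>m \<le> k\<close>
proof (induction m)
  case (Suc m)
  have m: "m < k" "n m \<le> n (Suc m)" "n 0 \<le> n m"
    using Suc.prems mono breakpoints_mono[OF mono, of 0 m] by auto
  have "block_value k n s l = s m" if "l \<in> {n m..<n (Suc m)}" for l
  proof -
    have "n 0 \<le> l" using that m by simp
    then obtain j0 where "j0 \<le> k" "\<And>j. j \<le> k \<Longrightarrow> n j \<le> l \<longleftrightarrow> j \<le> j0" "block_value k n s l = s j0"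
      using block_valueE[OF mono] by metis
    moreover from this(2)[of m] this(2)[of "Suc m"] that m have "j0 = m" by auto
    ultimately show ?thesis by simp
  qed
  then have "(\<Prod>l\<in>{n m..<n (Suc m)}. g (block_value k n s l)) = g (s m) ^ nat (n (Suc m) - n m)"
    by simp
  moreover have "{n 0..<n (Suc m)} = {n 0..<n m} \<union> {n m..<n (Suc m)}" using m by auto
  ultimately show ?case
    using Suc by (simp add: prod.union_disjoint)
qed simp

theorem theorem5:
  fixes a :: "('n::finite) matrix_fun"
    and k :: nat and n :: "nat \<Rightarrow> int" and s :: "nat \<Rightarrow> complex"
  assumes "k \<ge> 1"
    and "n 0 = 0"
    and "\<forall>j<k. n j \<le> n (Suc j)"
    and "\<forall>j\<in>{1..k}. s k - s j \<noteq> -1"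
    and "s 0 = 0"
    and "a \<in> Phi_r_K11"
  shows "let A = (\<Sum>j=1..k. (s j - s (j - 1)) *\<^sub>o
                   (op_P - (laurent_op a \<circ> op_Qn (n j) \<circ> laurent_op (fun_inv a))));
             B = (\<Sum>j=1..k. (s k * s j / (1 + s k - s j)) *\<^sub>o block_proj k n j)
                   \<circ> laurent_op (fun_inv a) \<circ> op_Q \<circ> laurent_op a
         in trace_class A \<and> trace_class B \<and>
            fredholm_det (id + A) =
              (\<Prod>j<k. (1 + s k - s j) ^ (CARD('n) * nat (n (Suc j) - n j))) * fredholm_det (id - B)"
proof -
  note mono = assms(3)
  obtain um up where a: "a \<in> Linf"
    and um: "ae_invertible um" "um \<in> K11" "um \<in> Hinf_minus" "fun_inv um \<in> K11" "fun_inv um \<in> Hinf_minus"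
    and up: "ae_invertible up" "up \<in> K11" "up \<in> Hinf_plus" "fun_inv up \<in> K11" "fun_inv up \<in> Hinf_plus"
    and eq: "AE \<theta> in angle_measure. a (cis \<theta>) = um (cis \<theta>) ** up (cis \<theta>)"
    using assms(6) by (auto simp: Phi_r_K11_def)
  define Um Umi Up Upi where defs: "Um = laurent_mat um" "Umi = laurent_mat (fun_inv um)"
    "Up = laurent_mat up" "Upi = laurent_mat (fun_inv up)"
  define L Li where LLi: "L = Um * Up" "Li = Upi * Umi"
  have repr: "represents (laurent_op a) L" "represents (laurent_op (fun_inv a)) Li"
    unfolding LLi defs by (rule laurent_mat_factorization[OF a um(2,4,1) up(2,4,1) eq])+
  define \<gamma> where "\<gamma> = (\<lambda>j. s k * s j / (1 + s k - s j))"
  have \<gamma>0: "\<gamma> 0 = 0" using assms(5) by (simp add: \<gamma>_def)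
  define D C where DC: "D = (block_diag k n s :: 'n idx bmat)" "C = (block_diag k n \<gamma> :: 'n idx bmat)"
  have dc: "(1 + s k - block_value k n s l) * block_value k n \<gamma> l = s k * block_value k n s l" for l
  proof (cases "l < n 0")
    case False
    then obtain j where j: "j \<le> k" "\<And>\<sigma>. block_value k n \<sigma> l = \<sigma> j"
      using block_valueE[OF mono, of l] by (metis not_less)
    have "j = 0 \<or> 1 + s k - s j \<noteq> 0"
      using assms(4) j(1) by (cases j) (force simp: algebra_simps add_eq_0_iff2)+
    then show ?thesis
      using assms(5) by (auto simp: j \<gamma>_def)
  qed (simp add: block_value_def)
  have large: "block_value k n s l = s k" if "l \<ge> n k" for l
  proof -
    have "n 0 \<le> l" using that breakpoints_mono[OF mono, of 0 k] by simp
    then obtain j where "j \<le> k" "\<And>i. i \<le> k \<Longrightarrow> n i \<le> l \<longleftrightarrow> i \<le> j" "block_value k n s l = s j"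
      using block_valueE[OF mono, of l] by metis
    with that show ?thesis by force
  qed
  have inv: "Um * Umi = 1" "Umi * Um = 1" "Up * Upi = 1" "Upi * Up = 1"
    unfolding defs by (rule laurent_mat_inverse[OF um(2,4,1)] laurent_mat_inverse[OF up(2,4,1)])+
  have tri: "proj_P * Um * proj_Q = 0" "proj_P * Umi * proj_Q = 0"
    "proj_Q * Up * proj_P = 0" "proj_Q * Upi * proj_P = 0"
    unfolding defs using um up by (simp_all add: laurent_mat_minus_upper laurent_mat_plus_lower)
  have sum: "summable_entries (proj_Q * Um * proj_P)" "summable_entries (proj_P * Up * proj_Q)"
    unfolding defs by (rule summable_entries_hankel[OF um(2)] summable_entries_hankel[OF up(2)])+
  have neg: "block_value k n \<sigma> l = 0" if "l < 0" for l \<sigma>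
    using that assms(2) by (simp add: block_value_def)
  have "summable_entries (scal (s k) * proj_P - L * D * Li)"
    and "summable_entries (C * (Li * proj_Q * L))"
    and "bdet (scal (s k) * proj_P - L * D * Li) =
      (\<Prod>l\<in>{0..<n k}. (1 + s k - block_value k n s l) ^ CARD('n)) * bdet (- (C * (Li * proj_Q * L)))"
    unfolding DC LLi
    using bdet_wiener_hopf[OF inv tri sum bounded_block_value bounded_block_value neg neg large dc] by blast+
  note core = this
  define A :: "'n oper" where "A = (\<Sum>j=1..k. (s j - s (j - 1)) *\<^sub>o
      (op_P - (laurent_op a \<circ> op_Qn (n j) \<circ> laurent_op (fun_inv a))))"
  define B :: "'n oper" where "B = (\<Sum>j=1..k. (s k * s j / (1 + s k - s j)) *\<^sub>o block_proj k n j)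
      \<circ> laurent_op (fun_inv a) \<circ> op_Q \<circ> laurent_op a"
  have "represents A (\<Sum>j=1..k. scal (s j - s (j - 1)) * (proj_P - L * mat_Qn (n j) * Li))"
    unfolding A_def
    by (intro represents_sum represents_scale represents_diff represents_P represents_comp represents_Qn repr)
  also have "(\<Sum>j=1..k. scal (s j - s (j - 1)) * (proj_P - L * mat_Qn (n j) * Li)) =
      scal (s k) * proj_P - L * D * Li"
  proof -
    have P: "(\<Sum>j=1..k. scal (s j - s (j - 1)) * proj_P) = (scal (s k) * proj_P :: 'n idx bmat)"
    proof (rule bmat_eqI)
      fix p q :: "'n idx"
      show "entry (\<Sum>j=1..k. scal (s j - s (j - 1)) * proj_P) p q = entry (scal (s k) * proj_P) p q"
        unfolding entry_sum entry_scal_times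
        unfolding sum_distrib_right[symmetric] sum_increments assms(5) by simp
    qed
    have "L * D * Li = (\<Sum>j=1..k. L * (scal (s j - s (j - 1)) * mat_Qn (n j)) * Li)"
      unfolding DC sum_telescope_Qn[where k=k and n=n and s=s, OF mono assms(5), symmetric]
      by (simp only: sum_distrib_left sum_distrib_right)
    also have "\<dots> = (\<Sum>j=1..k. scal (s j - s (j - 1)) * (L * mat_Qn (n j) * Li))"
    proof (rule sum.cong[OF refl])
      fix j
      show "L * (scal (s j - s (j - 1)) * mat_Qn (n j)) * Li = scal (s j - s (j - 1)) * (L * mat_Qn (n j) * Li)"
        using arg_cong[OF scal_commute[of L "s j - s (j - 1)"], of "\<lambda>x. x * mat_Qn (n j) * Li"]
        by (simp only: mult.assoc)
    qed
    finally show ?thesis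
      by (simp only: right_diff_distrib sum_subtractf P)
  qed
  finally have A: "represents A (scal (s k) * proj_P - L * D * Li)" .
  have "represents B ((\<Sum>j=1..k. scal (\<gamma> j) * (mat_Qn (n j) - (if j < k then mat_Qn (n (Suc j)) else 0))) * Li * proj_Q * L)"
    unfolding B_def \<gamma>_def block_proj_def
    by (intro represents_sum represents_scale represents_diff represents_Q represents_comp represents_Qn repr)
       (auto intro: represents_Qn represents_zero)
  then have B: "represents B (C * (Li * proj_Q * L))"
    unfolding sum_block_proj[where k=k and n=n and \<sigma>=\<gamma>, OF mono \<gamma>0] DC by (simp only: mult.assoc)
  have mB: "represents (- B) (- (C * (Li * proj_Q * L)))"
    using represents_diff[OF represents_zero B] by simp
  have idB: "id - B = id + - B" by simp
  have "(\<Prod>l\<in>{0..<n k}. (1 + s k - block_value k n s l) ^ CARD('n)) =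
      (\<Prod>j<k. (1 + s k - s j) ^ (CARD('n) * nat (n (Suc j) - n j)))"
    using prod_block_value[OF mono order_refl, of "\<lambda>x. (1 + s k - x) ^ CARD('n)" s] assms(2)
    by (simp add: power_mult)
  then have "trace_class A \<and> trace_class B \<and> fredholm_det (id + A) =
      (\<Prod>j<k. (1 + s k - s j) ^ (CARD('n) * nat (n (Suc j) - n j))) * fredholm_det (id - B)"
    using trace_class_represents[OF A core(1)] trace_class_represents[OF B core(2)] core(3)
    unfolding idB fredholm_det_represents[OF A] fredholm_det_represents[OF mB] by simp
  then show ?thesis
    unfolding A_def B_def by (simp only: Let_def)
qed

end
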